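(* For every integer $n>2$, the number of pairs $(s,t)\in S_n\times S_n$ such that $[s,t]=sts^{-1}t^{-1}$ is a $3$-cycle and $\langle s,t\rangle$ equals $A_n$ or $S_n$ is $$\#\mathcal{A}(n)=\frac{3}{8}(n-2)\,J_2(n)\,n!.$$
   Context: Permutations compose as functions. $J_2(n)=n^2\prod_{p\mid n,\ p\text{ prime}}(1-p^{-2})$ is Jordan's totient function of order $2$. *)

theory Defs
  imports Complex_Main "HOL-Algebra.Sym_Groups" "HOL-Computational_Algebra.Primes"
begin

definition jordan_totient2 :: "nat \<Rightarrow> real" where
  "jordan_totient2 n = real n ^ 2 * (\<Prod>p\<in>prime_factors n. (1 - 1 / real p ^ 2))"

definition pairsA :: "nat \<Rightarrow> ((nat \<Rightarrow> nat) \<times> (nat \<Rightarrow> nat)) set" where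
  "pairsA n = {(s, t). s \<in> carrier (sym_group n) \<and> t \<in> carrier (sym_group n) \<and>
      s \<circ> t \<circ> inv' s \<circ> inv' t \<in> three_cycles n \<and>
      (generate (sym_group n) {s, t} = carrier (alt_group n) \<or>
       generate (sym_group n) {s, t} = carrier (sym_group n))}"

end

(* A pair (s,t) is a square-tiled surface with n labelled squares: s moves to the right
   neighbour and t to the upper one. Put c = [s,t]. The permutation t s t^-1 = c^-1 s is conjugate
   to s, so it has the same orbit lengths; when c is a 3-cycle this forces its three points (the
   singular corners) to lie either on one s-orbit or on exactly two. Cutting along the s-orbits
   through the corners presents the surface as one or two cylinders with explicit widths, heights
   and twists, and the labellings of a given surface account for the factor n!.
   By Jordan's argument a group containing c contains A_n as soon as no invariant equivalence
   relation other than the total one identifies the points of c. Modulo such a relation s and t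
   commute, so this says that the period lattice of the surface is all of Z^2, which is a gcd
   condition on the cylinder data.
   Let P(n) be the resulting weighted number of cylinder data. Dividing arbitrary data by its period
   lattice shows that the convolution of P with the divisor sum sigma counts all data, and the
   classical evaluation of sum sigma(k) sigma(n-k) gives that count in closed form. The function
   (3/8)(n-2) J_2(n), corrected at n = 1, has the same convolution with sigma, hence equals P. *)

theory Submission
  imports Defs "HOL-Number_Theory.Totient"
begin

section \<open>A convolution identity for divisor sums\<close>

text \<open>The surfaces have genus 2 and one cone point of angle 6 pi; it is the lower left corner
  of exactly three squares, the points of \<open>c\<close>. Labels cost exactly n! because
  \<open>s\<close> and \<open>t\<close> determine the cylinder data and the labelling once a base
  corner is fixed. With two cylinders the base is canonical: one corner is alone on its
  \<open>s\<close>-orbit, and the cyclic order of \<open>c\<close> tells the other two apart. With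
  one cylinder each of the three corners can serve, whence a weight 1/3 in P. No geometry enters the
  cylinder decomposition. It rests on one number, the sum of the squares of the orbit lengths, which
  is the same for \<open>s\<close> and for its conjugate. That number rules out three corners on
  three orbits, shows that corners on one orbit give the conjugate the same orbits, and in the
  remaining case forces the length of the wide orbit to be the narrow length plus the distance
  between the two corners on it.\<close>

definition divisor_power_sum :: "nat \<Rightarrow> nat \<Rightarrow> real" where
  "divisor_power_sum k n = (\<Sum>d | d dvd n. real d ^ k)"

lemma finite_divisors: "n > 0 \<Longrightarrow> finite {d. d dvd (n::nat)}"
  by simp

lemma sum_divisors_flip:
  fixes f :: "nat \<Rightarrow> real"
  assumes "n > 0"
  shows "(\<Sum>d | d dvd n. f (n div d)) = (\<Sum>d | d dvd n. f d)"
  by (rule sum.reindex_bij_witness[of _ "\<lambda>d. n div d" "\<lambda>d. n div d"])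
     (use assms in \<open>auto simp: div_dvd_iff_mult elim!: dvdE\<close>)

text \<open>Both sides run over the pairs with \<open>m * e dvd n\<close>.\<close>

lemma sum_divisors_swap:
  fixes f :: "nat \<Rightarrow> nat \<Rightarrow> real"
  assumes "n > 0"
  shows "(\<Sum>m | m dvd n. \<Sum>e | e dvd n div m. f m e) = (\<Sum>e | e dvd n. \<Sum>m | m dvd n div e. f m e)"
proof -
  have fin: "\<forall>m\<in>{m. m dvd n}. finite {e. e dvd n div m}"
    using assms by (auto intro!: finite_divisors elim!: dvdE)
  have fin': "finite {m. m dvd n}" using assms by simp
  have *: "e dvd n \<and> m dvd n div e" if "m dvd n" "e dvd n div m" for m e :: nat
    using that assms by (auto elim!: dvdE)
  show ?thesis
    unfolding sum.Sigma[OF fin' fin]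
    by (rule sum.reindex_bij_witness[of _ "\<lambda>(e,m). (m,e)" "\<lambda>(m,e). (e,m)"]) (auto dest: *)
qed

text \<open>Serves twice. Summing \<open>a * b\<close> over it gives the convolution of \<sigma>
  with itself, \<open>a\<close> and \<open>b\<close> being the divisors and \<open>x\<close>,
  \<open>y\<close> their cofactors; later \<open>a\<close>, \<open>b\<close> are the widths and
  \<open>x\<close>, \<open>y\<close> the heights of two cylinders of total area
  \<open>n\<close>.\<close>

definition quads :: "nat \<Rightarrow> (nat \<times> nat \<times> nat \<times> nat) set" where
  "quads n = {(a, b, x, y). 0 < a \<and> 0 < b \<and> 0 < x \<and> 0 < y \<and> a * x + b * y = n}"

lemma finite_quads: "finite (quads n)"
proof (rule finite_subset)
  show "quads n \<subseteq> {..n} \<times> {..n} \<times> {..n} \<times> {..n}"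
  proof
    fix q assume "q \<in> quads n"
    then obtain a b x y where q: "q = (a, b, x, y)" "0 < a" "0 < b" "0 < x" "0 < y" "a * x + b * y = n"
      by (auto simp: quads_def)
    have "a \<le> a * x" "x \<le> a * x" "b \<le> b * y" "y \<le> b * y"
      using q by simp_all
    hence "a \<le> n" "b \<le> n" "x \<le> n" "y \<le> n"
      using q(6) by linarith+
    thus "q \<in> {..n} \<times> {..n} \<times> {..n} \<times> {..n}" using q(1) by simp
  qed
qed simp

lemma sum_quads_sym:
  fixes f :: "nat \<Rightarrow> nat \<Rightarrow> nat \<Rightarrow> nat \<Rightarrow> real"
  shows "(\<Sum>(a, b, x, y) | (a, b, x, y) \<in> quads n \<and> P a b x y. f a b x y) =
    (\<Sum>(a, b, x, y) | (a, b, x, y) \<in> quads n \<and> P b a y x. f b a y x)"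
  by (rule sum.reindex_bij_witness[of _ "\<lambda>(a,b,x,y). (b,a,y,x)" "\<lambda>(a,b,x,y). (b,a,y,x)"])
     (auto simp: quads_def add.commute)

text \<open>Liouville's substitution: \<open>(a, b, x, y) \<mapsto> (a - b, b, x, x + y)\<close> preserves \<open>a x + b y\<close>.\<close>

lemma sum_quads_shear:
  fixes f :: "nat \<Rightarrow> nat \<Rightarrow> real"
  shows "(\<Sum>(a, b, x, y) | (a, b, x, y) \<in> quads n \<and> b < a. f a b) =
    (\<Sum>(a, b, x, y) | (a, b, x, y) \<in> quads n \<and> x < y. f (a + b) b)"
proof (rule sum.reindex_bij_witness[of _ "\<lambda>(a,b,x,y). (a+b,b,x,y-x)" "\<lambda>(a,b,x,y). (a-b,b,x,y+x)"], goal_cases)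
  case (4 q)
  obtain a b x y where q: "q = (a, b, x, y)" by (cases q) auto
  have "x < y" "a * x + b * y = n" using 4 q by (auto simp: quads_def)
  hence "(a + b) * x + b * (y - x) = n"
    by (simp add: algebra_simps diff_mult_distrib2)
  thus ?case using 4 q by (auto simp: quads_def)
next
  case (2 q)
  obtain a b x y where q: "q = (a, b, x, y)" by (cases q) auto
  have "b < a" "a * x + b * y = n" using 2 q by (auto simp: quads_def)
  moreover from this obtain d where "a = b + d" using less_imp_add_positive by blast
  ultimately have "(a - b) * x + b * (y + x) = n"
    by (simp add: algebra_simps)
  thus ?case using 2 q by (auto simp: quads_def)
qed (auto simp: quads_def)

text \<open>For \<open>x = y\<close> the equation reads \<open>(a + b) * x = n\<close>, so
  \<open>a + b\<close> is the divisor and \<open>a\<close> is free below it.\<close>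

lemma sum_quads_eq_right:
  fixes f :: "nat \<Rightarrow> nat \<Rightarrow> real"
  assumes "n > 0"
  shows "(\<Sum>(a, b, x, y) | (a, b, x, y) \<in> quads n \<and> x = y. f a b) = (\<Sum>d | d dvd n. \<Sum>a\<in>{1..<d}. f a (d - a))"
proof -
  have "(\<Sum>d | d dvd n. \<Sum>a\<in>{1..<d}. f a (d - a)) = (\<Sum>(d, a) \<in> Sigma {d. d dvd n} (\<lambda>d. {1..<d}). f a (d - a))"
    using assms by (intro sum.Sigma) auto
  also have "\<dots> = (\<Sum>(a, b, x, y) | (a, b, x, y) \<in> quads n \<and> x = y. f a b)"
    by (rule sum.reindex_bij_witness[of _ "\<lambda>(a,b,x,y). (a+b,a)" "\<lambda>(d,a). (a,d-a,n div d,n div d)"])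
       (use assms in \<open>auto simp: quads_def dvd_def simp flip: distrib_right\<close>)
  finally show ?thesis ..
qed

text \<open>For \<open>a = b\<close> the divisor is \<open>a\<close> itself, and
  \<open>n div d - 1\<close> counts the splittings of its cofactor into positive
  \<open>x + y\<close>.\<close>

lemma sum_quads_eq_left:
  fixes f :: "nat \<Rightarrow> real"
  assumes "n > 0"
  shows "(\<Sum>(a, b, x, y) | (a, b, x, y) \<in> quads n \<and> a = b. f a) = (\<Sum>d | d dvd n. real (n div d - 1) * f d)"
proof -
  have "(\<Sum>d | d dvd n. real (n div d - 1) * f d) = (\<Sum>d | d dvd n. \<Sum>x\<in>{1..<n div d}. f d)"
    by simp
  also have "\<dots> = (\<Sum>(d, x) \<in> Sigma {d. d dvd n} (\<lambda>d. {1..<n div d}). f d)"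
    using assms by (intro sum.Sigma) auto
  also have "\<dots> = (\<Sum>(a, b, x, y) | (a, b, x, y) \<in> quads n \<and> a = b. f a)"
    by (rule sum.reindex_bij_witness[of _ "\<lambda>(a,b,x,y). (a,x)" "\<lambda>(d,x). (d,d,x,n div d-x)"])
       (use assms in \<open>auto simp: quads_def dvd_def add_mult_distrib2[symmetric] add.commute\<close>)
  finally show ?thesis ..
qed

text \<open>The statistics \<open>u\<close>, \<open>v\<close> are arbitrary because the argument
  compares \<open>a\<close> with \<open>b\<close> in some places and \<open>x\<close> with
  \<open>y\<close> in others.\<close>

lemma sum_quads_split:
  fixes f :: "nat \<Rightarrow> nat \<Rightarrow> nat \<Rightarrow> nat \<Rightarrow> real" and u v :: "nat \<Rightarrow> nat \<Rightarrow> nat \<Rightarrow> nat \<Rightarrow> nat"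
  shows "(\<Sum>(a, b, x, y) \<in> quads n. f a b x y) =
    (\<Sum>(a, b, x, y) | (a, b, x, y) \<in> quads n \<and> u a b x y < v a b x y. f a b x y) +
    (\<Sum>(a, b, x, y) | (a, b, x, y) \<in> quads n \<and> v a b x y < u a b x y. f a b x y) +
    (\<Sum>(a, b, x, y) | (a, b, x, y) \<in> quads n \<and> u a b x y = v a b x y. f a b x y)"
proof -
  let ?S = "\<lambda>R. {(a, b, x, y). (a, b, x, y) \<in> quads n \<and> R (u a b x y) (v a b x y)}"
  have fin: "finite (?S R)" for R :: "nat \<Rightarrow> nat \<Rightarrow> bool"
    by (rule finite_subset[OF _ finite_quads[of n]]) auto
  have "quads n = (?S (<) \<union> ?S (\<lambda>p q. q < p)) \<union> ?S (=)" by auto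
  hence "(\<Sum>(a, b, x, y) \<in> quads n. f a b x y) = (\<Sum>(a, b, x, y) \<in> (?S (<) \<union> ?S (\<lambda>p q. q < p)) \<union> ?S (=). f a b x y)"
    by simp
  also have "\<dots> = (\<Sum>(a, b, x, y) \<in> ?S (<) \<union> ?S (\<lambda>p q. q < p). f a b x y) + (\<Sum>(a, b, x, y) \<in> ?S (=). f a b x y)"
    by (rule sum.union_disjoint) (use fin in auto)
  also have "(\<Sum>(a, b, x, y) \<in> ?S (<) \<union> ?S (\<lambda>p q. q < p). f a b x y) =
      (\<Sum>(a, b, x, y) \<in> ?S (<). f a b x y) + (\<Sum>(a, b, x, y) \<in> ?S (\<lambda>p q. q < p). f a b x y)"
    by (rule sum.union_disjoint) (use fin in auto)
  finally show ?thesis .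
qed

lemma sum_squares_below: "(\<Sum>a\<in>{1..<d}. real a ^ 2) = real d ^ 3 / 3 - real d ^ 2 / 2 + real d / 6"
proof (induction d)
  case (Suc d)
  thus ?case by (cases "d = 0") (auto simp: field_simps power2_eq_square power3_eq_cube)
qed simp

text \<open>Liouville's elementary proof. Write -4ab as (a - b)^2 - (a + b)^2. The shear turns the
  first square into \<open>a^2\<close> summed over \<open>x < y\<close>, and the second into
  \<open>a^2\<close> summed over \<open>b < a\<close>, up to the diagonal \<open>x = y\<close>. The
  two off-diagonal sums differ only by diagonal ones, and those are plain sums over
  divisors.\<close>

theorem convolution_divisor_sums:
  assumes "n > 0"
  shows "(\<Sum>(a, b, x, y) \<in> quads n. real a * real b) =
    5/12 * divisor_power_sum 3 n + 1/12 * divisor_power_sum 1 n - real n / 2 * divisor_power_sum 1 n"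
proof -
  let ?S = "\<lambda>f P. \<Sum>(a, b, x, y) | (a, b, x, y) \<in> quads n \<and> P a b x y. (f a b :: real)"
  let ?C = "\<Sum>(a, b, x, y) \<in> quads n. real a * real b"
  have minus: "(\<Sum>(a, b, x, y) \<in> quads n. (real a - real b)^2) = 2 * ?S (\<lambda>a b. real a ^ 2) (\<lambda>a b x y. x < y)"
  proof -
    have "(\<Sum>(a, b, x, y) \<in> quads n. (real a - real b)^2) =
       ?S (\<lambda>a b. (real a - real b)^2) (\<lambda>a b x y. a < b) + ?S (\<lambda>a b. (real a - real b)^2) (\<lambda>a b x y. b < a)
       + ?S (\<lambda>a b. (real a - real b)^2) (\<lambda>a b x y. a = b)"
      by (rule sum_quads_split)
    moreover have "?S (\<lambda>a b. (real a - real b)^2) (\<lambda>a b x y. a = b) = 0"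
      by (rule sum.neutral) auto
    moreover have "?S (\<lambda>a b. (real a - real b)^2) (\<lambda>a b x y. a < b) = ?S (\<lambda>a b. (real b - real a)^2) (\<lambda>a b x y. b < a)"
      by (rule sum_quads_sym)
    moreover have "\<dots> = ?S (\<lambda>a b. (real a - real b)^2) (\<lambda>a b x y. b < a)"
      by (simp add: power2_commute)
    moreover have "?S (\<lambda>a b. (real a - real b)^2) (\<lambda>a b x y. b < a) = ?S (\<lambda>a b. (real (a + b) - real b)^2) (\<lambda>a b x y. x < y)"
      by (rule sum_quads_shear)
    ultimately show ?thesis by simp
  qed
  have plus: "(\<Sum>(a, b, x, y) \<in> quads n. (real a + real b)^2) =
     2 * ?S (\<lambda>a b. real a ^ 2) (\<lambda>a b x y. b < a) + ?S (\<lambda>a b. (real a + real b)^2) (\<lambda>a b x y. x = y)"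
  proof -
    have "(\<Sum>(a, b, x, y) \<in> quads n. (real a + real b)^2) =
       ?S (\<lambda>a b. (real a + real b)^2) (\<lambda>a b x y. x < y) + ?S (\<lambda>a b. (real a + real b)^2) (\<lambda>a b x y. y < x)
       + ?S (\<lambda>a b. (real a + real b)^2) (\<lambda>a b x y. x = y)"
      by (rule sum_quads_split)
    also have "?S (\<lambda>a b. (real a + real b)^2) (\<lambda>a b x y. y < x) = ?S (\<lambda>a b. (real b + real a)^2) (\<lambda>a b x y. x < y)"
      by (rule sum_quads_sym)
    also have "\<dots> = ?S (\<lambda>a b. (real a + real b)^2) (\<lambda>a b x y. x < y)"
      by (simp add: add.commute)
    also have "\<dots> = ?S (\<lambda>a b. real (a + b) ^ 2) (\<lambda>a b x y. x < y)" by simp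
    also have "\<dots> = ?S (\<lambda>a b. real a ^ 2) (\<lambda>a b x y. b < a)"
      by (rule sum_quads_shear[symmetric])
    finally show ?thesis by (simp only: mult_2)
  qed
  \<comment> \<open>Sum \<open>a^2\<close> over all quadruples, once split by \<open>a\<close>
    against \<open>b\<close> and once by \<open>x\<close> against \<open>y\<close>. The part
    \<open>a < b\<close> equals the part \<open>y < x\<close>, by symmetry, shear and symmetry
    again, and cancels.\<close>
  have diff: "?S (\<lambda>a b. real a ^ 2) (\<lambda>a b x y. x < y) - ?S (\<lambda>a b. real a ^ 2) (\<lambda>a b x y. b < a) =
     ?S (\<lambda>a b. real a ^ 2) (\<lambda>a b x y. a = b) - ?S (\<lambda>a b. real a ^ 2) (\<lambda>a b x y. x = y)"
  proof -
    have 1: "(\<Sum>(a, b, x, y) \<in> quads n. real a ^ 2) = ?S (\<lambda>a b. real a ^ 2) (\<lambda>a b x y. a < b)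
      + ?S (\<lambda>a b. real a ^ 2) (\<lambda>a b x y. b < a) + ?S (\<lambda>a b. real a ^ 2) (\<lambda>a b x y. a = b)"
      by (rule sum_quads_split)
    have 2: "(\<Sum>(a, b, x, y) \<in> quads n. real a ^ 2) = ?S (\<lambda>a b. real a ^ 2) (\<lambda>a b x y. x < y)
      + ?S (\<lambda>a b. real a ^ 2) (\<lambda>a b x y. y < x) + ?S (\<lambda>a b. real a ^ 2) (\<lambda>a b x y. x = y)"
      by (rule sum_quads_split)
    have "?S (\<lambda>a b. real a ^ 2) (\<lambda>a b x y. a < b) = ?S (\<lambda>a b. real b ^ 2) (\<lambda>a b x y. b < a)"
      by (rule sum_quads_sym)
    also have "\<dots> = ?S (\<lambda>a b. real b ^ 2) (\<lambda>a b x y. x < y)" by (rule sum_quads_shear)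
    also have "\<dots> = ?S (\<lambda>a b. real a ^ 2) (\<lambda>a b x y. y < x)" by (rule sum_quads_sym)
    finally show ?thesis using 1 2 by linarith
  qed
  have "- 4 * ?C = (\<Sum>(a, b, x, y) \<in> quads n. (real a - real b)^2) - (\<Sum>(a, b, x, y) \<in> quads n. (real a + real b)^2)"
    unfolding sum_distrib_left sum_subtractf[symmetric]
    by (rule sum.cong) (auto simp: power2_eq_square algebra_simps)
  also have "\<dots> = 2 * ?S (\<lambda>a b. real a ^ 2) (\<lambda>a b x y. a = b) - 2 * ?S (\<lambda>a b. real a ^ 2) (\<lambda>a b x y. x = y)
     - ?S (\<lambda>a b. (real a + real b)^2) (\<lambda>a b x y. x = y)"
    using plus minus diff by linarith
  also have "\<dots> = (\<Sum>d | d dvd n. 2 * (real n * real d - real d ^ 2)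
       - 2 * (real d ^ 3 / 3 - real d ^ 2 / 2 + real d / 6) - (real d ^ 3 - real d ^ 2))"
  proof -
    have "?S (\<lambda>a b. real a ^ 2) (\<lambda>a b x y. a = b) = (\<Sum>d | d dvd n. real (n div d - 1) * real d ^ 2)"
      using assms by (rule sum_quads_eq_left)
    also have "\<dots> = (\<Sum>d | d dvd n. real n * real d - real d ^ 2)"
    proof (rule sum.cong)
      fix d assume "d \<in> {d. d dvd n}"
      then obtain e where "n = d * e" "d > 0" "e \<ge> 1" using assms by (auto elim!: dvdE)
      thus "real (n div d - 1) * real d ^ 2 = real n * real d - real d ^ 2"
        by (simp add: of_nat_diff power2_eq_square algebra_simps)
    qed simp
    finally have A: "?S (\<lambda>a b. real a ^ 2) (\<lambda>a b x y. a = b) = (\<Sum>d | d dvd n. real n * real d - real d ^ 2)" .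
    have B: "?S (\<lambda>a b. real a ^ 2) (\<lambda>a b x y. x = y) = (\<Sum>d | d dvd n. real d ^ 3 / 3 - real d ^ 2 / 2 + real d / 6)"
      using assms by (subst sum_quads_eq_right) (simp_all only: sum_squares_below)
    have C: "?S (\<lambda>a b. (real a + real b) ^ 2) (\<lambda>a b x y. x = y) = (\<Sum>d | d dvd n. real d ^ 3 - real d ^ 2)"
    proof -
      have "(\<Sum>a\<in>{1..<d}. (real a + real (d - a)) ^ 2) = real d ^ 3 - real d ^ 2" if "d dvd n" for d
      proof -
        have "d > 0" using that assms by (auto intro: Nat.gr0I)
        have "(\<Sum>a\<in>{1..<d}. (real a + real (d - a)) ^ 2) = (\<Sum>a\<in>{1..<d}. real d ^ 2)"
          by (rule sum.cong) (auto simp: of_nat_diff)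
        thus ?thesis using \<open>d > 0\<close>
          by (simp add: of_nat_diff algebra_simps power2_eq_square power3_eq_cube)
      qed
      thus ?thesis using assms by (subst sum_quads_eq_right) simp_all
    qed
    show ?thesis by (simp only: A B C sum_distrib_left sum_subtractf[symmetric])
  qed
  also have "\<dots> = (\<Sum>d | d dvd n. 2 * real n * real d ^ 1 - 5/3 * real d ^ 3 - 1/3 * real d ^ 1)"
    by (rule sum.cong) (auto simp: field_simps)
  also have "\<dots> = 2 * real n * divisor_power_sum 1 n - 5/3 * divisor_power_sum 3 n - 1/3 * divisor_power_sum 1 n"
    unfolding divisor_power_sum_def sum_distrib_left sum_subtractf by simp
  finally show ?thesis by (simp add: field_simps)
qed

text \<open>The first sum counts arbitrary two-cylinder data, the narrow cylinder first, with all
  \<open>a * b\<close> twists; the binomials count arbitrary one-cylinder data of width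
  \<open>l\<close>. Each contains half the sum of the squares of the divisors, with opposite signs,
  so that only the total has so simple a form.\<close>

lemma sum_quads_less:
  assumes "n > 0"
  shows "(\<Sum>(a, b, x, y) | (a, b, x, y) \<in> quads n \<and> a < b. real a * real b) + (\<Sum>l | l dvd n. real (l choose 3)) =
    3/8 * (divisor_power_sum 3 n + divisor_power_sum 1 n - 2 * real n * divisor_power_sum 1 n)"
proof -
  let ?S = "\<lambda>f P. \<Sum>(a, b, x, y) | (a, b, x, y) \<in> quads n \<and> P a b x y. (f a b :: real)"
  have "(\<Sum>(a, b, x, y) \<in> quads n. real a * real b) = ?S (\<lambda>a b. real a * real b) (\<lambda>a b x y. a < b)
      + ?S (\<lambda>a b. real a * real b) (\<lambda>a b x y. b < a) + ?S (\<lambda>a b. real a * real b) (\<lambda>a b x y. a = b)"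
    by (rule sum_quads_split)
  moreover have "?S (\<lambda>a b. real a * real b) (\<lambda>a b x y. b < a) = ?S (\<lambda>a b. real b * real a) (\<lambda>a b x y. a < b)"
    by (rule sum_quads_sym)
  moreover have "\<dots> = ?S (\<lambda>a b. real a * real b) (\<lambda>a b x y. a < b)"
    by (simp add: mult.commute)
  moreover have "?S (\<lambda>a b. real a * real b) (\<lambda>a b x y. a = b) = ?S (\<lambda>a b. real a * real a) (\<lambda>a b x y. a = b)"
    by (rule sum.cong) auto
  moreover have "\<dots> = (\<Sum>d | d dvd n. real (n div d - 1) * (real d * real d))"
    using assms by (rule sum_quads_eq_left)
  moreover have "\<dots> = (\<Sum>d | d dvd n. real n * real d ^ 1 - real d ^ 2)"
  proof (rule sum.cong)
    fix d assume "d \<in> {d. d dvd n}"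
    then obtain e where "n = d * e" "d > 0" "e \<ge> 1" using assms by (auto elim!: dvdE)
    thus "real (n div d - 1) * (real d * real d) = real n * real d ^ 1 - real d ^ 2"
      by (simp add: of_nat_diff power2_eq_square algebra_simps)
  qed simp
  moreover have "\<dots> = real n * divisor_power_sum 1 n - divisor_power_sum 2 n"
    unfolding divisor_power_sum_def sum_distrib_left sum_subtractf by simp
  moreover have "real (l choose 3) = 1/6 * real l ^ 3 - 1/2 * real l ^ 2 + 1/3 * real l ^ 1" for l
  proof (cases "l < 3")
    case True
    hence "l = 0 \<or> l = 1 \<or> l = 2" by auto
    thus ?thesis by (auto simp: binomial_eq_0)
  next
    case False
    have "real (l choose 3) = (\<Prod>i = 0..<3. real l - real i) / fact 3"
      by (simp add: binomial_gbinomial gbinomial_prod_rev)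
    also have "{0..<3::nat} = {0,1,2}" by auto
    finally show ?thesis by (simp add: fact_numeral field_simps power2_eq_square power3_eq_cube)
  qed
  hence "(\<Sum>l | l dvd n. real (l choose 3)) = 1/6 * divisor_power_sum 3 n - 1/2 * divisor_power_sum 2 n + 1/3 * divisor_power_sum 1 n"
    unfolding divisor_power_sum_def sum_distrib_left by (simp add: sum_subtractf sum.distrib)
  ultimately show ?thesis
    using convolution_divisor_sums[OF assms] by (simp add: algebra_simps)
qed

section \<open>Jordan's totient function\<close>

lemma jordan_totient2_1 [simp]: "jordan_totient2 (Suc 0) = 1"
  by (simp add: jordan_totient2_def)

lemma jordan_totient2_mult_coprime:
  assumes "coprime a b" "a > 0" "b > 0"
  shows "jordan_totient2 (a * b) = jordan_totient2 a * jordan_totient2 b"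
proof -
  have "prime_factors (a * b) = prime_factors a \<union> prime_factors b"
    using assms by (intro prime_factors_product) auto
  moreover have "prime_factors a \<inter> prime_factors b = {}"
    using assms(1) by (auto simp: in_prime_factors_iff) (meson coprime_common_divisor not_prime_unit)
  ultimately show ?thesis
    by (simp add: jordan_totient2_def prod.union_disjoint power_mult_distrib)
qed

lemma jordan_totient2_prime_power:
  assumes "prime p" "k > 0"
  shows "jordan_totient2 (p ^ k) = real p ^ (2 * k) - real p ^ (2 * (k - 1))"
proof -
  obtain j where k: "k = Suc j" using assms(2) by (cases k) auto
  have p0: "real p \<noteq> 0" using assms(1) by (simp add: prime_gt_0_nat)
  have "prime_factors (p ^ k) = {p}"
    using assms by (simp add: prime_factors_power prime_prime_factors)
  hence "jordan_totient2 (p ^ k) = real p ^ (2 * k) * (1 - 1 / real p ^ 2)"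
    by (simp add: jordan_totient2_def power_mult[symmetric] mult.commute)
  also have "\<dots> = real p ^ (2 * k) - real p ^ (2 * (k - 1))"
    using p0 by (simp add: k field_simps power_add power2_eq_square)
  finally show ?thesis .
qed

lemma sum_divisors_prime_power:
  fixes f :: "nat \<Rightarrow> real"
  assumes "prime p"
  shows "(\<Sum>d | d dvd p ^ k. f d) = (\<Sum>i\<le>k. f (p ^ i))"
proof -
  have "{d. d dvd p ^ k} = (\<lambda>i. p ^ i) ` {..k}"
    using divides_primepow_nat[OF assms] by auto
  moreover have "inj_on (\<lambda>i. p ^ i) {..k}"
    using assms by (auto simp: inj_on_def prime_gt_Suc_0_nat power_inject_exp)
  ultimately show ?thesis by (simp add: sum.reindex)
qed

text \<open>A divisor of \<open>a * b\<close> is the product of its gcd with \<open>a\<close> and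
  its gcd with \<open>b\<close>.\<close>

lemma sum_divisors_mult_coprime:
  fixes f g :: "nat \<Rightarrow> real"
  assumes "coprime a b" "a > 0" "b > 0"
    and f: "\<And>d e. d dvd a \<Longrightarrow> e dvd b \<Longrightarrow> f (d * e) = f d * f e"
  shows "(\<Sum>d | d dvd a * b. f d) = (\<Sum>d | d dvd a. f d) * (\<Sum>e | e dvd b. f e)"
proof -
  have gcd1: "gcd (d * e) a = d" "gcd (d * e) b = e" if "d dvd a" "e dvd b" for d e
  proof -
    have "coprime a e" using assms(1) that by (meson coprime_divisors dvd_refl)
    hence "gcd (d * e) a = gcd d a" by (rule gcd_mult_left_right_cancel)
    thus "gcd (d * e) a = d" using that by (simp add: gcd_nat.absorb1)
    have "coprime b d" using assms(1) that by (meson coprime_commute coprime_divisors dvd_refl)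
    hence "gcd (d * e) b = gcd e b" by (rule gcd_mult_left_left_cancel)
    thus "gcd (d * e) b = e" using that by (simp add: gcd_nat.absorb1)
  qed
  have split: "gcd d a * gcd d b = d" if "d dvd a * b" for d
    using division_decomp[OF that] gcd1 by metis
  have "(\<Sum>d | d dvd a. f d) * (\<Sum>e | e dvd b. f e) = (\<Sum>(d, e)\<in>{d. d dvd a} \<times> {e. e dvd b}. f d * f e)"
    by (simp add: sum_product sum.cartesian_product)
  also have "\<dots> = (\<Sum>d | d dvd a * b. f d)"
    by (rule sum.reindex_bij_witness[of _ "\<lambda>d. (gcd d a, gcd d b)" "\<lambda>(d, e). d * e"])
       (auto simp: gcd1 split f mult_dvd_mono)
  finally show ?thesis ..
qed

text \<open>Splitting off the full power of one prime reduces the claim to prime powers, where the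
  sum telescopes.\<close>

lemma jordan_totient2_divisor_sum:
  assumes "n > 0"
  shows "(\<Sum>d | d dvd n. jordan_totient2 d) = real n ^ 2"
  using assms
proof (induction n rule: less_induct)
  case (less n)
  show ?case
  proof (cases "n = 1")
    case False
    then obtain p where p: "prime p" "p dvd n" using prime_factor_nat by blast
    define k where "k = multiplicity p n"
    obtain m where m: "n = p ^ k * m" "\<not> p dvd m"
      using multiplicity_decompose'[of n p] less.prems p(1) unfolding k_def
      by (metis neq0_conv not_prime_unit)
    have k: "k > 0" using m p by (cases k) auto
    have m0: "m > 0" using m less.prems by (cases m) auto
    have cop: "coprime (p ^ k) m" using m p by (simp add: prime_imp_coprime)
    have "p ^ k > 1" using k p(1) by (metis One_nat_def one_less_power prime_gt_Suc_0_nat)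
    hence "m < n" using m m0 by simp
    have pp: "(\<Sum>i\<le>j. jordan_totient2 (p ^ i)) = real p ^ (2 * j)" for j
    proof (induction j)
      case (Suc j)
      have "jordan_totient2 (p ^ Suc j) = real p ^ (2 * Suc j) - real p ^ (2 * j)"
        using jordan_totient2_prime_power[OF p(1), of "Suc j"] by (simp only: diff_Suc_1 zero_less_Suc)
      thus ?case using Suc.IH by (simp only: sum.atMost_Suc)
    qed simp
    have "(\<Sum>d | d dvd n. jordan_totient2 d) =
        (\<Sum>d | d dvd p ^ k. jordan_totient2 d) * (\<Sum>d | d dvd m. jordan_totient2 d)"
      unfolding m(1)
    proof (rule sum_divisors_mult_coprime[OF cop])
      fix d e assume "d dvd p ^ k" "e dvd m"
      thus "jordan_totient2 (d * e) = jordan_totient2 d * jordan_totient2 e"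
        using cop m0 p(1) by (intro jordan_totient2_mult_coprime coprime_divisors[OF _ _ cop])
          (auto intro!: Nat.gr0I)
    qed (use p m0 in \<open>auto simp: prime_gt_0_nat\<close>)
    also have "\<dots> = real p ^ (2 * k) * real m ^ 2"
      using less.IH[OF \<open>m < n\<close> m0] by (simp add: sum_divisors_prime_power[OF p(1)] pp)
    finally show ?thesis by (simp add: m(1) power_mult_distrib power_mult[symmetric] mult.commute)
  qed simp
qed

lemma divisor_power_sum_1_flip:
  "n > 0 \<Longrightarrow> divisor_power_sum 1 n = (\<Sum>e | e dvd n. real (n div e))"
  unfolding divisor_power_sum_def by (subst sum_divisors_flip[symmetric]) auto

text \<open>In Dirichlet series, zeta(s) zeta(s-1) times zeta(s-3)/zeta(s-1) is zeta(s) zeta(s-3).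
  Concretely, with \<sigma>(k) written as the sum of \<open>k div e\<close>, the factor
  \<open>n div e\<close> comes out and leaves the divisor sum of Jordan's function at
  \<open>n div e\<close>.\<close>

lemma sum_sigma_mult_jordan_totient2:
  assumes "n > 0"
  shows "(\<Sum>m | m dvd n. divisor_power_sum 1 (n div m) * (real m * jordan_totient2 m)) = divisor_power_sum 3 n"
proof -
  have "(\<Sum>m | m dvd n. divisor_power_sum 1 (n div m) * (real m * jordan_totient2 m)) =
     (\<Sum>m | m dvd n. \<Sum>e | e dvd n div m. real (n div e) * jordan_totient2 m)"
  proof (rule sum.cong)
    fix m assume "m \<in> {m. m dvd n}"
    then obtain k where k: "n = m * k" "m > 0" "k > 0" using assms by (auto elim!: dvdE)
    have "divisor_power_sum 1 (n div m) * (real m * jordan_totient2 m)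
       = (\<Sum>e | e dvd k. real (k div e) * (real m * jordan_totient2 m))"
      using k by (simp add: divisor_power_sum_1_flip sum_distrib_right del: One_nat_def)
    also have "\<dots> = (\<Sum>e | e dvd k. real (n div e) * jordan_totient2 m)"
      by (rule sum.cong) (auto simp: k(1) div_mult_swap[symmetric])
    finally show "divisor_power_sum 1 (n div m) * (real m * jordan_totient2 m) =
       (\<Sum>e | e dvd n div m. real (n div e) * jordan_totient2 m)" using k by simp
  qed simp
  also have "\<dots> = (\<Sum>e | e dvd n. \<Sum>m | m dvd n div e. real (n div e) * jordan_totient2 m)"
    using assms by (rule sum_divisors_swap)
  also have "\<dots> = (\<Sum>e | e dvd n. real (n div e) ^ 3)"
    by (rule sum.cong)
       (use assms in \<open>auto simp: sum_distrib_left[symmetric] jordan_totient2_divisor_sum power2_eq_square power3_eq_cube\<close>)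
  also have "\<dots> = divisor_power_sum 3 n"
    unfolding divisor_power_sum_def using assms by (rule sum_divisors_flip)
  finally show ?thesis .
qed

text \<open>In Dirichlet series, zeta(s) zeta(s-1) times zeta(s-2)/zeta(s) is zeta(s-1)
  zeta(s-2).\<close>

lemma sum_sigma_jordan_totient2:
  assumes "n > 0"
  shows "(\<Sum>m | m dvd n. divisor_power_sum 1 (n div m) * jordan_totient2 m) = real n * divisor_power_sum 1 n"
proof -
  have "(\<Sum>m | m dvd n. divisor_power_sum 1 (n div m) * jordan_totient2 m) =
     (\<Sum>m | m dvd n. \<Sum>e | e dvd n div m. real e * jordan_totient2 m)"
    by (simp add: divisor_power_sum_def sum_distrib_right)
  also have "\<dots> = (\<Sum>e | e dvd n. \<Sum>m | m dvd n div e. real e * jordan_totient2 m)"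
    using assms by (rule sum_divisors_swap)
  also have "\<dots> = (\<Sum>e | e dvd n. real n * real (n div e))"
  proof (rule sum.cong)
    fix e assume "e \<in> {e. e dvd n}"
    then obtain k where k: "n = e * k" "e > 0" "k > 0" using assms by (auto elim!: dvdE)
    thus "(\<Sum>m | m dvd n div e. real e * jordan_totient2 m) = real n * real (n div e)"
      by (simp add: sum_distrib_left[symmetric] jordan_totient2_divisor_sum power2_eq_square)
  qed simp
  also have "\<dots> = real n * divisor_power_sum 1 n"
    using assms by (simp only: divisor_power_sum_1_flip sum_distrib_left)
  finally show ?thesis .
qed

text \<open>Since \<sigma>(1) = 1, the term \<open>m = n\<close> of the convolution isolates
  \<open>f n\<close> and induction settles the others.\<close>

lemma sigma_convolution_cancel:
  fixes f g :: "nat \<Rightarrow> real"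
  assumes conv: "\<And>n. n > 0 \<Longrightarrow> (\<Sum>m | m dvd n. divisor_power_sum 1 (n div m) * f m) =
      (\<Sum>m | m dvd n. divisor_power_sum 1 (n div m) * g m)"
    and "n > 0"
  shows "f n = g n"
  using \<open>n > 0\<close>
proof (induction n rule: less_induct)
  case (less n)
  have split: "(\<Sum>m | m dvd n. divisor_power_sum 1 (n div m) * F m) =
      F n + (\<Sum>m | m dvd n \<and> m \<noteq> n. divisor_power_sum 1 (n div m) * F m)" for F :: "nat \<Rightarrow> real"
  proof -
    have "{m. m dvd n} = insert n {m. m dvd n \<and> m \<noteq> n}" by auto
    moreover have "finite {m. m dvd n \<and> m \<noteq> n}"
      by (rule finite_subset[of _ "{m. m dvd n}"]) (use less.prems in auto)
    moreover have "divisor_power_sum 1 1 = 1" by (simp add: divisor_power_sum_def)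
    ultimately show ?thesis using less.prems by simp
  qed
  have "(\<Sum>m | m dvd n \<and> m \<noteq> n. divisor_power_sum 1 (n div m) * f m) =
        (\<Sum>m | m dvd n \<and> m \<noteq> n. divisor_power_sum 1 (n div m) * g m)"
  proof (rule sum.cong)
    fix m assume "m \<in> {m. m dvd n \<and> m \<noteq> n}"
    hence m: "m dvd n" "m \<noteq> n" by auto
    have "m \<le> n" using m(1) less.prems by (rule dvd_imp_le)
    hence "m < n" using m(2) by simp
    moreover have "m > 0" using m(1) less.prems by (cases m) auto
    ultimately show "divisor_power_sum 1 (n div m) * f m = divisor_power_sum 1 (n div m) * g m"
      using less.IH by simp
  qed simp
  thus ?case using conv[OF less.prems] unfolding split by linarith
qed

section \<open>Counting cylinder data\<close>

lemma card_coprime_shift: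
  fixes c :: int
  assumes "g > 0"
  shows "card {j. j < g \<and> coprime (int g) (c + int j)} = totient g"
proof -
  have mod_cop: "coprime (int g) (x mod int g) \<longleftrightarrow> coprime (int g) x" for x
    using coprime_mod_right_iff[of "int g" x] assms by simp
  \<comment> \<open>\<open>totatives g\<close> lies in 1..g rather than 0..g-1: the residue of
    \<open>c + j - 1\<close> is taken and 1 is added back.\<close>
  define F where "F = (\<lambda>j. nat ((c + int j - 1) mod int g) + 1)"
  define G where "G = (\<lambda>r. nat ((int r - c) mod int g))"
  have iF: "int (F j) = (c + int j - 1) mod int g + 1" for j
    using assms by (simp add: F_def)
  have iG: "int (G r) = (int r - c) mod int g" for r
    using assms by (simp add: G_def)
  have Fb: "0 < F j" "F j \<le> g" for j
    using assms pos_mod_bound[of "int g" "c + int j - 1"] by (auto simp: F_def nat_less_iff Suc_le_eq)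
  have Gb: "G r < g" for r
    using assms by (simp add: G_def nat_less_iff)
  have GF: "G (F j) = j" if "j < g" for j
  proof -
    have "int (G (F j)) = ((c + int j - 1) mod int g + (1 - c)) mod int g"
      by (simp only: iG iF) (simp add: algebra_simps)
    also have "\<dots> = int j mod int g" by (simp add: mod_simps)
    finally show ?thesis using that by simp
  qed
  have FG: "F (G r) = r" if "0 < r" "r \<le> g" for r
  proof -
    have "int (F (G r)) = (c - 1 + (int r - c) mod int g) mod int g + 1"
      by (simp only: iG iF) (simp add: algebra_simps)
    also have "\<dots> = (int r - 1) mod int g + 1" by (simp add: mod_simps)
    also have "\<dots> = int r" using that by simp
    finally show ?thesis by simp
  qed
  have Fcop: "coprime (F j) g \<longleftrightarrow> coprime (int g) (c + int j)" for j
  proof -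
    have "int (F j) mod int g = (c + int j) mod int g"
      unfolding iF by (simp add: mod_simps)
    hence "coprime (int g) (int (F j)) \<longleftrightarrow> coprime (int g) (c + int j)"
      using mod_cop by metis
    thus ?thesis by (simp add: coprime_commute)
  qed
  have "bij_betw F {j. j < g \<and> coprime (int g) (c + int j)} (totatives g)"
    by (rule bij_betw_byWitness[of _ G])
       (use Fb Gb in \<open>auto simp: GF FG Fcop totatives_def simp flip: Fcop\<close>)
  thus ?thesis unfolding totient_def by (rule bij_betw_same_card)
qed

text \<open>For coprime \<open>h\<close>, \<open>k\<close> the condition says that (w, 0), (v, 0),
  (-\<alpha>, h), (-\<beta>, k) generate Z^2: their 2 by 2 minors have gcd
  \<open>gcd (gcd w v) (h * \<beta> - k * \<alpha>)\<close>.\<close>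

definition twist_pairs :: "nat \<Rightarrow> nat \<Rightarrow> nat \<Rightarrow> nat \<Rightarrow> (nat \<times> nat) set" where
  "twist_pairs w v h k = {(\<alpha>, \<beta>). \<alpha> < w \<and> \<beta> < v \<and> coprime (int (gcd w v)) (int h * int \<beta> - int k * int \<alpha>)}"

lemma finite_twist_pairs: "finite (twist_pairs w v h k)"
  by (rule finite_subset[of _ "{..<w} \<times> {..<v}"]) (auto simp: twist_pairs_def)

text \<open>Translating \<open>(\<alpha>, \<beta>)\<close> by a Bezout solution of \<open>h b - k a = 1\<close> shifts the determinant by 1, so the
  determinant is equidistributed modulo \<open>gcd w v\<close>.\<close>

lemma card_twist_pairs:
  assumes "coprime h k" "w > 0" "v > 0"
  shows "card (twist_pairs w v h k) * gcd w v = w * v * totient (gcd w v)"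
proof -
  define g where "g = gcd w v"
  have g0: "g > 0" using assms by (simp add: g_def)
  obtain a b :: int where ab: "int h * b - int k * a = 1"
  proof -
    obtain x y where "x * int h + y * int k = gcd (int h) (int k)" using bezout_int by blast
    moreover have "gcd (int h) (int k) = 1" using assms(1) by (simp add: gcd_int_int_eq)
    ultimately have "int h * x - int k * (- y) = 1" by (simp add: algebra_simps)
    thus ?thesis by (rule that)
  qed
  define T where "T = (\<lambda>j::int. {(\<alpha>, \<beta>). \<alpha> < w \<and> \<beta> < v \<and> coprime (int g) (int h * int \<beta> - int k * int \<alpha> + j)})"
  have finT: "finite (T j)" for j
    by (rule finite_subset[of _ "{..<w} \<times> {..<v}"]) (auto simp: T_def)
  define S where "S = (\<lambda>j (\<alpha>, \<beta>). (nat ((int \<alpha> + j * a) mod int w), nat ((int \<beta> + j * b) mod int v)))"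
  have S_in: "S j q \<in> T (i - j)" if "q \<in> T i" for i j q
  proof -
    obtain \<alpha> \<beta> where q: "q = (\<alpha>, \<beta>)" by (cases q) auto
    define \<alpha>' \<beta>' where "\<alpha>' = (int \<alpha> + j * a) mod int w" and "\<beta>' = (int \<beta> + j * b) mod int v"
    have "int g dvd int w" "int g dvd int v" by (simp_all add: g_def)
    hence "[\<alpha>' = int \<alpha> + j * a] (mod int g)" "[\<beta>' = int \<beta> + j * b] (mod int g)"
      unfolding \<alpha>'_def \<beta>'_def cong_def by (simp_all add: mod_mod_cancel)
    hence "[int h * \<beta>' - int k * \<alpha>' + (i - j) =
        int h * (int \<beta> + j * b) - int k * (int \<alpha> + j * a) + (i - j)] (mod int g)"
      by (intro cong_add cong_diff cong_mult cong_refl)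
    also have "int h * (int \<beta> + j * b) - int k * (int \<alpha> + j * a) + (i - j) =
        int h * int \<beta> - int k * int \<alpha> + i + j * (int h * b - int k * a - 1)"
      by (simp add: algebra_simps)
    also have "\<dots> = int h * int \<beta> - int k * int \<alpha> + i" using ab by simp
    finally have "coprime (int h * \<beta>' - int k * \<alpha>' + (i - j)) (int g) \<longleftrightarrow>
        coprime (int h * int \<beta> - int k * int \<alpha> + i) (int g)"
      by (metis cong_imp_coprime cong_sym)
    moreover have "S j q = (nat \<alpha>', nat \<beta>')" "0 \<le> \<alpha>'" "0 \<le> \<beta>'" "\<alpha>' < int w" "\<beta>' < int v"
      using assms by (simp_all add: S_def q \<alpha>'_def \<beta>'_def)
    ultimately show ?thesis using that
      by (simp add: T_def q coprime_commute nat_less_iff)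
  qed
  have S_inv: "S (- j) (S j q) = q" if "q \<in> T i" for i j q
  proof -
    obtain \<alpha> \<beta> where "q = (\<alpha>, \<beta>)" by (cases q) auto
    hence q: "q = (\<alpha>, \<beta>)" "\<alpha> < w" "\<beta> < v" using that by (auto simp: T_def)
    have "((int \<alpha> + j * a) mod int w + - j * a) mod int w = int \<alpha>"
         "((int \<beta> + j * b) mod int v + - j * b) mod int v = int \<beta>"
      using q by (simp_all add: mod_simps)
    thus ?thesis using assms by (simp add: S_def q)
  qed
  have card_T: "card (T j) = card (T 0)" for j
  proof (rule bij_betw_same_card[of "S j"], rule bij_betw_byWitness[of _ "S (- j)"])
    show "\<forall>q\<in>T j. S (- j) (S j q) = q" using S_inv by blast
    show "\<forall>q\<in>T 0. S j (S (- j) q) = q" using S_inv[of _ 0 "- j"] by simp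
    show "S j ` T j \<subseteq> T 0" using S_in[of _ j j] by auto
    show "S (- j) ` T 0 \<subseteq> T j" using S_in[of _ 0 "- j"] by auto
  qed
  \<comment> \<open>Double counting: as \<open>j\<close> runs through the residues modulo
    \<open>g\<close>, each pair of twists satisfies the shifted condition for exactly
    \<open>totient g\<close> of them.\<close>
  have "card (T 0) * g = (\<Sum>j<g. card (T (int j)))" by (simp add: card_T[of "int j" for j])
  also have "\<dots> = card (SIGMA j:{..<g}. T (int j))" using finT by simp
  also have "\<dots> = card (SIGMA q:{..<w} \<times> {..<v}. {j. j < g \<and> coprime (int g) ((int h * int (snd q) - int k * int (fst q)) + int j)})"
    by (rule bij_betw_same_card[of prod.swap], rule bij_betw_byWitness[of _ prod.swap]) (auto simp: T_def)
  also have "\<dots> = (\<Sum>q\<in>{..<w} \<times> {..<v}. totient g)"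
    by (subst card_SigmaI) (auto simp: card_coprime_shift[OF g0])
  also have "\<dots> = w * v * totient g" by simp
  finally show ?thesis by (simp add: T_def twist_pairs_def g_def)
qed

definition two_cylinder_count :: "nat \<Rightarrow> real" where
  "two_cylinder_count n =
     (\<Sum>(w, v, h, k) | (w, v, h, k) \<in> quads n \<and> (w < v \<and> coprime h k). real (card (twist_pairs w v h k)))"

text \<open>A quadruple \<open>(a, b, x, y)\<close> is divided by \<open>gcd x y\<close> in the heights \<open>x, y\<close> and by a divisor \<open>k\<close> of
  \<open>gcd a b\<close> in the widths; the factor \<open>a b\<close> is spread over the \<open>k\<close> by \<open>\<Sum>k | k dvd g. totient (g div k) = g\<close>.\<close>

lemma sum_sigma_two_cylinder_count:
  assumes "n > 0"
  shows "(\<Sum>m | m dvd n. divisor_power_sum 1 (n div m) * two_cylinder_count m) =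
    (\<Sum>(a, b, x, y) | (a, b, x, y) \<in> quads n \<and> a < b. real a * real b)"
proof -
  \<comment> \<open>The number of admissible twists from \<open>card_twist_pairs\<close>; it does
    not depend on the heights.\<close>
  define G where "G = (\<lambda>a b. real a * real b * real (totient (gcd a b)) / real (gcd a b))"
  define Q where "Q = (\<lambda>n. {(a, b, x, y). (a, b, x, y) \<in> quads n \<and> a < b})"
  define Q1 where "Q1 = (\<lambda>n. {(a, b, x, y). (a, b, x, y) \<in> quads n \<and> (a < b \<and> coprime x y)})"
  have finQ: "finite (Q n)" "finite (Q1 n)" for n
    by (rule finite_subset[OF _ finite_quads[of n]]; auto simp: Q_def Q1_def)+
  have count: "two_cylinder_count m = (\<Sum>(a, b, x, y)\<in>Q1 m. G a b)" for m
    unfolding two_cylinder_count_def Q1_def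
  proof (rule sum.cong)
    fix q assume "q \<in> {(a, b, x, y). (a, b, x, y) \<in> quads m \<and> (a < b \<and> coprime x y)}"
    then obtain a b x y where q: "q = (a, b, x, y)" "a > 0" "b > 0" "coprime x y"
      by (auto simp: quads_def)
    have "real (card (twist_pairs a b x y)) * real (gcd a b) = real a * real b * real (totient (gcd a b))"
      using card_twist_pairs[OF q(4,2,3)] by (metis of_nat_mult)
    thus "(case q of (w, v, h, k) \<Rightarrow> real (card (twist_pairs w v h k))) = (case q of (a, b, x, y) \<Rightarrow> G a b)"
      using q by (simp add: G_def field_simps)
  qed simp
  have fin: "finite {k. k dvd n div m}" if "m dvd n" for m
    using that assms by (auto intro!: finite_divisors elim!: dvdE)
  have "(\<Sum>m | m dvd n. divisor_power_sum 1 (n div m) * two_cylinder_count m) =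
      (\<Sum>m | m dvd n. \<Sum>k | k dvd n div m. \<Sum>(a, b, x, y)\<in>Q1 m. real k * G a b)"
    by (simp add: count divisor_power_sum_def sum_product case_prod_beta)
  also have "\<dots> = (\<Sum>m | m dvd n. \<Sum>(k, a, b, x, y)\<in>{k. k dvd n div m} \<times> Q1 m. real k * G a b)"
    by (simp add: sum.cartesian_product)
  also have "\<dots> = (\<Sum>(m, k, a, b, x, y)\<in>Sigma {m. m dvd n} (\<lambda>m. {k. k dvd n div m} \<times> Q1 m). real k * G a b)"
    by (subst sum.Sigma) (use assms finQ fin in \<open>auto simp: case_prod_beta\<close>)
  \<comment> \<open>The scale \<open>n div m\<close> factors as \<open>k * e\<close>, where
    \<open>k\<close> stretches the widths and \<open>e\<close> the heights. As the old heights are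
    coprime, \<open>e\<close> reappears as the gcd of the new ones.\<close>
  also have "\<dots> = (\<Sum>((a, b, x, y), k)\<in>Sigma (Q n) (\<lambda>(a, b, x, y). {k. k dvd gcd a b}). real k * G (a div k) (b div k))"
  proof (rule sum.reindex_bij_witness[of _
      "\<lambda>((a, b, x, y), k). (n div (k * gcd x y), k, a div k, b div k, x div gcd x y, y div gcd x y)"
      "\<lambda>(m, k, a, b, x, y). let e = n div m div k in ((k * a, k * b, e * x, e * y), k)"], goal_cases)
    case (1 q)
    obtain m k a b x y where q: "q = (m, k, a, b, x, y)" by (cases q) auto
    with 1 have *: "m dvd n" "k dvd n div m" "0 < a" "0 < b" "0 < x" "0 < y" "a * x + b * y = m" "a < b" "coprime x y"
      by (auto simp: Q1_def quads_def)
    obtain e where e: "n = m * (k * e)" "m > 0" "k > 0" "e > 0"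
      using *(1,2) assms by (auto elim!: dvdE)
    have "gcd (e * x) (e * y) = e" using *(9) by (simp add: gcd_mult_distrib_nat[symmetric])
    thus ?case using e by (simp add: q Let_def)
  next
    case (2 q)
    obtain m k a b x y where q: "q = (m, k, a, b, x, y)" by (cases q) auto
    with 2 have *: "m dvd n" "k dvd n div m" "0 < a" "0 < b" "0 < x" "0 < y" "a * x + b * y = m" "a < b" "coprime x y"
      by (auto simp: Q1_def quads_def)
    obtain e where e: "n = m * (k * e)" "m > 0" "k > 0" "e > 0"
      using *(1,2) assms by (auto elim!: dvdE)
    have "k * a * (e * x) + k * b * (e * y) = n" using *(7) e(1) by (auto simp: algebra_simps)
    thus ?case using e * by (simp add: q Let_def Q_def quads_def)
  next
    case (3 q)
    obtain k a b x y where q: "q = ((a, b, x, y), k)" by (cases q) auto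
    with 3 have *: "0 < a" "0 < b" "0 < x" "0 < y" "a * x + b * y = n" "a < b" "k dvd a" "k dvd b"
      by (auto simp: Q_def quads_def)
    define e where "e = gcd x y"
    obtain a' b' x' y' where **: "a = k * a'" "b = k * b'" "x = e * x'" "y = e * y'"
      using *(7,8) gcd_dvd1[of x y] gcd_dvd2[of x y] unfolding e_def[symmetric] by (elim dvdE)
    have pos: "k > 0" "e > 0" using * ** by auto
    have "n = (k * e) * (a' * x' + b' * y')" using *(5) ** by (simp add: algebra_simps)
    moreover have "a' * x' + b' * y' > 0" using * ** by auto
    ultimately have "n div (n div (k * e)) div k = e"
      using pos by (simp add: mult.commute[of k e])
    moreover have "x div e = x'" "y div e = y'" "a div k = a'" "b div k = b'" using pos ** by simp_all
    ultimately have "(let f = n div (n div (k * e)) div k in ((k * (a div k), k * (b div k), f * (x div e), f * (y div e)), k)) = q"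
      unfolding q using ** by (simp add: Let_def)
    thus ?case by (simp add: q e_def)
  next
    case (4 q)
    obtain k a b x y where q: "q = ((a, b, x, y), k)" by (cases q) auto
    with 4 have *: "0 < a" "0 < b" "0 < x" "0 < y" "a * x + b * y = n" "a < b" "k dvd a" "k dvd b"
      by (auto simp: Q_def quads_def)
    define e where "e = gcd x y"
    obtain a' b' x' y' where **: "a = k * a'" "b = k * b'" "x = e * x'" "y = e * y'"
      using *(7,8) gcd_dvd1[of x y] gcd_dvd2[of x y] unfolding e_def[symmetric] by (elim dvdE)
    have pos: "k > 0" "e > 0" using * ** by auto
    have n: "n = (k * e) * (a' * x' + b' * y')" using *(5) ** by (simp add: algebra_simps)
    have p: "a' * x' + b' * y' > 0" using * ** by auto
    have "coprime (x div gcd x y) (y div gcd x y)" using * by (intro div_gcd_coprime) auto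
    moreover have "x div gcd x y = x'" "y div gcd x y = y'" unfolding e_def[symmetric] using pos ** by simp_all
    ultimately have cop: "coprime x' y'" by simp
    have m: "n div (k * e) = a' * x' + b' * y'" using n pos by simp
    hence nm: "n = n div (k * e) * (k * e)" using n by simp
    hence "n div (k * e) dvd n" by (rule dvdI)
    moreover have "k dvd n div (n div (k * e))" using p m nm
      by (metis dvd_triv_left neq0_conv nonzero_mult_div_cancel_left)
    moreover have "(a', b', x', y') \<in> Q1 (n div (k * e))"
      using * ** cop m by (simp add: Q1_def quads_def)
    ultimately have "(n div (k * e), k, a', b', x', y') \<in> Sigma {m. m dvd n} (\<lambda>m. {k. k dvd n div m} \<times> Q1 m)"
      by simp
    moreover have "x div e = x'" "y div e = y'" "a div k = a'" "b div k = b'" using pos ** by simp_all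
    ultimately show ?case by (simp add: q e_def)
  next
    case (5 q)
    obtain m k a b x y where q: "q = (m, k, a, b, x, y)" by (cases q) auto
    with 5 have "k > 0" using assms by (auto elim!: dvdE)
    thus ?case by (simp add: q Let_def)
  qed
  also have "\<dots> = (\<Sum>(a, b, x, y)\<in>Q n. \<Sum>k | k dvd gcd a b. real k * G (a div k) (b div k))"
    by (subst sum.Sigma[symmetric]) (use finQ in \<open>auto simp: case_prod_beta Q_def quads_def intro!: finite_divisors\<close>)
  also have "\<dots> = (\<Sum>(a, b, x, y)\<in>Q n. real a * real b)"
  proof (rule sum.cong)
    fix q assume "q \<in> Q n"
    then obtain a b x y where q: "q = (a, b, x, y)" "a > 0" "b > 0" by (auto simp: Q_def quads_def)
    define g where "g = gcd a b"
    have g0: "g > 0" using q by (simp add: g_def)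
    have "(\<Sum>k | k dvd g. real k * G (a div k) (b div k)) = (\<Sum>k | k dvd g. real a * real b / real g * real (totient (g div k)))"
    proof (rule sum.cong)
      fix k assume "k \<in> {k. k dvd g}"
      then obtain a' b' where k: "a = k * a'" "b = k * b'" "k > 0"
        using q unfolding g_def by (auto elim!: dvdE)
      have "g = k * gcd a' b'" unfolding g_def k by (simp add: gcd_mult_distrib_nat)
      thus "real k * G (a div k) (b div k) = real a * real b / real g * real (totient (g div k))"
        using k by (simp add: G_def field_simps)
    qed simp
    also have "\<dots> = real a * real b / real g * (\<Sum>k | k dvd g. real (totient (g div k)))"
      by (simp add: sum_distrib_left)
    also have "(\<Sum>k | k dvd g. real (totient (g div k))) = (\<Sum>k | k dvd g. real (totient k))"
      using g0 by (rule sum_divisors_flip)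
    also have "\<dots> = real g" using totient_divisor_sum[of g] by (metis of_nat_sum)
    finally show "(case q of (a, b, x, y) \<Rightarrow> \<Sum>k | k dvd gcd a b. real k * G (a div k) (b div k)) =
        (case q of (a, b, x, y) \<Rightarrow> real a * real b)"
      using g0 by (simp add: q g_def)
  qed simp
  finally show ?thesis by (simp add: Q_def)
qed

text \<open>\<open>i\<close> and \<open>j\<close> are the distances of two corners from the third
  along an orbit of length \<open>n\<close>; the gcd generates the horizontal periods.\<close>

definition gap_pairs :: "nat \<Rightarrow> (nat \<times> nat) set" where
  "gap_pairs n = {(i, j). 0 < i \<and> i < j \<and> j < n \<and> gcd (gcd i j) n = 1}"

lemma finite_gap_pairs: "finite (gap_pairs n)"
  by (rule finite_subset[of _ "{..<n} \<times> {..<n}"]) (auto simp: gap_pairs_def)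

lemma card_ordered_pairs: "card {(i, j). 0 < i \<and> i < j \<and> j < (n::nat)} = (n - 1) choose 2"
proof (induction n)
  case (Suc n)
  have "{(i, j). 0 < i \<and> i < j \<and> j < Suc n} = {(i, j). 0 < i \<and> i < j \<and> j < n} \<union> (\<lambda>i. (i, n)) ` {0<..<n}"
    by auto
  moreover have "finite {(i, j). 0 < i \<and> i < j \<and> j < n}"
    by (rule finite_subset[of _ "{..<n} \<times> {..<n}"]) auto
  moreover have "card ((\<lambda>i. (i, n)) ` {0<..<n}) = n - 1"
    by (simp add: card_image inj_on_def)
  ultimately have "card {(i, j). 0 < i \<and> i < j \<and> j < Suc n} = ((n - 1) choose 2) + (n - 1)"
    by (simp only:) (subst card_Un_disjoint, use Suc.IH in auto)
  thus ?case by (cases n) (auto simp: numeral_2_eq_2)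
qed simp

text \<open>Dividing an arbitrary pair of gaps and the width by their common gcd gives a unique
  primitive pair for a width \<open>m\<close> dividing \<open>n\<close>.\<close>

lemma sum_gap_pairs:
  assumes "n > 0"
  shows "(\<Sum>m | m dvd n. card (gap_pairs m)) = (n - 1) choose 2"
proof -
  let ?fun = "\<lambda>(m, i, j). (n div m * i, n div m * j)" and ?inv = "\<lambda>(i, j). (n div gcd (gcd i j) n, i div gcd (gcd i j) n, j div gcd (gcd i j) n)"
  have "(\<Sum>m | m dvd n. card (gap_pairs m)) = card (SIGMA m:{m. m dvd n}. gap_pairs m)"
    using assms finite_gap_pairs by simp
  also have "\<dots> = card {(i, j). 0 < i \<and> i < j \<and> j < n}"
  proof (rule bij_betw_same_card[of ?fun],
      rule bij_betw_byWitness[of _ ?inv],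
      goal_cases)
    case 1
    show ?case
    proof (rule ballI)
      fix q assume "q \<in> (SIGMA m:{m. m dvd n}. gap_pairs m)"
      then obtain m i j e where q: "q = (m, i, j)" and e: "n = m * e" "m > 0" "e > 0" "gcd (gcd i j) m = 1"
        using assms by (auto simp: gap_pairs_def elim!: dvdE)
      have "gcd (gcd (e * i) (e * j)) (m * e) = e * gcd (gcd i j) m"
        by (simp add: gcd_mult_distrib_nat mult.commute[of m])
      hence "gcd (gcd (e * i) (e * j)) (m * e) = e" using e(4) by simp
      thus "?inv (?fun q) = q"
        using e by (simp add: q)
    qed
  next
    case 2
    show ?case
    proof (rule ballI)
      fix q assume "q \<in> {(i, j). 0 < i \<and> i < j \<and> j < n}"
      then obtain i j where q: "q = (i, j)" "0 < i" "i < j" "j < n" by auto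
      define g where "g = gcd (gcd i j) n"
      have "g dvd i" "g dvd j" "g dvd n" "g > 0" using assms by (auto simp: g_def intro: dvd_trans)
      then obtain i' j' n' where "i = g * i'" "j = g * j'" "n = g * n'" by (auto elim!: dvdE)
      moreover have "?inv q = (n div g, i div g, j div g)" by (simp add: q g_def)
      ultimately show "?fun (?inv q) = q"
        using \<open>g > 0\<close> assms by (simp add: q)
    qed
  next
    case 3
    show ?case
    proof (rule image_subsetI)
      fix q assume "q \<in> (SIGMA m:{m. m dvd n}. gap_pairs m)"
      then obtain m i j e where q: "q = (m, i, j)" and e: "n = m * e" "m > 0" "e > 0" "0 < i" "i < j" "j < m"
        using assms by (auto simp: gap_pairs_def elim!: dvdE)
      thus "?fun q \<in> {(i, j). 0 < i \<and> i < j \<and> j < n}" by (simp add: q)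
    qed
  next
    case 4
    show ?case
    proof (rule image_subsetI)
      fix q assume "q \<in> {(i, j). 0 < i \<and> i < j \<and> j < n}"
      then obtain i j where q: "q = (i, j)" and ij: "0 < i" "i < j" "j < n" by auto
      define g where "g = gcd (gcd i j) n"
      have "g dvd i" "g dvd j" "g dvd n" "g > 0" using assms by (auto simp: g_def intro: dvd_trans)
      then obtain i' j' n' where *: "i = g * i'" "j = g * j'" "n = g * n'" by (auto elim!: dvdE)
      have "g = g * gcd (gcd i' j') n'"
        by (subst (1) g_def) (simp add: * gcd_mult_distrib_nat)
      hence "gcd (gcd i' j') n' = 1" using \<open>g > 0\<close> by simp
      moreover have "?inv q = (n div g, i div g, j div g)" by (simp add: q g_def)
      ultimately show "?inv q \<in> (SIGMA m:{m. m dvd n}. gap_pairs m)"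
        using \<open>g > 0\<close> ij * by (simp add: gap_pairs_def)
    qed
  qed
  also have "\<dots> = (n - 1) choose 2" by (rule card_ordered_pairs)
  finally show ?thesis .
qed

text \<open>The factor \<open>m / 3\<close> stands for \<open>m\<close> twists and three possible
  base corners. Pulling \<open>n div e\<close> out of \<sigma> leaves the sum of all pairs of gaps
  for the width \<open>n div e\<close>, and \<open>l / 3\<close> times \<open>l - 1\<close> over 2
  is \<open>l\<close> over 3.\<close>

lemma sum_sigma_gap_pairs:
  assumes "n > 0"
  shows "(\<Sum>m | m dvd n. divisor_power_sum 1 (n div m) * (real m / 3 * real (card (gap_pairs m)))) =
    (\<Sum>l | l dvd n. real (l choose 3))"
proof -
  have "(\<Sum>m | m dvd n. divisor_power_sum 1 (n div m) * (real m / 3 * real (card (gap_pairs m)))) =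
     (\<Sum>m | m dvd n. \<Sum>e | e dvd n div m. real (n div e) / 3 * real (card (gap_pairs m)))"
  proof (rule sum.cong)
    fix m assume "m \<in> {m. m dvd n}"
    then obtain k where k: "n = m * k" "m > 0" "k > 0" using assms by (auto elim!: dvdE)
    have "divisor_power_sum 1 (n div m) * (real m / 3 * real (card (gap_pairs m)))
       = (\<Sum>e | e dvd k. real (k div e) * (real m / 3 * real (card (gap_pairs m))))"
      using k by (simp add: divisor_power_sum_1_flip sum_distrib_right del: One_nat_def)
    also have "\<dots> = (\<Sum>e | e dvd k. real (n div e) / 3 * real (card (gap_pairs m)))"
      by (rule sum.cong) (auto simp: k(1) div_mult_swap[symmetric])
    finally show "divisor_power_sum 1 (n div m) * (real m / 3 * real (card (gap_pairs m))) =
       (\<Sum>e | e dvd n div m. real (n div e) / 3 * real (card (gap_pairs m)))" using k by simp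
  qed simp
  also have "\<dots> = (\<Sum>e | e dvd n. \<Sum>m | m dvd n div e. real (n div e) / 3 * real (card (gap_pairs m)))"
    using assms by (rule sum_divisors_swap)
  also have "\<dots> = (\<Sum>e | e dvd n. real ((n div e) choose 3))"
  proof (rule sum.cong)
    fix e assume "e \<in> {e. e dvd n}"
    hence "n div e > 0" using assms by (auto elim!: dvdE)
    then obtain l where l: "n div e = Suc l" by (cases "n div e") auto
    have "3 * (Suc l choose 3) = Suc l * (l choose 2)"
      using Suc_times_binomial_eq[of l 2] by (simp add: numeral_3_eq_3 numeral_2_eq_2)
    hence *: "real (Suc l choose 3) = real (Suc l) / 3 * real (l choose 2)"
      by (metis (no_types, lifting) nonzero_mult_div_cancel_left of_nat_mult of_nat_numeral times_divide_eq_left zero_neq_numeral)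
    have "(\<Sum>m | m dvd Suc l. real (card (gap_pairs m))) = real (l choose 2)"
      using sum_gap_pairs[of "Suc l"] by (metis diff_Suc_1 of_nat_sum zero_less_Suc)
    thus "(\<Sum>m | m dvd n div e. real (n div e) / 3 * real (card (gap_pairs m))) = real ((n div e) choose 3)"
      unfolding l sum_distrib_left[symmetric] * by simp
  qed simp
  also have "\<dots> = (\<Sum>l | l dvd n. real (l choose 3))"
    using assms by (rule sum_divisors_flip)
  finally show ?thesis .
qed

theorem cylinder_counts_eq_jordan_totient2:
  assumes "n > 1"
  shows "real n / 3 * real (card (gap_pairs n)) + two_cylinder_count n = 3/8 * (real n - 2) * jordan_totient2 n"
proof -
  define f where "f = (\<lambda>n. real n / 3 * real (card (gap_pairs n)) + two_cylinder_count n)"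
  \<comment> \<open>At 1 the formula gives -3/8, whereas there are no cylinder data of area 1. The
    correction contributes 3/8 \<sigma>(n) to the convolution, which is precisely the remaining term
    of the closed form.\<close>
  define g where "g = (\<lambda>n. 3/8 * (real n - 2) * jordan_totient2 n + (if n = 1 then 3/8 else 0))"
  have "f n = g n"
  proof (rule sigma_convolution_cancel)
    fix n :: nat assume n: "n > 0"
    have "(\<Sum>m | m dvd n. divisor_power_sum 1 (n div m) * f m) =
        3/8 * (divisor_power_sum 3 n + divisor_power_sum 1 n - 2 * real n * divisor_power_sum 1 n)"
      using sum_sigma_two_cylinder_count[OF n] sum_sigma_gap_pairs[OF n] sum_quads_less[OF n]
      by (simp only: f_def distrib_left sum.distrib)
    also have "\<dots> = (\<Sum>m | m dvd n. 3/8 * (divisor_power_sum 1 (n div m) * (real m * jordan_totient2 m))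
        - 3/4 * (divisor_power_sum 1 (n div m) * jordan_totient2 m) + (if m = 1 then 3/8 * divisor_power_sum 1 (n div m) else 0))"
      unfolding sum.distrib sum_subtractf sum_distrib_left[symmetric]
        sum_sigma_mult_jordan_totient2[OF n] sum_sigma_jordan_totient2[OF n]
      using n by (simp add: sum.delta algebra_simps)
    also have "\<dots> = (\<Sum>m | m dvd n. divisor_power_sum 1 (n div m) * g m)"
      by (rule sum.cong) (auto simp: g_def field_simps)
    finally show "(\<Sum>m | m dvd n. divisor_power_sum 1 (n div m) * f m) =
        (\<Sum>m | m dvd n. divisor_power_sum 1 (n div m) * g m)" .
  qed (use assms in simp)
  thus ?thesis using assms by (simp add: f_def g_def)
qed

section \<open>Invariant equivalence relations and 3-cycles\<close>

text \<open>A congruence of the action. Transitivity is not presupposed, so partitions into unions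
  of orbits count as well as block systems.\<close>

definition stable_equiv :: "nat \<Rightarrow> (nat \<Rightarrow> nat) \<Rightarrow> (nat \<Rightarrow> nat) \<Rightarrow> (nat \<times> nat) set \<Rightarrow> bool" where
  "stable_equiv n s t R \<longleftrightarrow> equiv {1..n} R \<and> (\<forall>x y. (x, y) \<in> R \<longrightarrow> (s x, s y) \<in> R \<and> (t x, t y) \<in> R)"

abbreviation pair_group :: "nat \<Rightarrow> (nat \<Rightarrow> nat) \<Rightarrow> (nat \<Rightarrow> nat) \<Rightarrow> (nat \<Rightarrow> nat) set" where
  "pair_group n s t \<equiv> generate (sym_group n) {s, t}"

lemma stable_equivD:
  assumes "stable_equiv n s t R"
  shows "R \<subseteq> {1..n} \<times> {1..n}" "x \<in> {1..n} \<Longrightarrow> (x, x) \<in> R" "(x, y) \<in> R \<Longrightarrow> (y, x) \<in> R"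
    "(x, y) \<in> R \<Longrightarrow> (y, z) \<in> R \<Longrightarrow> (x, z) \<in> R"
    "(x, y) \<in> R \<Longrightarrow> (s x, s y) \<in> R" "(x, y) \<in> R \<Longrightarrow> (t x, t y) \<in> R"
  using assms unfolding stable_equiv_def equiv_def
  by (auto dest: refl_onD symD transD)

text \<open>An injective map of a finite relation into itself is onto.\<close>

lemma inv_in_finite_invariant_rel:
  fixes n :: nat
  assumes "s permutes {1..n}" "R \<subseteq> {1..n} \<times> {1..n}" "\<And>x y. (x, y) \<in> R \<Longrightarrow> (s x, s y) \<in> R" "(x, y) \<in> R"
  shows "(inv' s x, inv' s y) \<in> R"
proof -
  have fin: "finite R" using assms(2) by (rule finite_subset) simp
  have "inj s" using assms(1) by (rule permutes_inj)
  hence "inj_on (map_prod s s) R" by (auto simp: inj_on_def dest: injD)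
  hence "map_prod s s ` R = R"
    using assms(3) by (intro endo_inj_surj fin) auto
  hence "(x, y) \<in> map_prod s s ` R" using assms(4) by simp
  then obtain a b where "(a, b) \<in> R" "s a = x" "s b = y" by auto
  thus ?thesis using \<open>inj s\<close> by (auto simp: inv_f_f)
qed

lemma stable_equiv_pair_group:
  assumes R: "stable_equiv n s t R" and st: "s permutes {1..n}" "t permutes {1..n}"
    and g: "g \<in> pair_group n s t" and xy: "(x, y) \<in> R"
  shows "(g x, g y) \<in> R"
  using g xy
proof (induction arbitrary: x y)
  case one
  thus ?case by (simp add: sym_group_one)
next
  case (incl h)
  thus ?case using stable_equivD(5,6)[OF R] by auto
next
  case (inv h)
  hence "h permutes {1..n}" "\<And>x y. (x, y) \<in> R \<Longrightarrow> (h x, h y) \<in> R"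
    using st stable_equivD(5,6)[OF R] by auto
  hence "(inv' h x, inv' h y) \<in> R"
    using inv_in_finite_invariant_rel stable_equivD(1)[OF R] inv.prems by blast
  thus ?case using \<open>h permutes {1..n}\<close> by (simp add: sym_group_carrier)
next
  case (eng h1 h2)
  thus ?case by (simp add: sym_group_mult)
qed

lemma cycle_of_list_3:
  assumes "distinct [x, y, z]"
  shows "cycle_of_list [x, y, z] x = y" "cycle_of_list [x, y, z] y = z" "cycle_of_list [x, y, z] z = x"
    "u \<noteq> x \<Longrightarrow> u \<noteq> y \<Longrightarrow> u \<noteq> z \<Longrightarrow> cycle_of_list [x, y, z] u = u"
  using assms by (auto simp: transpose_def)

lemma cycle_of_list_3_rotate:
  "distinct [x, y, z] \<Longrightarrow> cycle_of_list [y, z, x] = cycle_of_list [x, y, z]"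
  by (rule ext) (auto simp: transpose_def)

lemma cycle_of_list_3_inv:
  assumes "distinct [x, y, z]"
  shows "inv' (cycle_of_list [x, y, z]) = cycle_of_list [x, z, y]"
proof (rule inv_equality)
  fix u
  show "cycle_of_list [x, z, y] (cycle_of_list [x, y, z] u) = u"
    using assms by (auto simp: transpose_def)
  show "cycle_of_list [x, y, z] (cycle_of_list [x, z, y] u) = u"
    using assms by (auto simp: transpose_def)
qed

declare cycle_of_list.simps(1) [simp del]

lemma three_cyclesI:
  "distinct [x, y, z] \<Longrightarrow> {x, y, z} \<subseteq> {1..n} \<Longrightarrow> cycle_of_list [x, y, z] \<in> three_cycles n"
  by (rule CollectI, rule exI[of _ "[x, y, z]"]) auto

text \<open>The 3-cycle through \<open>p\<close>, \<open>q\<close>, \<open>z\<close> lies in the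
  group and moves the related pair \<open>p\<close>, \<open>q\<close> to \<open>q\<close>,
  \<open>z\<close>; hence \<open>q\<close> is related to everything.\<close>

lemma stable_equiv_total:
  assumes alt: "carrier (alt_group n) \<subseteq> pair_group n s t"
    and R: "stable_equiv n s t R" and st: "s permutes {1..n}" "t permutes {1..n}"
    and pq: "(p, q) \<in> R" "p \<noteq> q"
  shows "R = {1..n} \<times> {1..n}"
proof -
  have pq': "p \<in> {1..n}" "q \<in> {1..n}" using stable_equivD(1)[OF R] pq by auto
  have *: "(q, z) \<in> R" if "z \<in> {1..n}" for z
  proof (cases "z = p \<or> z = q")
    case True
    thus ?thesis using stable_equivD(2,3)[OF R] pq pq' by auto
  next
    case False
    hence d: "distinct [p, q, z]" using pq by auto
    have "cycle_of_list [p, q, z] \<in> three_cycles n" using d pq' that by (intro three_cyclesI) auto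
    hence "cycle_of_list [p, q, z] \<in> pair_group n s t" using alt three_cycles_incl by blast
    from stable_equiv_pair_group[OF R st this pq(1)] show ?thesis
      by (simp only: cycle_of_list_3[OF d])
  qed
  have "(x, y) \<in> R" if "x \<in> {1..n}" "y \<in> {1..n}" for x y
    using *[OF that(1)] *[OF that(2)] stable_equivD(3,4)[OF R] by blast
  thus ?thesis using stable_equivD(1)[OF R] by auto
qed

lemma pair_group_subgroup:
  assumes "s permutes {1..n}" "t permutes {1..n}"
  shows "subgroup (pair_group n s t) (sym_group n)"
  using assms by (intro group.generate_is_subgroup[OF sym_group_is_group]) (auto simp: sym_group_carrier)

lemma pair_group_ops:
  assumes st: "s permutes {1..n}" "t permutes {1..n}"
  shows "g \<in> pair_group n s t \<Longrightarrow> g permutes {1..n}"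
    "g \<in> pair_group n s t \<Longrightarrow> h \<in> pair_group n s t \<Longrightarrow> g \<circ> h \<in> pair_group n s t"
    "g \<in> pair_group n s t \<Longrightarrow> inv' g \<in> pair_group n s t"
    "id \<in> pair_group n s t" "s \<in> pair_group n s t" "t \<in> pair_group n s t"
proof -
  note sub = pair_group_subgroup[OF st]
  show perm: "g permutes {1..n}" if "g \<in> pair_group n s t" for g
    using subgroup.mem_carrier[OF sub that] by (simp add: sym_group_carrier)
  show "g \<in> pair_group n s t \<Longrightarrow> h \<in> pair_group n s t \<Longrightarrow> g \<circ> h \<in> pair_group n s t"
    using subgroup.m_closed[OF sub] by (simp add: sym_group_mult)
  show "inv' g \<in> pair_group n s t" if "g \<in> pair_group n s t"
    using subgroup.m_inv_closed[OF sub that] perm[OF that] by (simp add: sym_group_carrier)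
  show "id \<in> pair_group n s t" using subgroup.one_closed[OF sub] by (simp add: sym_group_one)
qed (auto intro: generate.incl)

text \<open>The alternating group has index 2: one odd element in the group translates every odd
  permutation into the even ones.\<close>

lemma pair_group_alt_or_sym:
  assumes st: "s permutes {1..n}" "t permutes {1..n}"
    and alt: "carrier (alt_group n) \<subseteq> pair_group n s t"
  shows "pair_group n s t = carrier (alt_group n) \<or> pair_group n s t = carrier (sym_group n)"
proof (cases "pair_group n s t = carrier (alt_group n)")
  case False
  then obtain g where g: "g \<in> pair_group n s t" "g \<notin> carrier (alt_group n)" using alt by blast
  note ops = pair_group_ops[OF st]
  have gp: "g permutes {1..n}" using ops(1) g(1) by blast
  hence odd: "\<not> evenperm g" using g(2) by (simp add: alt_group_carrier)
  have "h \<in> pair_group n s t" if h: "h \<in> carrier (sym_group n)" for h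
  proof (cases "evenperm h")
    case True
    thus ?thesis using alt h by (auto simp: alt_group_carrier sym_group_carrier)
  next
    case False
    have hp: "h permutes {1..n}" using h by (simp add: sym_group_carrier)
    have perms: "permutation g" "permutation h" "permutation (inv' g)"
      using gp hp permutes_inv[OF gp] by (auto simp: permutation_permutes)
    have "evenperm (h \<circ> inv' g)"
      using perms odd False by (simp add: evenperm_comp evenperm_inv)
    hence "h \<circ> inv' g \<in> pair_group n s t"
      using alt permutes_compose[OF permutes_inv[OF gp] hp] by (auto simp: alt_group_carrier)
    hence "h \<circ> inv' g \<circ> g \<in> pair_group n s t" using g(1) by (rule ops(2))
    thus ?thesis using permutes_inv_o(2)[OF gp] by (simp add: comp_assoc)
  qed
  moreover have "pair_group n s t \<subseteq> carrier (sym_group n)"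
    using ops(1) by (auto simp: sym_group_carrier)
  ultimately show ?thesis by blast
qed simp

lemma conj_cycle_3:
  assumes "g permutes A" "distinct [x, y, z]"
  shows "g \<circ> cycle_of_list [x, y, z] \<circ> inv' g = cycle_of_list [g x, g y, g z]"
  using conjugation_of_cycle[OF assms(2) permutes_bij[OF assms(1)]] by simp

text \<open>Jordan's argument: being joined by a 3-cycle of the group is a stable equivalence relation.\<close>

theorem alt_group_subset_pair_group:
  assumes st: "s permutes {1..n}" "t permutes {1..n}"
    and pqr: "distinct [p, q, r]" "{p, q, r} \<subseteq> {1..n}" "cycle_of_list [p, q, r] \<in> pair_group n s t"
    and total: "\<And>R. stable_equiv n s t R \<Longrightarrow> (p, q) \<in> R \<Longrightarrow> (q, r) \<in> R \<Longrightarrow> R = {1..n} \<times> {1..n}"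
  shows "carrier (alt_group n) \<subseteq> pair_group n s t"
proof -
  note ops = pair_group_ops[OF st]
  define T where "T = (\<lambda>x y z. distinct [x, y, z] \<and> {x, y, z} \<subseteq> {1..n} \<and> cycle_of_list [x, y, z] \<in> pair_group n s t)"
  have rot: "T y z x" if "T x y z" for x y z
    using that cycle_of_list_3_rotate[of x y z] unfolding T_def by (metis (no_types, lifting) distinct_length_2_or_more distinct_singleton insert_commute)
  have flip: "T x z y" if "T x y z" for x y z
  proof -
    have "inv' (cycle_of_list [x, y, z]) \<in> pair_group n s t" using that ops(3) unfolding T_def by blast
    hence "cycle_of_list [x, z, y] \<in> pair_group n s t"
      using that unfolding T_def by (metis cycle_of_list_3_inv)
    thus ?thesis using that unfolding T_def by auto
  qed
  have conj: "T (g x) (g y) (g z)" if "T x y z" "g \<in> pair_group n s t" for g x y z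
  proof -
    have gp: "g permutes {1..n}" using ops(1) that(2) .
    have "g \<circ> cycle_of_list [x, y, z] \<circ> inv' g \<in> pair_group n s t"
      using that by (intro ops) (auto simp: T_def)
    moreover have "distinct [g x, g y, g z]"
      using that(1) permutes_inj[OF gp] by (auto simp: T_def dest: injD)
    moreover have "{g x, g y, g z} \<subseteq> {1..n}" using that(1) permutes_in_image[OF gp] by (auto simp: T_def)
    ultimately show ?thesis using conj_cycle_3[OF gp] that(1) unfolding T_def by metis
  qed
  \<comment> \<open>The triples have \<open>y\<close> and \<open>z\<close> in common. Conjugating
    the first by the 3-cycle through \<open>y\<close>, \<open>w\<close>, \<open>z\<close> fixes
    \<open>x\<close> and replaces the pair \<open>y\<close>, \<open>z\<close> by \<open>w\<close>,
    \<open>y\<close>.\<close>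
  have shared: "T x y w" if "T x y z" "T y z w" "x \<noteq> w" for x y z w
  proof -
    have T': "T y w z" using flip that(2) by blast
    hence d: "distinct [y, w, z]" by (simp add: T_def)
    have "T (cycle_of_list [y, w, z] x) (cycle_of_list [y, w, z] y) (cycle_of_list [y, w, z] z)"
      using that(1) by (rule conj) (use T' in \<open>simp add: T_def\<close>)
    moreover have "cycle_of_list [y, w, z] x = x"
      using that by (intro cycle_of_list_3(4)[OF d]) (auto simp: T_def)
    ultimately have "T x w y" by (simp only: cycle_of_list_3[OF d])
    thus ?thesis by (rule flip)
  qed
  \<comment> \<open>The triples meet only in \<open>y\<close>. Conjugating the second by the 3-cycle
    through \<open>y\<close>, \<open>x\<close>, \<open>z\<close> moves \<open>y\<close> to
    \<open>x\<close> and fixes \<open>w\<close> and \<open>v\<close>, which produces a triple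
    sharing two points with the second one.\<close>
  have far: "T x w v" if "T x y z" "T y w v" "x \<noteq> w" "z \<noteq> w" "v \<noteq> x" "z \<noteq> v" for x y z w v
  proof -
    have T': "T y x z" using flip rot that(1) by blast
    hence d: "distinct [y, x, z]" by (simp add: T_def)
    have "T (cycle_of_list [y, x, z] y) (cycle_of_list [y, x, z] w) (cycle_of_list [y, x, z] v)"
      using that(2) by (rule conj) (use T' in \<open>simp add: T_def\<close>)
    moreover have "cycle_of_list [y, x, z] w = w" "cycle_of_list [y, x, z] v = v"
      using that by (intro cycle_of_list_3(4)[OF d]; auto simp: T_def)+
    ultimately show ?thesis by (simp only: cycle_of_list_3[OF d])
  qed
  have join: "T x y w" if "T x y z" "T y w v" "x \<noteq> w" for x y z w v
  proof -
    consider "z = w" | "v = x" | "z = v" | "z \<noteq> w" "v \<noteq> x" "z \<noteq> v" by blast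
    thus ?thesis
    proof cases
      case 1 thus ?thesis using that by simp
    next
      case 2 thus ?thesis using that rot by blast
    next
      case 3 thus ?thesis using that shared flip by blast
    next
      case 4
      hence "T x w v" using far that by blast
      moreover have "T w v y" using that(2) rot by blast
      moreover have "x \<noteq> y" using that(1) by (auto simp: T_def)
      ultimately have "T x w y" by (rule shared)
      thus ?thesis by (rule flip)
    qed
  qed
  define R where "R = {(x, y). x \<in> {1..n} \<and> y \<in> {1..n} \<and> (x = y \<or> (\<exists>z. T x y z))}"
  have "stable_equiv n s t R"
    unfolding stable_equiv_def
  proof (intro conjI allI impI equivI)
    show "R \<subseteq> {1..n} \<times> {1..n}" "refl_on {1..n} R" by (auto simp: R_def refl_on_def)
    have "T y x z" if "T x y z" for x y z using flip[OF rot[OF that]] .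
    thus "sym R" unfolding R_def sym_def by blast
    show "trans R"
    proof (rule transI)
      fix x y w assume xy: "(x, y) \<in> R" "(y, w) \<in> R"
      show "(x, w) \<in> R"
      proof (cases "x = y \<or> y = w \<or> x = w")
        case True
        thus ?thesis using xy by (auto simp: R_def)
      next
        case False
        then obtain z v where "T x y z" "T y w v" using xy by (auto simp: R_def)
        hence "T x w y" using False join flip by blast
        thus ?thesis using xy by (auto simp: R_def)
      qed
    qed
  next
    fix x y assume "(x, y) \<in> R"
    thus "(s x, s y) \<in> R" "(t x, t y) \<in> R"
      using conj[OF _ ops(5)] conj[OF _ ops(6)] permutes_in_image[OF st(1)] permutes_in_image[OF st(2)]
      unfolding R_def by blast+
  qed
  moreover have "T p q r" using pqr by (simp add: T_def)
  hence "(p, q) \<in> R" "(q, r) \<in> R" using rot[of p q r] pqr(2) by (auto simp: R_def)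
  ultimately have R: "R = {1..n} \<times> {1..n}" by (rule total)
  \<comment> \<open>Totality gives a 3-cycle of the group through \<open>x\<close>, \<open>y\<close>
    and one through \<open>y\<close>, \<open>w\<close>; \<open>join\<close> turns them into the
    3-cycle on exactly these three points. So all 3-cycles, and thereby the alternating group, are
    present.\<close>
  have "T x y w" if "distinct [x, y, w]" "{x, y, w} \<subseteq> {1..n}" for x y w
  proof -
    have "(x, y) \<in> R" "(y, w) \<in> R" using that R by auto
    moreover have "x \<noteq> y" "y \<noteq> w" "x \<noteq> w" using that(1) by auto
    ultimately obtain z v where "T x y z" "T y w v" unfolding R_def by blast
    thus ?thesis using \<open>x \<noteq> w\<close> by (rule join)
  qed
  hence three: "three_cycles n \<subseteq> pair_group n s t"
  proof (intro subsetI, elim CollectE exE conjE)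
    fix g cs assume T: "\<And>x y w. distinct [x, y, w] \<Longrightarrow> {x, y, w} \<subseteq> {1..n} \<Longrightarrow> T x y w"
      and cs: "g = cycle_of_list cs" "distinct cs" "length cs = 3" "set cs \<subseteq> {1..n}"
    obtain x y w where "cs = [x, y, w]" using stupid_lemma[OF cs(3)] by blast
    thus "g \<in> pair_group n s t" using cs T[of x y w] by (simp add: T_def)
  qed
  show ?thesis
  proof
    fix g assume "g \<in> carrier (alt_group n)"
    hence "g \<in> generate (alt_group n) (three_cycles n)" using alt_group_carrier_as_three_cycles by blast
    thus "g \<in> pair_group n s t"
    proof induction
      case one
      show ?case unfolding alt_group_one by (rule ops(4))
    next
      case (incl h)
      thus ?case using three by blast
    next
      case (inv h)
      hence "h \<in> carrier (alt_group n)" using three_cycles_incl by blast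
      thus ?case using inv three ops(3) by (auto simp: alt_group_inv_equality)
    next
      case (eng h1 h2)
      show ?case unfolding alt_group_mult by (rule ops(2)[OF eng.IH])
    qed
  qed
qed

section \<open>Pairs with a given 3-cycle as commutator\<close>

lemma commutator_eq_iff:
  assumes "s permutes A" "t permutes A"
  shows "s \<circ> t \<circ> inv' s \<circ> inv' t = c \<longleftrightarrow> (\<forall>x. s (t x) = c (t (s x)))"
proof
  assume "s \<circ> t \<circ> inv' s \<circ> inv' t = c"
  thus "\<forall>x. s (t x) = c (t (s x))"
    using permutes_inverses[OF assms(1)] permutes_inverses[OF assms(2)] by auto
next
  assume *: "\<forall>x. s (t x) = c (t (s x))"
  show "s \<circ> t \<circ> inv' s \<circ> inv' t = c"
  proof
    fix x
    show "(s \<circ> t \<circ> inv' s \<circ> inv' t) x = c x"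
      using *[rule_format, of "inv' s (inv' t x)"] permutes_inverses[OF assms(1)] permutes_inverses[OF assms(2)]
      by simp
  qed
qed

text \<open>Written as \<open>s t = c t s\<close>, without inverses. The triple is ordered, so a
  pair has three of them, the rotations; choosing one means choosing a base corner.\<close>

definition commutator_is :: "nat \<Rightarrow> (nat \<Rightarrow> nat) \<Rightarrow> (nat \<Rightarrow> nat) \<Rightarrow> nat \<Rightarrow> nat \<Rightarrow> nat \<Rightarrow> bool" where
  "commutator_is n s t p q r \<longleftrightarrow> s permutes {1..n} \<and> t permutes {1..n} \<and> distinct [p, q, r] \<and> {p, q, r} \<subseteq> {1..n} \<and>
     (\<forall>x. s (t x) = cycle_of_list [p, q, r] (t (s x)))"

lemma commutator_is_rotate:
  "commutator_is n s t p q r \<Longrightarrow> commutator_is n s t q r p"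
  unfolding commutator_is_def using cycle_of_list_3_rotate[of p q r] by auto

lemma commutator_is_cycle_eq:
  assumes "commutator_is n s t p q r" "commutator_is n s t p' q' r'"
  shows "cycle_of_list [p, q, r] = cycle_of_list [p', q', r']"
proof -
  have st: "s permutes {1..n}" "t permutes {1..n}" using assms(1) by (simp_all add: commutator_is_def)
  have "s \<circ> t \<circ> inv' s \<circ> inv' t = cycle_of_list [a, b, e]" if "commutator_is n s t a b e" for a b e
    using that commutator_eq_iff[OF st] by (simp add: commutator_is_def)
  from this[OF assms(1)] this[OF assms(2)] show ?thesis by simp
qed

lemma pairsA_iff:
  "(s, t) \<in> pairsA n \<longleftrightarrow> (\<exists>p q r. commutator_is n s t p q r) \<and> carrier (alt_group n) \<subseteq> pair_group n s t"
proof
  assume "(s, t) \<in> pairsA n"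
  hence *: "s permutes {1..n}" "t permutes {1..n}" "s \<circ> t \<circ> inv' s \<circ> inv' t \<in> three_cycles n"
    "pair_group n s t = carrier (alt_group n) \<or> pair_group n s t = carrier (sym_group n)"
    by (auto simp: pairsA_def sym_group_carrier)
  then obtain cs where cs: "s \<circ> t \<circ> inv' s \<circ> inv' t = cycle_of_list cs" "distinct cs" "length cs = 3" "set cs \<subseteq> {1..n}"
    by blast
  obtain p q r where "cs = [p, q, r]" using stupid_lemma[OF cs(3)] by blast
  hence "commutator_is n s t p q r"
    using cs * commutator_eq_iff[OF *(1,2)] by (simp add: commutator_is_def)
  moreover have "carrier (alt_group n) \<subseteq> pair_group n s t"
    using *(4) subgroup.subset[OF alt_group_is_subgroup] by blast
  ultimately show "(\<exists>p q r. commutator_is n s t p q r) \<and> carrier (alt_group n) \<subseteq> pair_group n s t" by blast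
next
  assume "(\<exists>p q r. commutator_is n s t p q r) \<and> carrier (alt_group n) \<subseteq> pair_group n s t"
  then obtain p q r where c: "commutator_is n s t p q r" and alt: "carrier (alt_group n) \<subseteq> pair_group n s t"
    by blast
  hence st: "s permutes {1..n}" "t permutes {1..n}" by (simp_all add: commutator_is_def)
  have "s \<circ> t \<circ> inv' s \<circ> inv' t = cycle_of_list [p, q, r]"
    using c commutator_eq_iff[OF st] by (simp add: commutator_is_def)
  also have "\<dots> \<in> three_cycles n" using c by (intro three_cyclesI) (auto simp: commutator_is_def)
  finally show "(s, t) \<in> pairsA n"
    using st pair_group_alt_or_sym[OF st alt] by (simp add: pairsA_def sym_group_carrier)
qed

lemma commutator_in_pair_group:
  assumes "commutator_is n s t p q r"
  shows "cycle_of_list [p, q, r] \<in> pair_group n s t"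
proof -
  have st: "s permutes {1..n}" "t permutes {1..n}" using assms by (simp_all add: commutator_is_def)
  have "s \<circ> t \<circ> inv' s \<circ> inv' t = cycle_of_list [p, q, r]"
    using assms commutator_eq_iff[OF st] by (simp add: commutator_is_def)
  moreover have "s \<circ> t \<circ> inv' s \<circ> inv' t \<in> pair_group n s t"
    by (intro pair_group_ops[OF st])
  ultimately show ?thesis by simp
qed

corollary pairsA_I:
  assumes "commutator_is n s t p q r"
    and "\<And>R. stable_equiv n s t R \<Longrightarrow> (p, q) \<in> R \<Longrightarrow> (q, r) \<in> R \<Longrightarrow> R = {1..n} \<times> {1..n}"
  shows "(s, t) \<in> pairsA n"
proof -
  have "carrier (alt_group n) \<subseteq> pair_group n s t"
    using assms commutator_in_pair_group[OF assms(1)]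
    by (intro alt_group_subset_pair_group[of s n t p q r]) (auto simp: commutator_is_def)
  thus ?thesis using assms(1) unfolding pairsA_iff by blast
qed

corollary pairsA_D:
  assumes "(s, t) \<in> pairsA n" "stable_equiv n s t R" "(p, q) \<in> R" "p \<noteq> q"
  shows "R = {1..n} \<times> {1..n}"
proof -
  have alt: "carrier (alt_group n) \<subseteq> pair_group n s t" using assms(1) unfolding pairsA_iff by (rule conjunct2)
  have "s permutes {1..n} \<and> t permutes {1..n}"
    using assms(1) unfolding pairsA_iff commutator_is_def by (elim conjE exE) (rule conjI)
  thus ?thesis using stable_equiv_total[OF alt assms(2) _ _ assms(3,4)] by simp
qed

section \<open>Orbits of a permutation and of its conjugate\<close>

text \<open>Its cardinality is the sum of the squares of the orbit lengths, the conjugation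
  invariant on which the orbit arguments rest. Forward powers suffice because a permutation of a
  finite set has finite order.\<close>

definition orel :: "nat \<Rightarrow> (nat \<Rightarrow> nat) \<Rightarrow> (nat \<times> nat) set" where
  "orel n f = {(x, y). x \<in> {1..n} \<and> (\<exists>k. y = (f ^^ k) x)}"

lemma funpow_in_carrier:
  assumes "f permutes {1..n::nat}"
  shows "(f ^^ k) x \<in> {1..n} \<longleftrightarrow> x \<in> {1..n}"
  using permutes_in_image[OF permutes_funpow[OF assms, of k], of x] .

lemma permutes_permutation: "f permutes {1..n::nat} \<Longrightarrow> permutation f"
  using permutation_permutes by blast

lemma least_power_pos:
  assumes "f permutes {1..n::nat}"
  shows "least_power f x > 0" "(f ^^ least_power f x) x = x"
  using least_power_of_permutation[OF permutes_permutation[OF assms]] by auto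

lemma funpow_eq_self_iff:
  assumes "f permutes {1..n::nat}"
  shows "(f ^^ k) x = x \<longleftrightarrow> least_power f x dvd k"
  using least_power_dvd[OF permutes_permutation[OF assms]] by blast

lemma funpow_mod_period:
  assumes "(f ^^ m) x = x"
  shows "(f ^^ (k mod m)) x = (f ^^ k) x"
proof -
  have "(f ^^ (m * j)) x = x" for j
    by (induction j) (simp_all add: funpow_add assms)
  hence "(f ^^ (k mod m + m * (k div m))) x = (f ^^ (k mod m)) x"
    by (simp only: funpow_add o_apply)
  thus ?thesis by simp
qed

lemma funpow_inj_on_period:
  assumes f: "f permutes {1..n::nat}"
  shows "inj_on (\<lambda>i. (f ^^ i) x) {..<least_power f x}"
proof -
  have *: False if "i < j" "j < least_power f x" "(f ^^ i) x = (f ^^ j) x" for i j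
  proof -
    have "(f ^^ (j - i)) x = x"
      using funpow_diff[OF permutes_inj[OF f], of i j x] that by simp
    hence "least_power f x dvd j - i" using funpow_eq_self_iff[OF f] by simp
    thus False using that by (auto dest: dvd_imp_le)
  qed
  show ?thesis
    by (rule inj_onI) (metis * lessThan_iff linorder_neqE_nat)
qed

lemma orel_period:
  assumes f: "f permutes {1..n}" and xy: "(x, y) \<in> orel n f"
  obtains i where "i < least_power f x" "y = (f ^^ i) x"
proof -
  obtain k where "y = (f ^^ k) x" using xy by (auto simp: orel_def)
  hence "y = (f ^^ (k mod least_power f x)) x"
    using funpow_mod_period[OF least_power_pos(2)[OF f]] by simp
  thus ?thesis using that least_power_pos(1)[OF f] by (metis mod_less_divisor)
qed

lemma equiv_orel:
  assumes f: "f permutes {1..n}"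
  shows "equiv {1..n} (orel n f)"
proof (rule equivI)
  show "orel n f \<subseteq> {1..n} \<times> {1..n}"
    using funpow_in_carrier[OF f] by (auto simp: orel_def simp del: atLeastAtMost_iff)
  have "x = (f ^^ 0) x" for x by simp
  thus "refl_on {1..n} (orel n f)" unfolding refl_on_def orel_def by blast
  show "sym (orel n f)"
  proof (rule symI)
    fix x y assume xy: "(x, y) \<in> orel n f"
    then obtain i where i: "i < least_power f x" "y = (f ^^ i) x" using orel_period[OF f] by blast
    have "(f ^^ (least_power f x - i)) y = (f ^^ (least_power f x - i + i)) x"
      unfolding i(2) by (simp only: funpow_add o_apply)
    also have "\<dots> = x" using i least_power_pos(2)[OF f] by simp
    finally show "(y, x) \<in> orel n f"
      using xy funpow_in_carrier[OF f, of i x] i(2) unfolding orel_def by (metis (mono_tags, lifting) case_prodD case_prodI mem_Collect_eq)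
  qed
  show "trans (orel n f)"
  proof (rule transI)
    fix x y z assume "(x, y) \<in> orel n f" "(y, z) \<in> orel n f"
    then obtain i j where "x \<in> {1..n}" "y = (f ^^ i) x" "z = (f ^^ j) y" by (auto simp: orel_def)
    hence "z = (f ^^ (j + i)) x" by (simp add: funpow_add)
    thus "(x, z) \<in> orel n f" using \<open>x \<in> {1..n}\<close> unfolding orel_def by blast
  qed
qed

lemma orelD:
  assumes f: "f permutes {1..n}"
  shows "orel n f \<subseteq> {1..n} \<times> {1..n}" "x \<in> {1..n} \<Longrightarrow> (x, x) \<in> orel n f"
    "(x, y) \<in> orel n f \<Longrightarrow> (y, x) \<in> orel n f"
    "(x, y) \<in> orel n f \<Longrightarrow> (y, z) \<in> orel n f \<Longrightarrow> (x, z) \<in> orel n f"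
  using equiv_orel[OF f] unfolding equiv_def by (auto dest: refl_onD symD transD)

lemma orel_funpow: "x \<in> {1..n} \<Longrightarrow> (x, (f ^^ k) x) \<in> orel n f"
  by (auto simp: orel_def)

lemma orel_step: "x \<in> {1..n} \<Longrightarrow> (x, f x) \<in> orel n f"
  using orel_funpow[of x n 1 f] by simp

lemma orel_funpow_iff:
  assumes "f permutes {1..n}" "x \<in> {1..n}"
  shows "(y, (f ^^ k) x) \<in> orel n f \<longleftrightarrow> (y, x) \<in> orel n f"
  using orelD(3,4)[OF assms(1)] orel_funpow[OF assms(2)] by metis

lemma orel_least:
  assumes "f permutes {1..n}" "trans R" "\<And>x. x \<in> {1..n} \<Longrightarrow> (x, x) \<in> R" "\<And>x. x \<in> {1..n} \<Longrightarrow> (x, f x) \<in> R"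
  shows "orel n f \<subseteq> R"
proof -
  have "(x, (f ^^ k) x) \<in> R" if "x \<in> {1..n}" for x k
  proof (induction k)
    case (Suc k)
    have "((f ^^ k) x, f ((f ^^ k) x)) \<in> R"
      using assms(4) that funpow_in_carrier[OF assms(1), of k x] by blast
    thus ?case using Suc assms(2) by (auto dest: transD)
  qed (use assms(3) that in simp)
  thus ?thesis by (auto simp: orel_def)
qed

lemma funpow_intertwine:
  assumes "\<And>x. g (t x) = t (f x)"
  shows "(g ^^ k) (t x) = t ((f ^^ k) x)"
  by (induction k) (simp_all add: assms)

lemma card_orel_conj:
  assumes t: "t permutes {1..n}" and gt: "\<And>x. g (t x) = t (f x)"
  shows "map_prod t t ` orel n f = orel n g" "card (orel n f) = card (orel n g)"
proof -
  show *: "map_prod t t ` orel n f = orel n g"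
  proof (intro equalityI subsetI)
    fix z assume "z \<in> map_prod t t ` orel n f"
    then obtain x k where "x \<in> {1..n}" "z = (t x, t ((f ^^ k) x))" by (auto simp: orel_def)
    thus "z \<in> orel n g"
      using permutes_in_image[OF t] by (auto simp: orel_def simp flip: funpow_intertwine[of g t f, OF gt])
  next
    fix z assume "z \<in> orel n g"
    then obtain y k where y: "y \<in> {1..n}" "z = (y, (g ^^ k) y)" by (auto simp: orel_def)
    obtain x where x: "x \<in> {1..n}" "y = t x"
      using y(1) permutes_image[OF t] by (metis imageE)
    hence "z = map_prod t t (x, (f ^^ k) x)" using y(2) by (simp add: funpow_intertwine[of g t f, OF gt])
    thus "z \<in> map_prod t t ` orel n f" using orel_funpow[OF x(1)] by blast
  qed
  have "inj_on (map_prod t t) (orel n f)"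
    using permutes_inj[OF t] by (auto simp: inj_on_def dest: injD)
  thus "card (orel n f) = card (orel n g)" using card_image * by metis
qed

text \<open>If \<open>cycle_of_list [p, q, r]\<close> is the commutator of \<open>s\<close> and \<open>t\<close>, then \<open>twisted s p q r\<close> is the conjugate
  of \<open>s\<close> by \<open>t\<close>.\<close>

definition twisted :: "(nat \<Rightarrow> nat) \<Rightarrow> nat \<Rightarrow> nat \<Rightarrow> nat \<Rightarrow> nat \<Rightarrow> nat" where
  "twisted s p q r = cycle_of_list [p, r, q] \<circ> s"

lemma twisted_rotate:
  assumes "distinct [p, q, r]"
  shows "twisted s q r p = twisted s p q r"
proof -
  have "cycle_of_list [p, r, q] = cycle_of_list [q, p, r]"
    by (rule cycle_of_list_3_rotate) (use assms in auto)
  thus ?thesis by (simp only: twisted_def)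
qed

lemma commutator_isD:
  assumes "commutator_is n s t p q r"
  shows "s permutes {1..n}" "t permutes {1..n}" "distinct [p, q, r]" "p \<in> {1..n}" "q \<in> {1..n}" "r \<in> {1..n}"
    "s (t x) = cycle_of_list [p, q, r] (t (s x))"
  using assms by (auto simp: commutator_is_def)

lemma twisted_simps:
  assumes "distinct [p, q, r]"
  shows "s x = p \<Longrightarrow> twisted s p q r x = r" "s x = q \<Longrightarrow> twisted s p q r x = p" "s x = r \<Longrightarrow> twisted s p q r x = q"
    "s x \<notin> {p, q, r} \<Longrightarrow> twisted s p q r x = s x"
  using cycle_of_list_3[of p r q] assms by (auto simp: twisted_def)

lemma twisted_permutes:
  assumes "commutator_is n s t p q r"
  shows "twisted s p q r permutes {1..n}"
proof -
  have "cycle_of_list [p, r, q] permutes {1..n}"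
    using cycle_permutes by (rule permutes_subset) (use commutator_isD[OF assms] in auto)
  thus ?thesis unfolding twisted_def using commutator_isD(1)[OF assms] by (intro permutes_compose)
qed

lemma twisted_conj:
  assumes "commutator_is n s t p q r"
  shows "twisted s p q r (t x) = t (s x)"
proof -
  have d: "distinct [p, q, r]" using commutator_isD(3)[OF assms] .
  have "cycle_of_list [p, r, q] (cycle_of_list [p, q, r] y) = y" for y
    using permutes_inverses(2)[OF cycle_permutes[of "[p, q, r]"]] by (simp only: cycle_of_list_3_inv[OF d])
  thus ?thesis using commutator_isD(7)[OF assms] by (simp add: twisted_def)
qed

section \<open>How the corners are distributed over the orbits\<close>

lemma funpow_twisted:
  assumes "distinct [p, q, r]" "\<And>i. 0 < i \<Longrightarrow> i \<le> m \<Longrightarrow> (s ^^ i) a \<notin> {p, q, r}"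
  shows "(twisted s p q r ^^ m) a = (s ^^ m) a"
  using assms(2)
proof (induction m)
  case (Suc m)
  hence "(twisted s p q r ^^ Suc m) a = twisted s p q r ((s ^^ m) a)" by simp
  also have "\<dots> = (s ^^ Suc m) a"
    using Suc.prems[of "Suc m"] by (simp add: twisted_simps(4)[OF assms(1)])
  finally show ?case .
qed simp

text \<open>The orbit relations of \<open>s\<close> and of its conjugate have the same cardinality, so an inclusion between
  them is an equality.\<close>

lemma stable_equiv_orel_same_orbit:
  assumes c: "commutator_is n s t p q r" and "(p, q) \<in> orel n s" "(q, r) \<in> orel n s"
  shows "orel n (twisted s p q r) = orel n s" "stable_equiv n s t (orel n s)"
proof -
  note cD = commutator_isD[OF c]
  note oD = orelD[OF cD(1)]
  let ?u = "twisted s p q r"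
  have rel: "(x, y) \<in> orel n s" if "x \<in> {p, q, r}" "y \<in> {p, q, r}" for x y
  proof -
    have "(p, x) \<in> orel n s" if "x \<in> {p, q, r}" for x
      using that assms(2) oD(2)[OF cD(4)] oD(4)[OF assms(2,3)] by auto
    from oD(4)[OF oD(3)[OF this[OF that(1)]] this[OF that(2)]] show ?thesis .
  qed
  have "orel n ?u \<subseteq> orel n s"
  proof (rule orel_least[OF twisted_permutes[OF c]])
    show "trans (orel n s)" using equiv_orel[OF cD(1)] by (simp add: equiv_def)
    fix x assume x: "x \<in> {1..n}"
    show "(x, x) \<in> orel n s" using oD(2)[OF x] .
    show "(x, ?u x) \<in> orel n s"
    proof (cases "s x \<in> {p, q, r}")
      case True
      hence "?u x \<in> {p, q, r}" using twisted_simps(1-3)[OF cD(3), of s x] by auto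
      hence "(s x, ?u x) \<in> orel n s" using rel True by blast
      from oD(4)[OF orel_step[OF x] this] show ?thesis .
    next
      case False
      thus ?thesis using orel_step[OF x] twisted_simps(4)[OF cD(3)] by metis
    qed
  qed
  moreover have "finite (orel n s)" using oD(1) by (rule finite_subset) simp
  moreover have "card (orel n s) = card (orel n ?u)"
    using cD(2) twisted_conj[OF c] by (rule card_orel_conj)
  ultimately show eq: "orel n ?u = orel n s" using card_subset_eq by metis
  have "(t x, t y) \<in> orel n s" if "(x, y) \<in> orel n s" for x y
  proof -
    have "map_prod t t (x, y) \<in> map_prod t t ` orel n s" using that by (rule imageI)
    thus ?thesis using card_orel_conj(1)[of t n ?u s, OF cD(2) twisted_conj[OF c]] eq by simp
  qed
  moreover have "(s x, s y) \<in> orel n s" if xy: "(x, y) \<in> orel n s" for x y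
  proof -
    have "x \<in> {1..n}" "y \<in> {1..n}" using xy oD(1) by auto
    thus ?thesis using oD(4)[OF oD(4)[OF oD(3)[OF orel_step[of x n s]] xy] orel_step[of y n s]] by blast
  qed
  ultimately show "stable_equiv n s t (orel n s)"
    using equiv_orel[OF cD(1)] by (simp add: stable_equiv_def)
qed

text \<open>If \<open>p\<close> is the only corner on its \<open>s\<close>-orbit, the twisted
  permutation follows that orbit from \<open>p\<close> up to its last point, and there it steps to
  \<open>r\<close> instead of returning to \<open>p\<close>.\<close>

lemma orel_twisted_predecessor:
  assumes c: "commutator_is n s t p q r" and "(p, q) \<notin> orel n s" "(p, r) \<notin> orel n s"
  shows "(p, r) \<in> orel n (twisted s p q r)"
proof -
  note cD = commutator_isD[OF c]
  let ?u = "twisted s p q r"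
  obtain m where m: "least_power s p = Suc m"
    using least_power_pos(1)[OF cD(1), of p] gr0_conv_Suc by blast
  have "(s ^^ i) p \<notin> {p, q, r}" if "0 < i" "i \<le> m" for i
  proof -
    have "(s ^^ i) p \<noteq> p" using that m funpow_eq_self_iff[OF cD(1)] by (auto dest: dvd_imp_le)
    thus ?thesis using assms orel_funpow[OF cD(4), of i s] by auto
  qed
  hence "(?u ^^ m) p = (s ^^ m) p" by (rule funpow_twisted[OF cD(3)])
  moreover have "s ((s ^^ m) p) = p" using least_power_pos(2)[OF cD(1), of p] m by simp
  ultimately have "r = (?u ^^ Suc m) p" by (simp add: twisted_simps(1)[OF cD(3)])
  thus ?thesis using cD(4) unfolding orel_def by blast
qed

text \<open>Corners on three different \<open>s\<close>-orbits would be merged into one orbit of the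
  conjugate, so its orbit relation would properly contain that of \<open>s\<close>. Their
  cardinalities are equal.\<close>

lemma not_three_orbits:
  assumes c: "commutator_is n s t p q r"
    and "(p, q) \<notin> orel n s" "(q, r) \<notin> orel n s" "(p, r) \<notin> orel n s"
  shows False
proof -
  note cD = commutator_isD[OF c]
  note oD = orelD[OF cD(1)]
  let ?u = "twisted s p q r"
  note up = twisted_permutes[OF c]
  note ouD = orelD[OF up]
  note c' = commutator_is_rotate[OF c]
  note c'' = commutator_is_rotate[OF c']
  have neg: "(q, p) \<notin> orel n s" "(r, q) \<notin> orel n s" "(r, p) \<notin> orel n s"
    using assms(2-4) oD(3) by blast+
  have tw1: "twisted s q r p = ?u" using cD(3) by (rule twisted_rotate)
  have "twisted s r p q = twisted s q r p" by (rule twisted_rotate) (use cD(3) in auto)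
  hence tw2: "twisted s r p q = ?u" using tw1 by (rule trans)
  have rel: "(p, r) \<in> orel n ?u" "(q, p) \<in> orel n ?u" "(r, q) \<in> orel n ?u"
    using orel_twisted_predecessor[OF c assms(2,4)] orel_twisted_predecessor[OF c' assms(3) neg(1)]
      orel_twisted_predecessor[OF c'' neg(3,2)] unfolding tw1 tw2 .
  have "orel n s \<subseteq> orel n ?u"
  proof (rule orel_least[OF cD(1)])
    show "trans (orel n ?u)" using equiv_orel[OF up] by (simp add: equiv_def)
    fix x assume x: "x \<in> {1..n}"
    show "(x, x) \<in> orel n ?u" using ouD(2)[OF x] .
    consider "s x = p" | "s x = q" | "s x = r" | "s x \<notin> {p, q, r}" by blast
    hence "(?u x, s x) \<in> orel n ?u"
    proof cases
      case 1 thus ?thesis using twisted_simps(1)[where s=s and x=x, OF cD(3)] rel(1) ouD(3) by simp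
    next
      case 2 thus ?thesis using twisted_simps(2)[where s=s and x=x, OF cD(3)] rel(2) ouD(3) by simp
    next
      case 3 thus ?thesis using twisted_simps(3)[where s=s and x=x, OF cD(3)] rel(3) ouD(3) by simp
    next
      case 4
      thus ?thesis using twisted_simps(4)[where s=s and x=x, OF cD(3)] ouD(2) permutes_in_image[OF cD(1)] x by simp
    qed
    from ouD(4)[OF orel_step[OF x] this] show "(x, s x) \<in> orel n ?u" .
  qed
  moreover have "finite (orel n ?u)" using ouD(1) by (rule finite_subset) simp
  moreover have "card (orel n s) = card (orel n ?u)"
    using cD(2) twisted_conj[OF c] by (rule card_orel_conj)
  ultimately have "orel n s = orel n ?u" using card_subset_eq by metis
  thus False using rel(1) assms(4) by simp
qed

text \<open>In the second case the triple has been rotated so that the corner alone on its orbit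
  stands in the middle; later this makes \<open>p\<close>, \<open>q\<close>, \<open>r\<close>
  canonical.\<close>

lemma orbit_trichotomy:
  assumes c: "commutator_is n s t p q r"
  obtains "(p, q) \<in> orel n s" "(q, r) \<in> orel n s"
  | p' q' r' where "commutator_is n s t p' q' r'" "(p', r') \<in> orel n s" "(p', q') \<notin> orel n s"
proof -
  note cD = commutator_isD[OF c]
  note oD = orelD(3,4)[OF cD(1)]
  note c' = commutator_is_rotate[OF c]
  note c'' = commutator_is_rotate[OF c']
  consider "(p, q) \<in> orel n s" "(q, r) \<in> orel n s" | "(p, r) \<in> orel n s" "(p, q) \<notin> orel n s"
    | "(p, q) \<in> orel n s" "(q, r) \<notin> orel n s" | "(q, r) \<in> orel n s" "(p, r) \<notin> orel n s"
    using not_three_orbits[OF c] oD(2)[of p q r] oD(2)[of p r q] oD(2)[of q p r] oD(1)[of p q] oD(1)[of r q] oD(1)[of q r] by blast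
  thus ?thesis
  proof cases
    case 3
    hence "(q, p) \<in> orel n s" using oD(1) by blast
    thus ?thesis using that(2)[OF c'] 3 by blast
  next
    case 4
    hence "(r, q) \<in> orel n s" "(r, p) \<notin> orel n s" using oD(1) by blast+
    thus ?thesis using that(2)[OF c''] by blast
  qed (use that c in blast)+
qed

lemma least_power_funpow:
  assumes f: "f permutes {1..n::nat}"
  shows "least_power f ((f ^^ i) x) = least_power f x"
proof -
  have "(f ^^ k) ((f ^^ i) x) = (f ^^ i) x \<longleftrightarrow> (f ^^ k) x = x" for k
  proof -
    have "(f ^^ k) ((f ^^ i) x) = (f ^^ i) ((f ^^ k) x)"
      by (metis add.commute funpow_add o_apply)
    moreover have "inj (f ^^ i)" using permutes_inj[OF permutes_funpow[OF f]] .
    ultimately show ?thesis by (simp only: inj_eq)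
  qed
  thus ?thesis by (simp add: least_power_def)
qed

lemma least_power_conj:
  assumes "inj t" "\<And>x. g (t x) = t (f x)"
  shows "least_power g (t x) = least_power f x"
proof -
  have "(g ^^ k) (t x) = t x \<longleftrightarrow> (f ^^ k) x = x" for k
    unfolding funpow_intertwine[of g t f, OF assms(2)] by (rule inj_eq[OF assms(1)])
  thus ?thesis by (simp add: least_power_def)
qed

section \<open>Two cylinders\<close>

lemma mod_shift_Suc:
  assumes "v > (0::nat)"
  shows "((x + 1) mod v + b) mod v = (if Suc ((x + b) mod v) = v then 0 else Suc ((x + b) mod v))"
proof -
  have "((x + 1) mod v + b) mod v = Suc (x + b) mod v" by (simp add: mod_simps)
  thus ?thesis by (simp add: mod_Suc)
qed

lemma mod_shift_inj:
  assumes "x < (v::nat)" "x' < v" "(x + b) mod v = (x' + b) mod v"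
  shows "x = x'"
  using assms by (metis cong_add_rcancel_nat cong_def mod_less)

lemma int_mod_mult_cong:
  assumes "m dvd A * int w"
  shows "[A * int (z mod w) = A * int z] (mod m)"
proof -
  have "int z = int w * int (z div w) + int (z mod w)"
    by (metis mult_div_mod_eq of_nat_add of_nat_mult)
  hence "A * int z = A * (int w * int (z div w) + int (z mod w))" by (rule arg_cong)
  hence "A * int (z mod w) - A * int z = - (A * int w * int (z div w))"
    by (simp only: distrib_left mult.assoc)
  hence "m dvd A * int (z mod w) - A * int z" using assms by simp
  thus ?thesis by (simp add: cong_iff_dvd_diff)
qed

lemma mult_in_subgroup:
  fixes L :: "int \<Rightarrow> bool"
  assumes add: "\<And>a b. L a \<Longrightarrow> L b \<Longrightarrow> L (a + b)" and neg: "\<And>a. L a \<Longrightarrow> L (- a)"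
    and "L c"
  shows "L (k * c)"
proof -
  have zero: "L 0" using add[OF assms(3) neg[OF assms(3)]] by simp
  have nmult: "L (int k * c)" for k
    by (induction k) (use zero add assms(3) in \<open>simp_all add: distrib_right\<close>)
  show ?thesis
    using nmult[of "nat k"] neg[OF nmult[of "nat (- k)"]] by (cases "k \<ge> 0") auto
qed

lemma gcd_in_subgroup:
  fixes L :: "int \<Rightarrow> bool"
  assumes add: "\<And>a b. L a \<Longrightarrow> L b \<Longrightarrow> L (a + b)" and neg: "\<And>a. L a \<Longrightarrow> L (- a)"
    and "L a" "L b"
  shows "L (gcd a b)"
proof -
  obtain x y where "x * a + y * b = gcd a b" using bezout_int by blast
  thus ?thesis
    using add[OF mult_in_subgroup[of L a x] mult_in_subgroup[of L b y]] assms by simp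
qed

text \<open>The cell \<open>(b, x, y)\<close> is the square in column \<open>x\<close> and row \<open>y\<close> of the wide (\<open>b = True\<close>, width \<open>v\<close>, height \<open>k\<close>)
  or the narrow (\<open>b = False\<close>, width \<open>w\<close>, height \<open>h\<close>) cylinder; \<open>cyl_width\<close> also serves for heights. The top
  of the wide cylinder is glued, after a twist by \<open>\<beta>\<close>, to the first \<open>v - w\<close> bottom edges of the wide
  cylinder followed by the bottom of the narrow one; the top of the narrow cylinder, twisted by \<open>\<alpha>\<close>,
  goes to the remaining \<open>w\<close> bottom edges of the wide cylinder.\<close>

definition cyl_width :: "nat \<Rightarrow> nat \<Rightarrow> bool \<Rightarrow> nat" where
  "cyl_width w v b = (if b then v else w)"

definition cells :: "nat \<Rightarrow> nat \<Rightarrow> nat \<Rightarrow> nat \<Rightarrow> (bool \<times> nat \<times> nat) set" where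
  "cells w v h k = {(b, x, y). x < cyl_width w v b \<and> y < cyl_width h k b}"

fun right_cell :: "nat \<Rightarrow> nat \<Rightarrow> bool \<times> nat \<times> nat \<Rightarrow> bool \<times> nat \<times> nat" where
  "right_cell w v (b, x, y) = (b, (x + 1) mod cyl_width w v b, y)"

definition glue_wide :: "nat \<Rightarrow> nat \<Rightarrow> nat \<Rightarrow> bool \<times> nat \<times> nat" where
  "glue_wide w v z = (if z < v - w then (True, z, 0) else (False, z - (v - w), 0))"

fun up_cell :: "nat \<Rightarrow> nat \<Rightarrow> nat \<Rightarrow> nat \<Rightarrow> nat \<Rightarrow> nat \<Rightarrow> bool \<times> nat \<times> nat \<Rightarrow> bool \<times> nat \<times> nat" where
  "up_cell w v h k \<alpha> \<beta> (b, x, y) =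
    (if y + 1 < cyl_width h k b then (b, x, y + 1)
     else if b then glue_wide w v ((x + \<beta>) mod v)
     else (True, v - w + (x + \<alpha>) mod w, 0))"

section \<open>Labellings of a finite model\<close>

definition bijections :: "'a set \<Rightarrow> 'b set \<Rightarrow> ('a \<Rightarrow> 'b) set" where
  "bijections A B = {f \<in> extensional A. bij_betw f A B}"

text \<open>Composition with one fixed bijection identifies labellings with permutations.
  Extensionality makes a labelling depend only on its values on the model; otherwise the set would
  not be counted by a factorial.\<close>

lemma card_bijections:
  assumes "finite A" "finite B" "card A = card B"
  shows "card (bijections A B) = fact (card B)" "finite (bijections A B)"
proof -
  obtain g where g: "bij_betw g A B" using assms finite_same_card_bij by blast
  have "bij_betw (\<lambda>\<sigma>. restrict (\<sigma> \<circ> g) A) {\<sigma>. \<sigma> permutes B} (bijections A B)"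
  proof (rule bij_betw_byWitness[of _ "\<lambda>f z. if z \<in> B then f (inv_into A g z) else z"])
    show "\<forall>\<sigma>\<in>{\<sigma>. \<sigma> permutes B}. (\<lambda>z. if z \<in> B then restrict (\<sigma> \<circ> g) A (inv_into A g z) else z) = \<sigma>"
    proof (intro ballI ext)
      fix \<sigma> z assume "\<sigma> \<in> {\<sigma>. \<sigma> permutes B}"
      thus "(if z \<in> B then restrict (\<sigma> \<circ> g) A (inv_into A g z) else z) = \<sigma> z"
        using g bij_betw_inv_into_right[OF g, of z] bij_betwE[OF bij_betw_inv_into[OF g]]
        by (auto simp: permutes_not_in)
    qed
    show "\<forall>f\<in>bijections A B. restrict ((\<lambda>z. if z \<in> B then f (inv_into A g z) else z) \<circ> g) A = f"
    proof (intro ballI ext)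
      fix f z assume "f \<in> bijections A B"
      thus "restrict ((\<lambda>z. if z \<in> B then f (inv_into A g z) else z) \<circ> g) A z = f z"
        using bij_betwE[OF g] bij_betw_inv_into_left[OF g, of z]
        by (auto simp: bijections_def extensional_def)
    qed
    show "(\<lambda>\<sigma>. restrict (\<sigma> \<circ> g) A) ` {\<sigma>. \<sigma> permutes B} \<subseteq> bijections A B"
    proof (rule image_subsetI)
      fix \<sigma> assume "\<sigma> \<in> {\<sigma>. \<sigma> permutes B}"
      hence "bij_betw (\<sigma> \<circ> g) A B" using bij_betw_trans[OF g] permutes_imp_bij by blast
      thus "restrict (\<sigma> \<circ> g) A \<in> bijections A B"
        by (auto simp: bijections_def cong: bij_betw_cong)
    qed
    show "(\<lambda>f z. if z \<in> B then f (inv_into A g z) else z) ` bijections A B \<subseteq> {\<sigma>. \<sigma> permutes B}"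
    proof (intro image_subsetI CollectI bij_imp_permutes)
      fix f assume "f \<in> bijections A B"
      hence "bij_betw (f \<circ> inv_into A g) B B"
        using bij_betw_trans[OF bij_betw_inv_into[OF g]] by (auto simp: bijections_def)
      thus "bij_betw (\<lambda>z. if z \<in> B then f (inv_into A g z) else z) B B"
        by (subst bij_betw_cong[of _ _ "f \<circ> inv_into A g"]) auto
    qed auto
  qed
  hence eq: "bij_betw (\<lambda>\<sigma>. restrict (\<sigma> \<circ> g) A) {\<sigma>. \<sigma> permutes B} (bijections A B)" .
  show "card (bijections A B) = fact (card B)"
    using bij_betw_same_card[OF eq] card_permutations[OF refl assms(2)] by simp
  show "finite (bijections A B)"
    using bij_betw_finite[OF eq] finite_permutations[OF assms(2)] by simp
qed

text \<open>The identity off the image, as \<open>permutes\<close> demands outside the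
  carrier.\<close>

definition transport :: "('a \<Rightarrow> nat) \<Rightarrow> 'a set \<Rightarrow> ('a \<Rightarrow> 'a) \<Rightarrow> nat \<Rightarrow> nat" where
  "transport f A g z = (if z \<in> f ` A then f (g (inv_into A f z)) else z)"

lemma transport_permutes:
  assumes "bij_betw f A B" "bij_betw g A A"
  shows "transport f A g permutes B"
proof (rule bij_imp_permutes)
  have B: "f ` A = B" using assms(1) by (simp add: bij_betw_def)
  have "bij_betw (f \<circ> (g \<circ> inv_into A f)) B B"
    by (rule bij_betw_trans[OF bij_betw_trans[OF bij_betw_inv_into[OF assms(1)] assms(2)] assms(1)])
  thus "bij_betw (transport f A g) B B"
    by (subst bij_betw_cong[of _ _ "f \<circ> (g \<circ> inv_into A f)"]) (auto simp: transport_def B)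
  show "transport f A g z = z" if "z \<notin> B" for z using that B by (simp add: transport_def)
qed

lemma transport_apply:
  "inj_on f A \<Longrightarrow> a \<in> A \<Longrightarrow> transport f A g (f a) = f (g a)"
  by (simp add: transport_def)

text \<open>The cell type is left open so that the columns of one cylinder and the cells of two
  cylinders are both instances.\<close>

definition modelled :: "nat \<Rightarrow> 'a set \<Rightarrow> ('a \<Rightarrow> 'a) \<Rightarrow> ('a \<Rightarrow> 'a) \<Rightarrow> ('a \<Rightarrow> nat) \<Rightarrow> (nat \<Rightarrow> nat) \<Rightarrow> (nat \<Rightarrow> nat) \<Rightarrow> bool" where
  "modelled n M R U f s t \<longleftrightarrow> f \<in> bijections M {1..n} \<and> s permutes {1..n} \<and> t permutes {1..n} \<and>
     (\<forall>m\<in>M. s (f m) = f (R m) \<and> t (f m) = f (U m))"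

lemma modelled_transport:
  assumes "f \<in> bijections M {1..n}" "bij_betw R M M" "bij_betw U M M"
  shows "modelled n M R U f (transport f M R) (transport f M U)"
proof -
  have f: "bij_betw f M {1..n}" using assms(1) by (simp add: bijections_def)
  thus ?thesis
    using assms(1) transport_permutes[OF f assms(2)] transport_permutes[OF f assms(3)]
      transport_apply[OF bij_betw_imp_inj_on[OF f]] by (simp add: modelled_def)
qed

lemma modelledD:
  assumes "modelled n M R U f s t"
  shows "bij_betw f M {1..n}" "f \<in> bijections M {1..n}" "s permutes {1..n}" "t permutes {1..n}"
    "m \<in> M \<Longrightarrow> s (f m) = f (R m)" "m \<in> M \<Longrightarrow> t (f m) = f (U m)" "m \<in> M \<Longrightarrow> f m \<in> {1..n}"
    "m \<in> M \<Longrightarrow> m' \<in> M \<Longrightarrow> f m = f m' \<longleftrightarrow> m = m'"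
proof -
  show f: "bij_betw f M {1..n}" using assms by (simp add: modelled_def bijections_def)
  show "m \<in> M \<Longrightarrow> f m \<in> {1..n}" using bij_betwE[OF f] by blast
  show "m \<in> M \<Longrightarrow> m' \<in> M \<Longrightarrow> f m = f m' \<longleftrightarrow> m = m'"
    using bij_betw_imp_inj_on[OF f] by (auto simp: inj_on_def)
qed (use assms in \<open>simp_all add: modelled_def\<close>)

lemma modelled_surj:
  assumes "modelled n M R U f s t" "z \<in> {1..n}"
  obtains m where "m \<in> M" "z = f m"
proof -
  have "z \<in> f ` M" using modelledD(1)[OF assms(1)] assms(2) by (simp add: bij_betw_def)
  thus ?thesis using that by auto
qed

lemma modelled_transport_unique:
  assumes "modelled n M R U f s t"
  shows "s = transport f M R" "t = transport f M U"
proof -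
  note mD = modelledD[OF assms]
  have "s z = transport f M R z \<and> t z = transport f M U z" for z
  proof (cases "z \<in> f ` M")
    case True
    then obtain m where "m \<in> M" "z = f m" by auto
    thus ?thesis using mD(5,6) by (simp add: transport_apply[OF bij_betw_imp_inj_on[OF mD(1)]])
  next
    case False
    hence "s z = z" "t z = z"
      using mD(1) permutes_not_in[OF mD(3)] permutes_not_in[OF mD(4)] by (auto simp: bij_betw_def)
    thus ?thesis using False by (simp add: transport_def)
  qed
  thus "s = transport f M R" "t = transport f M U" by blast+
qed

lemma modelled_commutator:
  assumes mo: "modelled n M R U f s t" and abc: "distinct [a, b, c]" "a \<in> M" "b \<in> M" "c \<in> M"
    and closed: "\<And>m. m \<in> M \<Longrightarrow> R m \<in> M" "\<And>m. m \<in> M \<Longrightarrow> U m \<in> M"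
    and RU: "\<And>m. m \<in> M \<Longrightarrow> R (U m) = (let m' = U (R m) in if m' = a then b else if m' = b then c else if m' = c then a else m')"
  shows "commutator_is n s t (f a) (f b) (f c)"
proof -
  note mD = modelledD[OF mo]
  have d: "distinct [f a, f b, f c]" using abc mD(8) by auto
  have cyc: "cycle_of_list [f a, f b, f c] (f m) = f (if m = a then b else if m = b then c else if m = c then a else m)"
    if "m \<in> M" for m
  proof -
    consider "m = a" | "m = b" | "m = c" | "m \<noteq> a" "m \<noteq> b" "m \<noteq> c" by blast
    thus ?thesis
    proof cases
      case 4
      hence "f m \<noteq> f a" "f m \<noteq> f b" "f m \<noteq> f c" using that abc mD(8) by auto
      thus ?thesis using 4 cycle_of_list_3(4)[OF d] by simp
    qed (use cycle_of_list_3(1-3)[OF d] abc(1) in auto)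
  qed
  have "s (t z) = cycle_of_list [f a, f b, f c] (t (s z))" for z
  proof (cases "z \<in> {1..n}")
    case True
    then obtain m where m: "m \<in> M" "z = f m" using modelled_surj[OF mo] by metis
    thus ?thesis using closed RU by (simp add: mD(5,6) cyc Let_def)
  next
    case False
    have "z \<notin> set [f a, f b, f c]" using False mD(7) abc by auto
    moreover have "s z = z" "t z = z" using permutes_not_in[OF mD(3) False] permutes_not_in[OF mD(4) False] .
    ultimately show ?thesis using id_outside_supp[of z "[f a, f b, f c]"] by simp
  qed
  thus ?thesis using d mD(3,4,7) abc by (auto simp: commutator_is_def simp del: atLeastAtMost_iff)
qed

text \<open>A function on the cells that changes by a constant modulo \<open>d\<close> under each of
  the two moves maps the surface equivariantly to Z/d, and its fibres form a congruence.\<close>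

lemma modelled_stable_equiv:
  fixes val :: "'a \<Rightarrow> int"
  assumes mo: "modelled n M R U f s t"
    and closed: "\<And>m. m \<in> M \<Longrightarrow> R m \<in> M" "\<And>m. m \<in> M \<Longrightarrow> U m \<in> M"
    and val: "\<And>m. m \<in> M \<Longrightarrow> [val (R m) = val m + A] (mod d)" "\<And>m. m \<in> M \<Longrightarrow> [val (U m) = val m + B] (mod d)"
  shows "stable_equiv n s t {(f c, f c') | c c'. c \<in> M \<and> c' \<in> M \<and> [val c = val c'] (mod d)}"
proof -
  note mD = modelledD[OF mo]
  define E where "E = {(f c, f c') | c c'. c \<in> M \<and> c' \<in> M \<and> [val c = val c'] (mod d)}"
  have "stable_equiv n s t E"
    unfolding stable_equiv_def
  proof (intro conjI allI impI equivI)
    show "E \<subseteq> {1..n} \<times> {1..n}" using mD(7) by (auto simp: E_def simp del: atLeastAtMost_iff)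
    show "refl_on {1..n} E"
    proof (rule refl_onI)
      fix z assume "z \<in> {1..n}"
      then obtain c where "c \<in> M" "z = f c" using modelled_surj[OF mo] by metis
      thus "(z, z) \<in> E" unfolding E_def using cong_refl by blast
    qed
    show "sym E"
    proof (rule symI)
      fix z z' assume "(z, z') \<in> E"
      then obtain c c' where "c \<in> M" "c' \<in> M" "z = f c" "z' = f c'" "[val c = val c'] (mod d)"
        unfolding E_def by blast
      thus "(z', z) \<in> E" unfolding E_def using cong_sym by blast
    qed
    show "trans E"
    proof (rule transI)
      fix z1 z2 z3 assume "(z1, z2) \<in> E" "(z2, z3) \<in> E"
      then obtain c1 c2 c2' c3 where *: "c1 \<in> M" "c2 \<in> M" "c2' \<in> M" "c3 \<in> M" "z1 = f c1" "z2 = f c2" "z2 = f c2'" "z3 = f c3"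
        "[val c1 = val c2] (mod d)" "[val c2' = val c3] (mod d)"
        unfolding E_def by blast
      have "c2 = c2'" using * mD(8) by blast
      thus "(z1, z3) \<in> E" using * cong_trans unfolding E_def by blast
    qed
  next
    fix z z' assume "(z, z') \<in> E"
    then obtain c c' where c: "c \<in> M" "c' \<in> M" "z = f c" "z' = f c'" "[val c = val c'] (mod d)"
      unfolding E_def by blast
    have "[val c + A = val c' + A] (mod d)" "[val c + B = val c' + B] (mod d)"
      using c(5) by (intro cong_add cong_refl; assumption)+
    hence "[val (R c) = val (R c')] (mod d)" "[val (U c) = val (U c')] (mod d)"
      using val c(1,2) by (meson cong_sym cong_trans)+
    moreover have "s z = f (R c)" "s z' = f (R c')" "t z = f (U c)" "t z' = f (U c')"
      using c by (simp_all add: mD(5,6))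
    moreover have "R c \<in> M" "R c' \<in> M" "U c \<in> M" "U c' \<in> M" using c closed by blast+
    ultimately show "(s z, s z') \<in> E" "(t z, t z') \<in> E" unfolding E_def by blast+
  qed
  thus ?thesis by (simp only: E_def)
qed

text \<open>The way the generation condition is exploited: an equivariant map to Z/d that fails to
  separate just two cells is constant.\<close>

lemma pairsA_modelled_cong:
  fixes val :: "'a \<Rightarrow> int"
  assumes st: "(s, t) \<in> pairsA n" and mo: "modelled n M R U f s t"
    and closed: "\<And>m. m \<in> M \<Longrightarrow> R m \<in> M" "\<And>m. m \<in> M \<Longrightarrow> U m \<in> M"
    and val: "\<And>m. m \<in> M \<Longrightarrow> [val (R m) = val m + A] (mod d)" "\<And>m. m \<in> M \<Longrightarrow> [val (U m) = val m + B] (mod d)"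
    and ab: "a \<in> M" "b \<in> M" "a \<noteq> b" "[val a = val b] (mod d)"
    and c: "c \<in> M" "c' \<in> M"
  shows "[val c = val c'] (mod d)"
proof -
  note mD = modelledD[OF mo]
  let ?E = "{(f c, f c') | c c'. c \<in> M \<and> c' \<in> M \<and> [val c = val c'] (mod d)}"
  have ab_E: "(f a, f b) \<in> ?E" using ab by blast
  have ne: "f a \<noteq> f b" using ab mD(8) by blast
  have "stable_equiv n s t ?E" using mo closed val by (rule modelled_stable_equiv)
  from pairsA_D[OF st this ab_E ne] have E: "?E = {1..n} \<times> {1..n}" .
  have "(f c, f c') \<in> ?E" unfolding E using mD(7) c by blast
  then obtain e e' where "e \<in> M" "e' \<in> M" "f c = f e" "f c' = f e'" "[val e = val e'] (mod d)" by blast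
  thus ?thesis using mD(8)[OF c(1)] mD(8)[OF c(2)] by blast
qed

section \<open>The surface attached to two-cylinder data\<close>

locale two_cylinder =
  fixes n w v h k \<alpha> \<beta> :: nat
  assumes pos: "0 < w" "w < v" "0 < h" "0 < k"
    and twist: "\<alpha> < w" "\<beta> < v"
    and area: "w * h + v * k = n"
begin

abbreviation M where "M \<equiv> cells w v h k"
abbreviation R where "R \<equiv> right_cell w v"
abbreviation U where "U \<equiv> up_cell w v h k \<alpha> \<beta>"

lemma width_pos: "0 < cyl_width w v b" "0 < cyl_width h k b"
  using pos by (auto simp: cyl_width_def)

lemma finite_cells: "finite M" and card_cells: "card M = n"
proof -
  have M: "M = {False} \<times> {..<w} \<times> {..<h} \<union> {True} \<times> {..<v} \<times> {..<k}"
    by (auto simp: cells_def cyl_width_def split: if_splits)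
  show "finite M" unfolding M by simp
  show "card M = n" unfolding M by (subst card_Un_disjoint) (auto simp: card_cartesian_product area)
qed

lemma R_in: "m \<in> M \<Longrightarrow> R m \<in> M"
  using width_pos by (cases m) (auto simp: cells_def)

lemma glue_wide_in: "z < v \<Longrightarrow> glue_wide w v z \<in> M"
  using pos by (auto simp: glue_wide_def cells_def cyl_width_def)

lemma glue_wide_inj: "glue_wide w v z = glue_wide w v z' \<Longrightarrow> z = z'"
  by (auto simp: glue_wide_def split: if_splits)

lemma U_in: "m \<in> M \<Longrightarrow> U m \<in> M"
proof (cases m)
  case (fields b x y)
  assume m: "m \<in> M"
  have "v - w + (x + \<alpha>) mod w < v"
    using mod_less_divisor[OF pos(1), of "x + \<alpha>"] pos(2) by linarith
  hence "(True, v - w + (x + \<alpha>) mod w, 0) \<in> M" using pos by (simp add: cells_def cyl_width_def)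
  thus ?thesis using m fields glue_wide_in[of "(x + \<beta>) mod v"] pos by (auto simp: cells_def)
qed

lemma bij_R: "bij_betw R M M"
proof -
  have "inj_on R M"
  proof (rule inj_onI)
    fix m m' assume *: "m \<in> M" "m' \<in> M" "R m = R m'"
    obtain b x y b' x' y' where m: "m = (b, x, y)" "m' = (b', x', y')" by (metis prod.exhaust)
    show "m = m'" using * mod_shift_inj[of x "cyl_width w v b" x' 1] by (auto simp: m cells_def)
  qed
  moreover have "R ` M \<subseteq> M" using R_in by auto
  ultimately show ?thesis using endo_inj_surj[OF finite_cells] by (auto simp: bij_betw_def)
qed

lemma bij_U: "bij_betw U M M"
proof -
  have "inj_on U M"
  proof (rule inj_onI)
    fix m m' assume *: "m \<in> M" "m' \<in> M" "U m = U m'"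
    obtain b x y where m: "m = (b, x, y)" by (cases m) auto
    obtain b' x' y' where m': "m' = (b', x', y')" by (cases m') auto
    show "m = m'"
    proof (cases "y + 1 < cyl_width h k b \<or> y' + 1 < cyl_width h k b'")
      case True
      hence "snd (snd (U m)) \<noteq> 0 \<or> snd (snd (U m')) \<noteq> 0" by (auto simp: m m')
      hence "y + 1 < cyl_width h k b" "y' + 1 < cyl_width h k b'"
        using *(3) by (auto simp: m m' glue_wide_def split: if_splits)
      thus ?thesis using * by (simp add: m m')
    next
      case False
      hence top: "y = cyl_width h k b - 1" "y' = cyl_width h k b' - 1"
        using * by (auto simp: m m' cells_def)
      have b: "b = b'"
        using *(3) False pos by (cases b; cases b') (auto simp: m m' glue_wide_def split: if_splits)
      have "(x + (if b then \<beta> else \<alpha>)) mod cyl_width w v b = (x' + (if b then \<beta> else \<alpha>)) mod cyl_width w v b"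
        using *(3) False b glue_wide_inj by (auto simp: m m' cyl_width_def split: if_splits)
      moreover have "x < cyl_width w v b" "x' < cyl_width w v b" using * b by (auto simp: m m' cells_def)
      ultimately have "x = x'" using mod_shift_inj by blast
      thus ?thesis using b top by (simp add: m m')
    qed
  qed
  moreover have "U ` M \<subseteq> M" using U_in by auto
  ultimately show ?thesis using endo_inj_surj[OF finite_cells] by (auto simp: bij_betw_def)
qed

text \<open>The corners are the left ends of the three arcs into which the gluing divides the
  bottoms of the cylinders: the wide bottom is cut at 0 and at \<open>v - w\<close>, the narrow one
  only at 0.\<close>

definition C where
  "C m = (if m = (True, 0, 0) then (False, 0, 0) else if m = (False, 0, 0) then (True, v - w, 0)
          else if m = (True, v - w, 0) then (True, 0, 0) else m)"

lemma corners_in: "(True, 0, 0) \<in> M" "(False, 0, 0) \<in> M" "(True, v - w, 0) \<in> M"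
  using pos by (auto simp: cells_def cyl_width_def)

lemma R_U:
  assumes "m \<in> M"
  shows "R (U m) = C (U (R m))"
proof -
  obtain b x y where m: "m = (b, x, y)" by (cases m) auto
  have x: "x < cyl_width w v b" and y: "y < cyl_width h k b" using assms by (auto simp: m cells_def)
  consider (inside) "y + 1 < cyl_width h k b" | (narrow) "\<not> y + 1 < cyl_width h k b" "\<not> b"
    | (wide) "\<not> y + 1 < cyl_width h k b" b by blast
  thus ?thesis
  proof cases
    case inside
    thus ?thesis by (simp add: m C_def)
  next
    case narrow
    define z where "z = (x + \<alpha>) mod w"
    have z: "z < w" using pos by (simp add: z_def)
    have UR: "U (R m) = (True, v - w + (if Suc z = w then 0 else Suc z), 0)"
      using narrow mod_shift_Suc[OF pos(1), of x \<alpha>] by (simp add: m cyl_width_def z_def)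
    have "R (U m) = (True, (v - w + z + 1) mod v, 0)" using narrow by (simp add: m cyl_width_def z_def)
    thus ?thesis using UR z pos by (auto simp: C_def)
  next
    case wide
    define z where "z = (x + \<beta>) mod v"
    have z: "z < v" using pos by (simp add: z_def)
    have v0: "0 < v" using pos by simp
    have UR: "U (R m) = glue_wide w v (if Suc z = v then 0 else Suc z)"
      using wide mod_shift_Suc[OF v0, of x \<beta>] by (simp add: m cyl_width_def z_def)
    have "R (U m) = R (glue_wide w v z)" using wide by (simp add: m cyl_width_def z_def)
    \<comment> \<open>\<open>z + 1 = v - w\<close> and \<open>z + 1 = v\<close> mark the ends of the
      two arcs on the top of the wide cylinder. Only there does it matter whether one moves right
      before or after crossing the top, and \<open>C\<close> accounts for the difference.\<close>
    moreover consider "z + 1 < v - w" | "z + 1 = v - w" | "v - w \<le> z" "z + 1 < v" | "z + 1 = v"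
      using z by linarith
    hence "R (glue_wide w v z) = C (glue_wide w v (if Suc z = v then 0 else Suc z))"
    proof cases
      case 1 thus ?thesis using pos z by (auto simp: glue_wide_def C_def cyl_width_def)
    next
      case 2 thus ?thesis using pos z by (auto simp: glue_wide_def C_def cyl_width_def)
    next
      case 3
      hence "Suc (z - (v - w)) < w" "Suc z - (v - w) = Suc (z - (v - w))" using pos by linarith+
      thus ?thesis using 3 pos by (auto simp: glue_wide_def C_def cyl_width_def)
    next
      case 4
      hence "Suc (z - (v - w)) = w" "\<not> z < v - w" using pos by linarith+
      thus ?thesis using 4 pos by (auto simp: glue_wide_def C_def cyl_width_def)
    qed
    ultimately show ?thesis using UR by simp
  qed
qed

section \<open>Labelled two-cylinder surfaces and generation\<close>

definition coord where
  "coord f s t \<longleftrightarrow> modelled n M R U f s t"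

lemma coord_transport: "f \<in> bijections M {1..n} \<Longrightarrow> coord f (transport f M R) (transport f M U)"
  unfolding coord_def using bij_R bij_U by (intro modelled_transport)

lemma coord_transport_unique:
  assumes "coord f s t"
  shows "s = transport f M R" "t = transport f M U"
  using modelled_transport_unique[OF assms[unfolded coord_def]] .

context
  fixes f s t
  assumes co: "coord f s t"
begin

lemmas f_in = modelledD(7)[OF co[unfolded coord_def]]
  and f_eq_iff = modelledD(8)[OF co[unfolded coord_def]]
  and s_f = modelledD(5)[OF co[unfolded coord_def]]
  and t_f = modelledD(6)[OF co[unfolded coord_def]]
  and s_perm = modelledD(3)[OF co[unfolded coord_def]]
  and t_perm = modelledD(4)[OF co[unfolded coord_def]]

lemma f_surj:
  assumes "z \<in> {1..n}"
  obtains b x y where "(b, x, y) \<in> M" "z = f (b, x, y)"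
  using modelled_surj[OF co[unfolded coord_def] assms] by (metis prod.exhaust)

lemma commutator_is_coord: "commutator_is n s t (f (True, 0, 0)) (f (False, 0, 0)) (f (True, v - w, 0))"
  by (rule modelled_commutator[OF co[unfolded coord_def] _ corners_in R_in U_in])
     (use pos R_U in \<open>auto simp: C_def Let_def\<close>)

lemma s_pow: "(b, x, y) \<in> M \<Longrightarrow> (s ^^ i) (f (b, x, y)) = f (b, (x + i) mod cyl_width w v b, y)"
proof (induction i)
  case (Suc i)
  have "(b, (x + i) mod cyl_width w v b, y) \<in> M" using Suc.prems width_pos by (simp add: cells_def)
  thus ?case using Suc by (simp add: s_f mod_simps)
qed (simp add: cells_def)

lemma s_pow_base: "x < cyl_width w v b \<Longrightarrow> (s ^^ x) (f (b, 0, 0)) = f (b, x, 0)"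
  using s_pow[of b 0 0 x] width_pos by (simp add: cells_def)

lemma t_pow: "x < cyl_width w v b \<Longrightarrow> y < cyl_width h k b \<Longrightarrow> (t ^^ y) (f (b, x, 0)) = f (b, x, y)"
proof (induction y)
  case (Suc y)
  moreover have "(b, x, y) \<in> M" using Suc.prems by (simp add: cells_def)
  ultimately show ?case by (simp add: t_f)
qed simp

lemma f_eq: "(b, x, y) \<in> M \<Longrightarrow> f (b, x, y) = (t ^^ y) ((s ^^ x) (f (b, 0, 0)))"
  by (simp add: s_pow_base t_pow cells_def)

lemma orel_f_iff:
  assumes "(b, x, y) \<in> M" "(b', x', y') \<in> M"
  shows "(f (b, x, y), f (b', x', y')) \<in> orel n s \<longleftrightarrow> b = b' \<and> y = y'"
proof
  assume "(f (b, x, y), f (b', x', y')) \<in> orel n s"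
  then obtain i where "f (b', x', y') = (s ^^ i) (f (b, x, y))" by (auto simp: orel_def)
  hence "f (b', x', y') = f (b, (x + i) mod cyl_width w v b, y)" using s_pow[OF assms(1)] by simp
  moreover have "(b, (x + i) mod cyl_width w v b, y) \<in> M" using assms width_pos by (simp add: cells_def)
  ultimately show "b = b' \<and> y = y'" using f_eq_iff assms(2) by simp
next
  assume *: "b = b' \<and> y = y'"
  have base: "(b, 0, y) \<in> M" using assms width_pos by (simp add: cells_def)
  have "(f (b, 0, y), f (b, x, y)) \<in> orel n s" if "(b, x, y) \<in> M" for x
    using orel_funpow[OF f_in[OF base], where f = s and k = x] s_pow[OF base, of x] that by (simp add: cells_def)
  thus "(f (b, x, y), f (b', x', y')) \<in> orel n s"
    using assms * orelD(4)[OF s_perm orelD(3)[OF s_perm, of "f (b, 0, y)" "f (b, x, y)"], of "f (b', x', y')"] by simp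
qed

lemma orel_corners:
  "(f (True, 0, 0), f (True, v - w, 0)) \<in> orel n s" "(f (True, 0, 0), f (False, 0, 0)) \<notin> orel n s"
  "(f (True, v - w, 0), f (False, 0, 0)) \<notin> orel n s"
  using orel_f_iff corners_in by simp_all

text \<open>The assumptions say that the linear form A x + B y is divisible by \<open>m\<close> on
  the four period vectors, so it is well defined on the surface modulo \<open>m\<close>. It vanishes
  at two distinct corners, hence everywhere, in particular one step to the right of a
  corner.\<close>

lemma pairsA_coord_dvd:
  fixes A B m :: int
  assumes st: "(s, t) \<in> pairsA n"
    and m: "m dvd A * int w" "m dvd A * int v" "m dvd A * int \<beta> - B * int k" "m dvd A * int \<alpha> - B * int h"
  shows "m dvd A" "m dvd B"
proof -
  define val where "val = (\<lambda>(b::bool, x, y). A * int x + B * int y)"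
  have valR: "[val (R c) = val c + A] (mod m)" if "c \<in> M" for c
  proof -
    obtain b x y where c: "c = (b, x, y)" by (cases c) auto
    have "m dvd A * int (cyl_width w v b)" using m by (simp add: cyl_width_def)
    hence "[A * int ((x + 1) mod cyl_width w v b) + B * int y = A * int (x + 1) + B * int y] (mod m)"
      by (intro cong_add int_mod_mult_cong cong_refl)
    thus ?thesis by (simp add: c val_def algebra_simps)
  qed
  have md: "m dvd A * int (v - w)" using m(1,2) pos by (simp add: of_nat_diff right_diff_distrib)
  have valU: "[val (U c) = val c + B] (mod m)" if "c \<in> M" for c
  proof -
    obtain b x y where c: "c = (b, x, y)" by (cases c) auto
    have y: "y < cyl_width h k b" using that by (simp add: c cells_def)
    consider (inside) "y + 1 < cyl_width h k b" | (narrow) "\<not> y + 1 < cyl_width h k b" "\<not> b"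
      | (wide) "\<not> y + 1 < cyl_width h k b" b by blast
    thus ?thesis
    proof cases
      case inside
      thus ?thesis by (simp add: c val_def algebra_simps)
    next
      case narrow
      hence yh: "int y + 1 = int h" using y by (simp add: cyl_width_def)
      have "[A * int (v - w) + A * int ((x + \<alpha>) mod w) = 0 + A * int (x + \<alpha>)] (mod m)"
        using md m(1) by (intro cong_add int_mod_mult_cong) (simp_all add: cong_0_iff)
      hence "[val (U c) = A * int x + A * int \<alpha>] (mod m)"
        using narrow by (simp add: c val_def distrib_left)
      moreover have "[A * int x + A * int \<alpha> = A * int x + B * int h] (mod m)"
        using m(4) by (intro cong_add cong_refl) (simp add: cong_iff_dvd_diff)
      moreover have "A * int x + B * int h = val c + B"
        by (simp add: c val_def yh[symmetric] distrib_left)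
      ultimately show ?thesis by (metis cong_trans)
    next
      case wide
      hence yk: "int y + 1 = int k" using y by (simp add: cyl_width_def)
      define z where "z = (x + \<beta>) mod v"
      have "[val (glue_wide w v z) = A * int z] (mod m)"
      proof (cases "z < v - w")
        case False
        hence "val (glue_wide w v z) - A * int z = - (A * int (v - w))"
          by (simp add: glue_wide_def val_def of_nat_diff algebra_simps)
        thus ?thesis using md by (simp add: cong_iff_dvd_diff)
      qed (simp add: glue_wide_def val_def)
      moreover have "[A * int z = A * int (x + \<beta>)] (mod m)"
        unfolding z_def using m(2) by (rule int_mod_mult_cong)
      ultimately have "[val (U c) = A * int x + A * int \<beta>] (mod m)"
        using wide by (simp add: c z_def distrib_left) (metis cong_trans)
      moreover have "[A * int x + A * int \<beta> = A * int x + B * int k] (mod m)"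
        using m(3) by (intro cong_add cong_refl) (simp add: cong_iff_dvd_diff)
      moreover have "A * int x + B * int k = val c + B"
        by (simp add: c val_def yk[symmetric] distrib_left)
      ultimately show ?thesis by (metis cong_trans)
    qed
  qed
  have *: "[A * int x + B * int y = 0] (mod m)" if "(b, x, y) \<in> M" for b x y
  proof -
    have "[val (b, x, y) = val (True, 0, 0)] (mod m)"
      by (rule pairsA_modelled_cong[OF st co[unfolded coord_def] R_in U_in valR valU corners_in(1,2) _ _ that corners_in(1)])
         (simp_all add: val_def)
    thus ?thesis by (simp add: val_def)
  qed
  have "(True, 1, 0) \<in> M" using pos by (simp add: cells_def cyl_width_def)
  from *[OF this] show A: "m dvd A" by (simp add: cong_0_iff)
  \<comment> \<open>If the wide cylinder has height 1 there is no cell above its base row; then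
    \<open>B\<close> is read off from the twist of that cylinder.\<close>
  show "m dvd B"
  proof (cases "k > 1")
    case True
    hence "(True, 0, 1) \<in> M" using pos by (simp add: cells_def cyl_width_def)
    from *[OF this] show ?thesis by (simp add: cong_0_iff)
  next
    case False
    hence "k = 1" using pos by simp
    hence "m dvd A * int \<beta> - B" using m(3) by simp
    with dvd_mult2[OF A] have "m dvd A * int \<beta> - (A * int \<beta> - B)" by (rule dvd_diff)
    thus ?thesis by (simp only: diff_diff_eq2 add_diff_cancel_left')
  qed
qed

text \<open>If the lattice spanned by \<open>(w, 0)\<close>, \<open>(v, 0)\<close>, \<open>(- \<alpha>, h)\<close>, \<open>(- \<beta>, k)\<close> is proper, some linear form
  \<open>A x + B y\<close> descends to the surface modulo a prime.\<close>

lemma pairsA_coord_coprime: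
  assumes st: "(s, t) \<in> pairsA n"
  shows "coprime h k" "(\<alpha>, \<beta>) \<in> twist_pairs w v h k"
proof -
  \<comment> \<open>The form y, modulo \<open>gcd h k\<close>: it is divisible by the modulus on all
    periods because the heights are.\<close>
  have "int (gcd h k) dvd 1"
    by (rule pairsA_coord_dvd(2)[OF st, of _ 0]) auto
  thus hk: "coprime h k" by (simp add: coprime_iff_gcd_eq_1)
  have "coprime (int (gcd w v)) (int h * int \<beta> - int k * int \<alpha>)"
  proof (rule ccontr)
    assume "\<not> coprime (int (gcd w v)) (int h * int \<beta> - int k * int \<alpha>)"
    then obtain c where c: "c dvd int (gcd w v)" "c dvd int h * int \<beta> - int k * int \<alpha>" "\<not> is_unit c"
      by (meson not_coprimeE)
    have "c \<noteq> 0" using c(1) pos by auto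
    then obtain p where p: "prime p" "p dvd c" using c(3) prime_divisorE by blast
    have "int (gcd w v) dvd int w" "int (gcd w v) dvd int v" by simp_all
    hence pw: "p dvd int w" "p dvd int v"
      using dvd_trans[OF dvd_trans[OF p(2) c(1)]] by blast+
    have pt: "p dvd int h * int \<beta> - int k * int \<alpha>" using p(2) c(2) by (rule dvd_trans)
    \<comment> \<open>The form h x + \<alpha> y kills the period (-\<alpha>, h), and modulo
      \<open>p\<close> also the others, by the choice of \<open>p\<close> as a divisor of the
      determinant and of both widths. The form k x + \<beta> y does the same for (-\<beta>, k), and
      together they contradict coprimality of the heights.\<close>
    have "p dvd int h"
      by (rule pairsA_coord_dvd(1)[OF st, of p "int h" "int \<alpha>"])
         (use pw pt in \<open>auto simp: mult.commute\<close>)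
    moreover have "p dvd int k"
      by (rule pairsA_coord_dvd(1)[OF st, of p "int k" "int \<beta>"])
         (use pw pt dvd_diff_commute in \<open>auto simp: mult.commute\<close>)
    ultimately have "p dvd gcd (int h) (int k)" by (rule gcd_greatest)
    hence "p dvd int (gcd h k)" unfolding gcd_int_int_eq .
    hence "p dvd 1" using hk by simp
    thus False using p(1) not_prime_unit by blast
  qed
  thus "(\<alpha>, \<beta>) \<in> twist_pairs w v h k" using twist by (simp add: twist_pairs_def)
qed

end

end

context two_cylinder
begin

context
  fixes f s t
  assumes co: "coord f s t"
begin

lemma t_pow_narrow: "(t ^^ h) (f (False, 0, 0)) = f (True, v - w + \<alpha>, 0)"
proof -
  obtain j where j: "h = Suc j" using pos by (cases h) auto
  have "(t ^^ j) (f (False, 0, 0)) = f (False, 0, j)"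
    using t_pow[OF co, of 0 False j] pos j by (simp add: cyl_width_def)
  moreover have "(False, 0, j) \<in> M" using pos j by (simp add: cells_def cyl_width_def)
  ultimately show ?thesis using t_f[OF co, of "(False, 0, j)"] twist(1) j by (simp add: cyl_width_def)
qed

lemma t_pow_wide: "(t ^^ k) (f (True, 0, 0)) = f (glue_wide w v \<beta>)"
proof -
  obtain j where j: "k = Suc j" using pos by (cases k) auto
  have "(t ^^ j) (f (True, 0, 0)) = f (True, 0, j)"
    using t_pow[OF co, of 0 True j] pos j by (simp add: cyl_width_def)
  moreover have "(True, 0, j) \<in> M" using pos j by (simp add: cells_def cyl_width_def)
  ultimately show ?thesis using t_f[OF co, of "(True, 0, j)"] twist(2) j by (simp add: cyl_width_def)
qed

text \<open>Once the corners are identified, \<open>s\<close> and \<open>t\<close> commute on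
  classes, so the classes form a quotient of Z^2 by a lattice containing the periods of the
  cylinders. By the coprimality conditions these generate Z^2, which leaves a single class.\<close>

lemma coord_pairsA:
  assumes hk: "coprime h k" and tw: "(\<alpha>, \<beta>) \<in> twist_pairs w v h k"
  shows "(s, t) \<in> pairsA n"
proof (rule pairsA_I[OF commutator_is_coord[OF co]])
  let ?p = "f (True, 0, 0)" and ?q = "f (False, 0, 0)" and ?r = "f (True, v - w, 0)"
  fix E assume E: "stable_equiv n s t E" and pq: "(?p, ?q) \<in> E" and qr: "(?q, ?r) \<in> E"
  note sp = s_perm[OF co] and tp = t_perm[OF co]
  note eD = stable_equivD[OF E]
  have pqr_in: "?p \<in> {1..n}" "?q \<in> {1..n}" "?r \<in> {1..n}" using f_in[OF co] corners_in by blast+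
  text \<open>Passing to classes turns the relations into equations.\<close>
  define \<kappa> where "\<kappa> = (\<lambda>x. E `` {x})"
  have \<kappa>: "\<kappa> x = \<kappa> y \<longleftrightarrow> (x, y) \<in> E" if "x \<in> {1..n}" "y \<in> {1..n}" for x y
    using E that unfolding \<kappa>_def stable_equiv_def by (intro eq_equiv_class_iff) auto
  have s_in: "s x \<in> {1..n} \<longleftrightarrow> x \<in> {1..n}" and t_in: "t x \<in> {1..n} \<longleftrightarrow> x \<in> {1..n}" for x
    using permutes_in_image[OF sp] permutes_in_image[OF tp] by blast+
  have \<kappa>_s: "\<kappa> (s x) = \<kappa> (s y) \<longleftrightarrow> \<kappa> x = \<kappa> y" if xy: "x \<in> {1..n}" "y \<in> {1..n}" for x y
  proof -
    have "(x, y) \<in> E" if "(s x, s y) \<in> E"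
      using inv_in_finite_invariant_rel[OF sp eD(1,5) that] permutes_inverses(2)[OF sp] by simp
    thus ?thesis using \<kappa>[OF xy] \<kappa>[of "s x" "s y"] s_in xy eD(5)[of x y] by blast
  qed
  have \<kappa>_t: "\<kappa> (t x) = \<kappa> (t y) \<longleftrightarrow> \<kappa> x = \<kappa> y" if xy: "x \<in> {1..n}" "y \<in> {1..n}" for x y
  proof -
    have "(x, y) \<in> E" if "(t x, t y) \<in> E"
      using inv_in_finite_invariant_rel[OF tp eD(1,6) that] permutes_inverses(2)[OF tp] by simp
    thus ?thesis using \<kappa>[OF xy] \<kappa>[of "t x" "t y"] t_in xy eD(6)[of x y] by blast
  qed
  have \<kappa>_pqr: "\<kappa> ?q = \<kappa> ?p" "\<kappa> ?r = \<kappa> ?p"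
    using \<kappa> pq qr pqr_in by metis+
  have comm: "\<kappa> (s (t x)) = \<kappa> (t (s x))" for x
  proof -
    note c = commutator_is_coord[OF co]
    note cyc = cycle_of_list_3[OF commutator_isD(3)[OF c]]
    have "\<kappa> (cycle_of_list [?p, ?q, ?r] y) = \<kappa> y" for y
    proof -
      consider "y = ?p" | "y = ?q" | "y = ?r" | "y \<noteq> ?p" "y \<noteq> ?q" "y \<noteq> ?r" by blast
      thus ?thesis using cyc \<kappa>_pqr by cases simp_all
    qed
    thus ?thesis using commutator_isD(7)[OF c] by simp
  qed
  \<comment> \<open>The orbit of the base corner under commuting moves, with natural exponents;
    negative ones enter only through differences.\<close>
  define pt where "pt = (\<lambda>i j. (t ^^ j) ((s ^^ i) ?p))"
  have pt_in: "pt i j \<in> {1..n}" for i j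
    using pqr_in by (simp only: pt_def funpow_in_carrier[OF sp] funpow_in_carrier[OF tp])
  have s_pt: "\<kappa> (s (pt i j)) = \<kappa> (pt (Suc i) j)" for i j
  proof (induction j)
    case (Suc j)
    have "\<kappa> (s (pt i (Suc j))) = \<kappa> (t (s (pt i j)))" using comm by (simp add: pt_def)
    also have "\<dots> = \<kappa> (t (pt (Suc i) j))" using Suc \<kappa>_t s_in pt_in by blast
    finally show ?case by (simp add: pt_def)
  qed (simp add: pt_def)
  have shift1: "\<kappa> (pt (Suc i) j) = \<kappa> (pt (Suc i') j') \<longleftrightarrow> \<kappa> (pt i j) = \<kappa> (pt i' j')" for i j i' j'
    unfolding s_pt[symmetric] by (rule \<kappa>_s[OF pt_in pt_in])
  have shift2: "\<kappa> (pt i (Suc j)) = \<kappa> (pt i' (Suc j')) \<longleftrightarrow> \<kappa> (pt i j) = \<kappa> (pt i' j')" for i j i' j'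
    using \<kappa>_t[OF pt_in pt_in] by (simp add: pt_def)
  have shift: "\<kappa> (pt (i + a) (j + b)) = \<kappa> (pt (i' + a) (j' + b)) \<longleftrightarrow> \<kappa> (pt i j) = \<kappa> (pt i' j')" for i j i' j' a b
  proof -
    have "\<kappa> (pt (i + a) (j + b)) = \<kappa> (pt (i' + a) (j' + b)) \<longleftrightarrow> \<kappa> (pt i (j + b)) = \<kappa> (pt i' (j' + b))"
      by (induction a) (simp_all add: shift1)
    also have "\<dots> \<longleftrightarrow> \<kappa> (pt i j) = \<kappa> (pt i' j')"
      by (induction b) (simp_all add: shift2)
    finally show ?thesis .
  qed
  text \<open>\<open>\<Lambda>\<close> is the lattice of vectors by which \<open>s\<close> and \<open>t\<close> act trivially on classes.\<close>
  define \<Lambda> where "\<Lambda> = (\<lambda>(a::int) (b::int). \<exists>i j i' j'. a = int i - int i' \<and> b = int j - int j' \<and> \<kappa> (pt i j) = \<kappa> (pt i' j'))"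
  have \<Lambda>I: "\<Lambda> (int i - int i') (int j - int j')" if "\<kappa> (pt i j) = \<kappa> (pt i' j')" for i j i' j'
    using that unfolding \<Lambda>_def by blast
  \<comment> \<open>By \<open>shift\<close>, an equality of classes survives adding and cancelling
    exponents, so membership does not depend on the exponents chosen to represent a vector.\<close>
  have \<Lambda>_iff: "\<Lambda> (int i - int i') (int j - int j') \<longleftrightarrow> \<kappa> (pt i j) = \<kappa> (pt i' j')" for i j i' j'
  proof
    assume "\<Lambda> (int i - int i') (int j - int j')"
    then obtain a b a' b' where *: "int i - int i' = int a - int a'" "int j - int j' = int b - int b'"
      "\<kappa> (pt a b) = \<kappa> (pt a' b')" unfolding \<Lambda>_def by blast
    have "i + a' = a + i'" "j + b' = b + j'" using *(1,2) by linarith+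
    moreover have "\<kappa> (pt (a + i') (b + j')) = \<kappa> (pt (a' + i') (b' + j'))" using *(3) by (simp only: shift)
    ultimately have "\<kappa> (pt (i + a') (j + b')) = \<kappa> (pt (i' + a') (j' + b'))"
      by (simp only: add.commute)
    thus "\<kappa> (pt i j) = \<kappa> (pt i' j')" by (simp only: shift)
  qed (rule \<Lambda>I)
  have add: "\<Lambda> (a + a') (b + b')" if ab: "\<Lambda> a b" "\<Lambda> a' b'" for a b a' b'
  proof -
    obtain i j i' j' where 1: "a = int i - int i'" "b = int j - int j'" "\<kappa> (pt i j) = \<kappa> (pt i' j')"
      using ab(1) unfolding \<Lambda>_def by blast
    obtain x y x' y' where 2: "a' = int x - int x'" "b' = int y - int y'" "\<kappa> (pt x y) = \<kappa> (pt x' y')"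
      using ab(2) unfolding \<Lambda>_def by blast
    have "\<kappa> (pt (i + x) (j + y)) = \<kappa> (pt (i' + x) (j' + y))" using 1(3) by (simp only: shift)
    moreover have "\<kappa> (pt (x + i') (y + j')) = \<kappa> (pt (x' + i') (y' + j'))" using 2(3) by (simp only: shift)
    ultimately have "\<kappa> (pt (i + x) (j + y)) = \<kappa> (pt (x' + i') (y' + j'))" by (simp only: add.commute)
    from \<Lambda>I[OF this] have "\<Lambda> (int (i + x) - int (x' + i')) (int (j + y) - int (y' + j'))" .
    moreover have "a + a' = int (i + x) - int (x' + i')" "b + b' = int (j + y) - int (y' + j')"
      using 1(1,2) 2(1,2) by simp_all
    ultimately show ?thesis by (simp only:)
  qed
  have neg: "\<Lambda> (- a) (- b)" if "\<Lambda> a b" for a b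
    using that unfolding \<Lambda>_def by (metis minus_diff_eq)
  have mult: "\<Lambda> (c * a) (c * b)" if "\<Lambda> a b" for a b c
    using mult_in_subgroup[of "\<lambda>c. \<Lambda> (c * a) (c * b)" 1 c] add neg that by (simp add: distrib_right)
  have s_pow0: "(s ^^ x) (f (b, 0, 0)) = f (b, x mod cyl_width w v b, 0)" for x b
    using s_pow[OF co, of b 0 0 x] corners_in by (cases b) auto
  have \<kappa>_s_pow: "\<kappa> ((s ^^ x) ?q) = \<kappa> (pt x 0)" for x
  proof (induction x)
    case (Suc x)
    have "(s ^^ x) ?q \<in> {1..n}" using funpow_in_carrier[OF sp] pqr_in(2) by blast
    from \<kappa>_s[OF this pt_in[of x 0]] show ?case using Suc by (simp add: pt_def)
  qed (simp add: pt_def \<kappa>_pqr)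
  have \<kappa>_t_pow: "\<kappa> ((t ^^ y) ?q) = \<kappa> (pt 0 y)" for y
  proof (induction y)
    case (Suc y)
    have "(t ^^ y) ?q \<in> {1..n}" using funpow_in_carrier[OF tp] pqr_in(2) by blast
    from \<kappa>_t[OF this pt_in[of 0 y]] show ?case using Suc by (simp add: pt_def)
  qed (simp add: pt_def \<kappa>_pqr)
  have pt00: "pt 0 0 = ?p" by (simp add: pt_def)
  have "\<kappa> (pt v 0) = \<kappa> (pt 0 0)" using s_pow0[of v True] by (simp add: pt_def cyl_width_def)
  from \<Lambda>I[OF this] have \<Lambda>v: "\<Lambda> (int v) 0" by simp
  have "\<kappa> (pt w 0) = \<kappa> (pt 0 0)"
    using \<kappa>_s_pow[of w] s_pow0[of w False] \<kappa>_pqr(1) by (simp add: cyl_width_def pt00)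
  from \<Lambda>I[OF this] have \<Lambda>w: "\<Lambda> (int w) 0" by simp
  have \<Lambda>d: "\<Lambda> (int (v - w)) 0" using add[OF \<Lambda>v neg[OF \<Lambda>w]] pos by (simp add: of_nat_diff)
  have s_pt0: "pt x 0 = f (True, x, 0)" if "x < v" for x
    using s_pow0[of x True] that by (simp add: pt_def cyl_width_def)
  \<comment> \<open>The narrow top is glued from column \<open>v - w\<close> on; this offset is
    itself a period and is removed by \<open>\<Lambda>d\<close>.\<close>
  have "\<kappa> (pt 0 h) = \<kappa> (pt (v - w + \<alpha>) 0)"
    using \<kappa>_t_pow[of h] t_pow_narrow s_pt0[of "v - w + \<alpha>"] pos twist by simp
  from add[OF \<Lambda>I[OF this] \<Lambda>d] have \<Lambda>h: "\<Lambda> (- int \<alpha>) (int h)" by simp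
  have \<Lambda>k: "\<Lambda> (- int \<beta>) (int k)"
  proof (cases "\<beta> < v - w")
    case True
    have "\<kappa> (pt 0 k) = \<kappa> (pt \<beta> 0)"
      using t_pow_wide s_pt0[of \<beta>] True twist by (simp add: glue_wide_def pt_def)
    from \<Lambda>I[OF this] show ?thesis by simp
  next
    case False
    have "\<kappa> (pt 0 k) = \<kappa> (f (False, \<beta> - (v - w), 0))"
      using t_pow_wide False by (simp add: glue_wide_def pt_def)
    also have "\<dots> = \<kappa> (pt (\<beta> - (v - w)) 0)"
      using \<kappa>_s_pow[of "\<beta> - (v - w)"] s_pow0[of "\<beta> - (v - w)" False] pos twist by (simp add: cyl_width_def)
    finally have "\<kappa> (pt 0 k) = \<kappa> (pt (\<beta> - (v - w)) 0)" .
    from add[OF \<Lambda>I[OF this] neg[OF \<Lambda>d]] show ?thesis using False by (simp add: of_nat_diff)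
  qed
  have \<Lambda>g: "\<Lambda> (gcd (int w) (int v)) 0"
    using gcd_in_subgroup[of "\<lambda>a. \<Lambda> a 0", OF _ _ \<Lambda>w \<Lambda>v] add[of _ 0 _ 0] neg[of _ 0] by simp
  \<comment> \<open>Taking \<open>h\<close> times (-\<beta>, k) minus \<open>k\<close> times
    (-\<alpha>, h) cancels the vertical part and leaves the determinant as a horizontal
    period.\<close>
  have "\<Lambda> (int k * int \<alpha> - int h * int \<beta>) 0"
    using add[OF mult[OF \<Lambda>k, of "int h"] mult[OF \<Lambda>h, of "- int k"]] by (simp add: algebra_simps)
  hence "\<Lambda> (gcd (gcd (int w) (int v)) (int k * int \<alpha> - int h * int \<beta>)) 0"
    using gcd_in_subgroup[of "\<lambda>a. \<Lambda> a 0", OF _ _ \<Lambda>g] add[of _ 0 _ 0] neg[of _ 0] by simp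
  moreover have "coprime (gcd (int w) (int v)) (int k * int \<alpha> - int h * int \<beta>)"
  proof -
    have "coprime (gcd (int w) (int v)) (- (int h * int \<beta> - int k * int \<alpha>))"
      using tw by (simp only: twist_pairs_def coprime_minus_right_iff mem_Collect_eq case_prod_conv gcd_int_int_eq)
    thus ?thesis by (simp only: minus_diff_eq)
  qed
  ultimately have \<Lambda>10: "\<Lambda> 1 0" by (simp only: coprime_imp_gcd_eq_1)
  have add0: "\<Lambda> 0 (b + b')" if "\<Lambda> 0 b" "\<Lambda> 0 b'" for b b' using add[OF that] by simp
  have neg0: "\<Lambda> 0 (- b)" if "\<Lambda> 0 b" for b using neg[OF that] by simp
  have "\<Lambda> 0 (int h)" using add[OF \<Lambda>h mult[OF \<Lambda>10, of "int \<alpha>"]] by simp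
  moreover have "\<Lambda> 0 (int k)" using add[OF \<Lambda>k mult[OF \<Lambda>10, of "int \<beta>"]] by simp
  ultimately have "\<Lambda> 0 (gcd (int h) (int k))"
    by (intro gcd_in_subgroup[of "\<Lambda> 0" "int h" "int k"]) (simp_all only: add0 neg0)
  hence \<Lambda>01: "\<Lambda> 0 1" using hk by simp
  have 1: "\<kappa> (pt 1 0) = \<kappa> (pt 0 0)" using \<Lambda>_iff[of 1 0 0 0] \<Lambda>10 by simp
  have 2: "\<kappa> (pt 0 1) = \<kappa> (pt 0 0)" using \<Lambda>_iff[of 0 0 1 0] \<Lambda>01 by simp
  have "\<kappa> (pt i 0) = \<kappa> ?p" for i
  proof (induction i)
    case (Suc i)
    thus ?case using shift[of 1 i 0 0 0 0] 1 by simp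
  qed (simp add: pt00)
  hence all: "\<kappa> (pt i j) = \<kappa> ?p" for i j
  proof (induction j)
    case (Suc j)
    thus ?case using shift[of 0 i 1 j 0 0] 2 by simp
  qed simp
  have "\<kappa> z = \<kappa> ?p" if zin: "z \<in> {1..n}" for z
  proof -
    obtain b x y where z: "(b, x, y) \<in> M" "z = f (b, x, y)" using f_surj[OF co zin] by metis
    hence zb: "z = (t ^^ y) ((s ^^ x) (f (b, 0, 0)))" using f_eq[OF co] by simp
    have base: "f (b, 0, 0) \<in> {1..n}" using pqr_in by (cases b) auto
    have "\<kappa> ((s ^^ x) (f (b, 0, 0))) = \<kappa> (pt x 0)" using \<kappa>_s_pow[of x] by (cases b) (simp_all add: pt_def)
    moreover have "(s ^^ x) (f (b, 0, 0)) \<in> {1..n}" using base funpow_in_carrier[OF sp] by blast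
    ultimately have "\<kappa> ((t ^^ y) ((s ^^ x) (f (b, 0, 0)))) = \<kappa> ((t ^^ y) (pt x 0))"
    proof (induction y)
      case (Suc y)
      have "(t ^^ y) ((s ^^ x) (f (b, 0, 0))) \<in> {1..n}" "(t ^^ y) (pt x 0) \<in> {1..n}"
        using Suc.prems(2) pt_in[of x 0] funpow_in_carrier[OF tp] by blast+
      from \<kappa>_t[OF this] show ?case using Suc by simp
    qed simp
    also have "\<dots> = \<kappa> (pt x y)" by (simp add: pt_def)
    finally show ?thesis using all zb by simp
  qed
  hence "(x, y) \<in> E" if "x \<in> {1..n}" "y \<in> {1..n}" for x y using \<kappa>[OF that] that by simp
  thus "E = {1..n} \<times> {1..n}" using eD(1) by auto
qed

section \<open>Recovering the data from the pair\<close>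

lemma coord_base_orel_iff:
  assumes "(b, x, y) \<in> M"
  shows "(\<exists>b'. (f (b', 0, 0), f (b, x, y)) \<in> orel n s) \<longleftrightarrow> y = 0"
  using orel_f_iff[OF co _ assms] corners_in by (metis (full_types))

lemma coord_s_pow_eq_iff: "(s ^^ i) (f (b, 0, 0)) = f (b, 0, 0) \<longleftrightarrow> cyl_width w v b dvd i"
proof -
  have base: "(b, 0, 0) \<in> M" using corners_in by (cases b) auto
  have "(b, i mod cyl_width w v b, 0) \<in> M" using width_pos by (simp add: cells_def)
  thus ?thesis using s_pow[OF co base, of i] f_eq_iff[OF co _ base] by (simp add: dvd_eq_mod_eq_0)
qed

end

end

text \<open>A height is the time after which \<open>t\<close> first returns to the two base orbits.
  If the second presentation were taller, \<open>t\<close> would still be inside its cylinder at a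
  moment when, by the first one, it is back on a base orbit.\<close>

lemma coord_height_le:
  assumes "two_cylinder n w v h k \<alpha> \<beta>" "two_cylinder n w' v' h' k' \<alpha>' \<beta>'"
    and co: "two_cylinder.coord n w v h k \<alpha> \<beta> f s t" "two_cylinder.coord n w' v' h' k' \<alpha>' \<beta>' f' s t"
    and base: "\<And>b. f (b, 0, 0) = f' (b, 0, 0)"
  shows "cyl_width h' k' b \<le> cyl_width h k b"
proof (rule ccontr)
  interpret A: two_cylinder n w v h k \<alpha> \<beta> by fact
  interpret B: two_cylinder n w' v' h' k' \<alpha>' \<beta>' by fact
  assume "\<not> cyl_width h' k' b \<le> cyl_width h k b"
  hence lt: "cyl_width h k b < cyl_width h' k' b" by simp
  define y where "y = cyl_width h k b"
  have "y > 0" using A.width_pos by (simp add: y_def)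
  have "(t ^^ y) (f' (b, 0, 0)) = f' (b, 0, y)" using B.t_pow[OF co(2)] lt B.width_pos by (simp add: y_def)
  moreover have "(b, 0, y) \<in> B.M" using lt B.width_pos by (simp add: y_def cells_def)
  ultimately have "\<nexists>b'. (f' (b', 0, 0), (t ^^ y) (f' (b, 0, 0))) \<in> orel n s"
    using B.coord_base_orel_iff[OF co(2)] \<open>y > 0\<close> by simp
  moreover have "\<exists>b'. (f (b', 0, 0), (t ^^ y) (f (b, 0, 0))) \<in> orel n s"
  proof (cases b)
    case True
    have "glue_wide w v \<beta> \<in> A.M" using A.glue_wide_in A.twist by simp
    moreover have "glue_wide w v \<beta> = (\<beta> < v - w, if \<beta> < v - w then \<beta> else \<beta> - (v - w), 0)" by (simp add: glue_wide_def)
    ultimately show ?thesis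
      using True A.t_pow_wide[OF co(1)] A.coord_base_orel_iff[OF co(1)] by (simp add: y_def cyl_width_def)
  next
    case False
    have "(True, v - w + \<alpha>, 0) \<in> A.M" using A.twist A.pos by (simp add: cells_def cyl_width_def)
    thus ?thesis
      using False A.t_pow_narrow[OF co(1)] A.coord_base_orel_iff[OF co(1)] by (simp add: y_def cyl_width_def)
  qed
  ultimately show False by (simp add: base)
qed

text \<open>The corners are recognised by the orbit relation and the cyclic order of the commutator.
  Then widths are orbit lengths, heights are return times, twists are the columns in which
  \<open>t\<close> lands, and labels follow by walking from the corners.\<close>

lemma coord_unique:
  assumes tc: "two_cylinder n w v h k \<alpha> \<beta>" "two_cylinder n w' v' h' k' \<alpha>' \<beta>'"
    and co: "two_cylinder.coord n w v h k \<alpha> \<beta> f s t" "two_cylinder.coord n w' v' h' k' \<alpha>' \<beta>' f' s t"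
  shows "(w, v, h, k, \<alpha>, \<beta>) = (w', v', h', k', \<alpha>', \<beta>')" "f = f'"
proof -
  interpret A: two_cylinder n w v h k \<alpha> \<beta> by fact
  interpret B: two_cylinder n w' v' h' k' \<alpha>' \<beta>' by fact
  let ?p = "f (True, 0, 0)" and ?q = "f (False, 0, 0)" and ?r = "f (True, v - w, 0)"
  let ?p' = "f' (True, 0, 0)" and ?q' = "f' (False, 0, 0)" and ?r' = "f' (True, v' - w', 0)"
  note cA = A.commutator_is_coord[OF co(1)] and cB = B.commutator_is_coord[OF co(2)]
  note oA = A.orel_corners[OF co(1)] and oB = B.orel_corners[OF co(2)]
  note sp = A.s_perm[OF co(1)] and tp = A.t_perm[OF co(1)]
  have cyc: "cycle_of_list [?p, ?q, ?r] = cycle_of_list [?p', ?q', ?r']"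
    using cA cB by (rule commutator_is_cycle_eq)
  note dA = commutator_isD(3)[OF cA] and dB = commutator_isD(3)[OF cB]
  note cycA = cycle_of_list_3[OF dA] and cycB = cycle_of_list_3[OF dB, folded cyc]
  have "?q' \<in> {?p, ?q, ?r}"
  proof (rule ccontr)
    assume "?q' \<notin> {?p, ?q, ?r}"
    hence "?r' = ?q'" using cycA(4)[of ?q'] cycB(2) by simp
    thus False using dB by simp
  qed
  \<comment> \<open>A rotated identification of the two triples would place the isolated corner of
    one presentation on the same \<open>s\<close>-orbit as another corner.\<close>
  moreover have "?q' \<noteq> ?p"
  proof
    assume *: "?q' = ?p"
    hence "?r' = ?q" using cycA(1) cycB(2) by simp
    moreover from this have "?p' = ?r" using cycA(2) cycB(3) by simp
    ultimately show False using oA(3) oB(1) by simp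
  qed
  moreover have "?q' \<noteq> ?r"
  proof
    assume *: "?q' = ?r"
    hence "?r' = ?p" using cycA(3) cycB(2) by simp
    moreover from this have "?p' = ?q" using cycA(1) cycB(3) by simp
    ultimately show False using oA(2) oB(1) orelD(3)[OF sp] by metis
  qed
  ultimately have qq: "?q' = ?q" by blast
  hence "?r' = ?r" using cycA(2) cycB(2) by simp
  hence "?p' = ?p" using cycA(3) cycB(3) by simp
  hence base: "f (b, 0, 0) = f' (b, 0, 0)" for b using qq by (cases b) auto
  have "cyl_width w v b = cyl_width w' v' b" for b
  proof (rule dvd_antisym)
    have *: "cyl_width w v b dvd i \<longleftrightarrow> cyl_width w' v' b dvd i" for i
      unfolding A.coord_s_pow_eq_iff[OF co(1), symmetric] B.coord_s_pow_eq_iff[OF co(2), symmetric] base ..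
    show "cyl_width w v b dvd cyl_width w' v' b" using * dvd_refl by (rule iffD2)
    show "cyl_width w' v' b dvd cyl_width w v b" using * dvd_refl by (rule iffD1)
  qed
  from this[of True] this[of False] have wv: "w' = w" "v' = v" by (simp_all add: cyl_width_def)
  have "cyl_width h k b = cyl_width h' k' b" for b
    using coord_height_le[OF tc co base] coord_height_le[OF tc(2,1) co(2,1) base[symmetric]] by (rule antisym[rotated])
  from this[of True] this[of False] have hk: "h' = h" "k' = k" by (simp_all add: cyl_width_def)
  have ff: "f c = f' c" if "c \<in> A.M" for c
  proof -
    obtain b x y where c: "c = (b, x, y)" by (cases c) auto
    thus ?thesis
      using that A.f_eq[OF co(1)] B.f_eq[OF co(2)] base by (simp add: wv hk)
  qed
  have "f \<in> extensional A.M" "f' \<in> extensional B.M"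
    using modelledD(2)[OF co(1)[unfolded A.coord_def]] modelledD(2)[OF co(2)[unfolded B.coord_def]]
    unfolding bijections_def by blast+
  hence ext: "f \<in> extensional A.M" "f' \<in> extensional A.M" unfolding wv hk .
  show "f = f'" using extensionalityI[OF ext ff] .
  have in_M: "(True, v - w + \<alpha>, 0) \<in> A.M" "(True, v - w + \<alpha>', 0) \<in> A.M"
    using A.twist B.twist A.pos wv by (auto simp: cells_def cyl_width_def)
  have "f (True, v - w + \<alpha>, 0) = f (True, v - w + \<alpha>', 0)"
    using A.t_pow_narrow[OF co(1)] B.t_pow_narrow[OF co(2)] base[of False] ff[OF in_M(2)] wv hk by simp
  hence "\<alpha> = \<alpha>'" using A.f_eq_iff[OF co(1) in_M] by simp
  moreover have in_M': "glue_wide w v \<beta> \<in> A.M" "glue_wide w v \<beta>' \<in> A.M"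
    using A.glue_wide_in A.twist B.twist wv by auto
  have "f (glue_wide w v \<beta>) = f (glue_wide w v \<beta>')"
    using A.t_pow_wide[OF co(1)] B.t_pow_wide[OF co(2)] base[of True] ff[OF in_M'(2)] wv hk by simp
  hence "glue_wide w v \<beta> = glue_wide w v \<beta>'" using A.f_eq_iff[OF co(1) in_M'] by simp
  hence "\<beta> = \<beta>'" by (rule A.glue_wide_inj)
  ultimately show "(w, v, h, k, \<alpha>, \<beta>) = (w', v', h', k', \<alpha>', \<beta>')" using wv hk by simp
qed

text \<open>An invariant set and its complement form a congruence, and it identifies two distinct
  points. This is what shows that the cylinders found below fill the surface.\<close>

lemma stable_subset_eq_carrier:
  assumes st: "(s, t) \<in> pairsA n" and S: "S \<subseteq> {1..n}" "s ` S \<subseteq> S" "t ` S \<subseteq> S"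
    and xy: "x \<in> S" "y \<in> S" "x \<noteq> y"
  shows "S = {1..n}"
proof -
  obtain p q r where c: "commutator_is n s t p q r" using st unfolding pairsA_iff by blast
  have perm: "s permutes {1..n}" "t permutes {1..n}" using commutator_isD(1,2)[OF c] .
  have fin: "finite S" using S(1) by (rule finite_subset) simp
  have iff: "g z \<in> S \<longleftrightarrow> z \<in> S" if g: "g permutes {1..n}" "g ` S \<subseteq> S" for g z
  proof -
    have inj: "inj g" using g(1) by (rule permutes_inj)
    hence "g ` S = S" using g(2) fin by (intro endo_inj_surj) (auto intro: inj_on_subset)
    thus ?thesis using inj_image_mem_iff[OF inj] by metis
  qed
  define E where "E = {(a, b). a \<in> {1..n} \<and> b \<in> {1..n} \<and> (a \<in> S \<longleftrightarrow> b \<in> S)}"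
  have "stable_equiv n s t E"
    unfolding stable_equiv_def
  proof (intro conjI allI impI equivI)
    show "E \<subseteq> {1..n} \<times> {1..n}" "refl_on {1..n} E" by (auto simp: E_def refl_on_def)
    show "sym E" unfolding E_def sym_def by blast
    show "trans E" unfolding E_def trans_def by blast
  next
    fix a b assume "(a, b) \<in> E"
    thus "(s a, s b) \<in> E" "(t a, t b) \<in> E"
      unfolding E_def using iff[OF perm(1) S(2)] iff[OF perm(2) S(3)]
        permutes_in_image[OF perm(1)] permutes_in_image[OF perm(2)] by blast+
  qed
  moreover have "(x, y) \<in> E" using xy S(1) by (auto simp: E_def)
  ultimately have E: "E = {1..n} \<times> {1..n}" by (rule pairsA_D[OF st _ _ xy(3)])
  have "z \<in> S" if "z \<in> {1..n}" for z
  proof -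
    have "(x, z) \<in> E" unfolding E using that xy(1) S(1) by blast
    thus ?thesis using xy(1) by (simp add: E_def)
  qed
  thus ?thesis using S(1) by blast
qed

section \<open>Cylinder data for corners on two orbits\<close>

lemma sum_if_less:
  assumes "d \<le> (v::nat)"
  shows "(\<Sum>i<v. if i < d then a else b) = d * a + (v - d) * (b::nat)"
proof -
  have "(\<Sum>i<v. if i < d then a else b) = sum (\<lambda>i. a) ({..<v} \<inter> {i. i < d}) + sum (\<lambda>i. b) ({..<v} \<inter> - {i. i < d})"
    by (rule sum.If_cases) simp
  moreover have "{..<v} \<inter> {i. i < d} = {..<d}" "{..<v} \<inter> - {i. i < d} = {d..<v}" using assms by auto
  ultimately show ?thesis by simp
qed

text \<open>The second case of \<open>orbit_trichotomy\<close>. \<open>d\<close> is the length of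
  the arc from \<open>p\<close> to \<open>r\<close>; it turns out to be the difference of the two
  widths.\<close>

locale two_orbits =
  fixes n :: nat and s t :: "nat \<Rightarrow> nat" and p q r d :: nat
  assumes c: "commutator_is n s t p q r"
    and r: "r = (s ^^ d) p" and d: "0 < d" "d < least_power s p"
    and pq: "(p, q) \<notin> orel n s"
begin

definition u where "u = twisted s p q r"
definition v where "v = least_power s p"
definition w where "w = least_power s q"
definition K where "K = {x. (p, x) \<in> orel n s \<or> (q, x) \<in> orel n s}"

lemmas sp = commutator_isD(1)[OF c] and tp = commutator_isD(2)[OF c] and dist = commutator_isD(3)[OF c]
  and p_in = commutator_isD(4)[OF c] and q_in = commutator_isD(5)[OF c]

lemma up: "u permutes {1..n}"
  unfolding u_def using c by (rule twisted_permutes)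

lemma u_t: "u (t x) = t (s x)"
  unfolding u_def using c by (rule twisted_conj)

lemma wv_pos: "0 < w" "0 < v" "d < v"
  using least_power_pos(1)[OF sp] d by (simp_all add: w_def v_def)

lemma p_pow_inj: "i < v \<Longrightarrow> j < v \<Longrightarrow> (s ^^ i) p = (s ^^ j) p \<longleftrightarrow> i = j"
  using funpow_inj_on_period[OF sp, of p] by (auto simp: inj_on_def v_def)

lemma q_pow_inj: "i < w \<Longrightarrow> j < w \<Longrightarrow> (s ^^ i) q = (s ^^ j) q \<longleftrightarrow> i = j"
  using funpow_inj_on_period[OF sp, of q] by (auto simp: inj_on_def w_def)

lemma p_pow_neq_q_pow: "(s ^^ i) p \<noteq> (s ^^ j) q"
proof
  assume "(s ^^ i) p = (s ^^ j) q"
  hence "(p, (s ^^ j) q) \<in> orel n s" using orel_funpow[OF p_in, of i s] by simp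
  thus False using pq orel_funpow_iff[OF sp q_in] by simp
qed

lemma p_pow_corner: "i < v \<Longrightarrow> (s ^^ i) p \<in> {p, q, r} \<longleftrightarrow> i = 0 \<or> i = d"
  using p_pow_inj[of i 0] p_pow_inj[of i d] p_pow_neq_q_pow[of i 0] wv_pos by (simp add: r)

lemma q_pow_corner: "i < w \<Longrightarrow> (s ^^ i) q \<in> {p, q, r} \<longleftrightarrow> i = 0"
  using q_pow_inj[of i 0] p_pow_neq_q_pow[of 0 i] p_pow_neq_q_pow[of d i] wv_pos by (auto simp: r)

lemma s_pow_period: "(s ^^ v) p = p" "(s ^^ w) q = q"
  using least_power_pos(2)[OF sp] by (simp_all add: v_def w_def)

lemma u_pow_p: "i < d \<Longrightarrow> (u ^^ i) p = (s ^^ i) p"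
  unfolding u_def by (rule funpow_twisted[OF dist]) (use p_pow_corner wv_pos in \<open>auto simp del: insert_iff\<close>)

lemma u_pow_q: "i < w \<Longrightarrow> (u ^^ i) q = (s ^^ i) q"
  unfolding u_def by (rule funpow_twisted[OF dist]) (use q_pow_corner in \<open>auto simp del: insert_iff\<close>)

lemma u_pow_r: "i < v - d \<Longrightarrow> (u ^^ i) r = (s ^^ (d + i)) p"
proof -
  assume i: "i < v - d"
  have eq: "(s ^^ j) r = (s ^^ (d + j)) p" for j
    unfolding r by (metis add.commute funpow_add o_apply)
  have "(u ^^ i) r = (s ^^ i) r"
    unfolding u_def
  proof (rule funpow_twisted[OF dist])
    fix j assume "0 < j" "j \<le> i"
    thus "(s ^^ j) r \<notin> {p, q, r}" unfolding eq using i by (subst p_pow_corner) auto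
  qed
  thus ?thesis using eq by simp
qed

lemma u_pow_d: "(u ^^ d) p = q"
proof -
  obtain j where j: "d = Suc j" using d by (cases d) auto
  have "(u ^^ d) p = u ((s ^^ j) p)" using u_pow_p[of j] j by simp
  also have "\<dots> = q" unfolding u_def by (rule twisted_simps(3)[OF dist]) (simp add: r j)
  finally show ?thesis .
qed

lemma u_pow_w: "(u ^^ w) q = p"
proof -
  obtain j where j: "w = Suc j" using wv_pos by (cases w) auto
  have "(u ^^ w) q = u ((s ^^ j) q)" using u_pow_q[of j] j by simp
  also have "\<dots> = p" unfolding u_def using s_pow_period(2) j by (intro twisted_simps(2)[OF dist]) simp
  finally show ?thesis .
qed

lemma u_pow_vd: "(u ^^ (v - d)) r = r"
proof -
  obtain j where j: "v - d = Suc j" using wv_pos by (cases "v - d") auto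
  have v: "v = Suc (d + j)" using j wv_pos by simp
  have "(u ^^ (v - d)) r = u ((s ^^ (d + j)) p)" using u_pow_r[of j] j by simp
  also have "\<dots> = r" unfolding u_def using s_pow_period(1) v by (intro twisted_simps(1)[OF dist]) simp
  finally show ?thesis .
qed

lemma u_pow_p': "i < w \<Longrightarrow> (u ^^ (d + i)) p = (s ^^ i) q"
proof -
  assume "i < w"
  have "(u ^^ (d + i)) p = (u ^^ i) ((u ^^ d) p)" by (metis add.commute funpow_add o_apply)
  thus ?thesis using u_pow_q[OF \<open>i < w\<close>] u_pow_d by simp
qed

lemma least_power_eqI:
  assumes "(u ^^ m) a = a" "0 < m" "\<And>i. 0 < i \<Longrightarrow> i < m \<Longrightarrow> (u ^^ i) a \<noteq> a"
  shows "least_power u a = m"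
  using least_power_le[OF assms(1,2)] least_power_pos[OF up, of a] assms(3)[of "least_power u a"] by linarith

text \<open>From \<open>p\<close>, \<open>u\<close> follows \<open>s\<close> for less than
  \<open>d\<close> steps, enters \<open>q\<close> where \<open>s\<close> would reach
  \<open>r\<close>, goes round the orbit of \<open>q\<close> and closes up at \<open>p\<close>. The
  \<open>v - d\<close> points from \<open>r\<close> on form a \<open>u\<close>-orbit of their
  own.\<close>

lemma least_power_u_p: "least_power u p = d + w"
proof (rule least_power_eqI)
  have "(u ^^ (d + w)) p = (u ^^ w) ((u ^^ d) p)" by (metis add.commute funpow_add o_apply)
  thus "(u ^^ (d + w)) p = p" using u_pow_d u_pow_w by simp
  fix i assume i: "0 < i" "i < d + w"
  show "(u ^^ i) p \<noteq> p"
  proof (cases "i < d")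
    case True
    thus ?thesis using u_pow_p p_pow_inj[of i 0] wv_pos i by simp
  next
    case False
    thus ?thesis using u_pow_p'[of "i - d"] p_pow_neq_q_pow[of 0 "i - d"] i by auto
  qed
qed (use d in simp)

lemma least_power_u_r: "least_power u r = v - d"
proof (rule least_power_eqI[OF u_pow_vd])
  fix i assume i: "0 < i" "i < v - d"
  thus "(u ^^ i) r \<noteq> r" using u_pow_r p_pow_inj[of "d + i" d] wv_pos unfolding r by simp
qed (use wv_pos in simp)

lemma K_eq: "K = (\<lambda>i. (s ^^ i) p) ` {..<v} \<union> (\<lambda>i. (s ^^ i) q) ` {..<w}"
proof (intro equalityI subsetI)
  fix x assume "x \<in> K"
  then consider "(p, x) \<in> orel n s" | "(q, x) \<in> orel n s" by (auto simp: K_def)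
  thus "x \<in> (\<lambda>i. (s ^^ i) p) ` {..<v} \<union> (\<lambda>i. (s ^^ i) q) ` {..<w}"
  proof cases
    case 1
    then obtain i where "i < least_power s p" "x = (s ^^ i) p" using orel_period[OF sp] by blast
    thus ?thesis by (auto simp: v_def)
  next
    case 2
    then obtain i where "i < least_power s q" "x = (s ^^ i) q" using orel_period[OF sp] by blast
    thus ?thesis by (auto simp: w_def)
  qed
next
  fix x assume "x \<in> (\<lambda>i. (s ^^ i) p) ` {..<v} \<union> (\<lambda>i. (s ^^ i) q) ` {..<w}"
  thus "x \<in> K" unfolding K_def using orel_funpow[OF p_in] orel_funpow[OF q_in] by blast
qed

lemma K_cases:
  assumes "x \<in> K"
  obtains i where "i < v" "x = (s ^^ i) p" | i where "i < w" "x = (s ^^ i) q"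
  using assms unfolding K_eq by blast

lemma K_sub: "K \<subseteq> {1..n}"
  using orelD(1)[OF sp] by (auto simp: K_def)

lemma s_pow_in_K: "x \<in> {1..n} \<Longrightarrow> (s ^^ i) x \<in> K \<longleftrightarrow> x \<in> K"
  using orel_funpow_iff[OF sp] by (simp add: K_def)

lemma pow_base_in_K: "(s ^^ i) p \<in> K" "(s ^^ i) q \<in> K"
  using orel_funpow[OF p_in] orel_funpow[OF q_in] by (simp_all add: K_def)

lemma u_pow_outside:
  assumes "x \<in> {1..n}" "x \<notin> K"
  shows "(u ^^ i) x = (s ^^ i) x"
  unfolding u_def
proof (rule funpow_twisted[OF dist])
  fix j
  have "p \<in> K" "q \<in> K" "r \<in> K" using pow_base_in_K(1)[of 0] pow_base_in_K(2)[of 0] pow_base_in_K(1)[of d] r by simp_all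
  moreover have "(s ^^ j) x \<notin> K" using assms s_pow_in_K by simp
  ultimately show "(s ^^ j) x \<notin> {p, q, r}" by auto
qed

lemma sum_K:
  fixes g :: "nat \<Rightarrow> nat"
  shows "sum g K = (\<Sum>i<v. g ((s ^^ i) p)) + (\<Sum>i<w. g ((s ^^ i) q))"
proof -
  have "sum g K = sum g ((\<lambda>i. (s ^^ i) p) ` {..<v}) + sum g ((\<lambda>i. (s ^^ i) q) ` {..<w})"
    unfolding K_eq by (rule sum.union_disjoint) (use p_pow_neq_q_pow in auto)
  moreover have "inj_on (\<lambda>i. (s ^^ i) p) {..<v}" "inj_on (\<lambda>i. (s ^^ i) q) {..<w}"
    using funpow_inj_on_period[OF sp] by (simp_all add: v_def w_def)
  ultimately show ?thesis by (simp add: sum.reindex)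
qed

lemma least_power_u_cases:
  "i < d \<Longrightarrow> least_power u ((s ^^ i) p) = d + w"
  "d \<le> i \<Longrightarrow> i < v \<Longrightarrow> least_power u ((s ^^ i) p) = v - d"
  "i < w \<Longrightarrow> least_power u ((s ^^ i) q) = d + w"
proof -
  show "i < d \<Longrightarrow> least_power u ((s ^^ i) p) = d + w"
    using least_power_funpow[OF up, of i p] u_pow_p least_power_u_p by simp
  show "d \<le> i \<Longrightarrow> i < v \<Longrightarrow> least_power u ((s ^^ i) p) = v - d"
    using least_power_funpow[OF up, of "i - d" r] u_pow_r[of "i - d"] least_power_u_r by simp
  show "i < w \<Longrightarrow> least_power u ((s ^^ i) q) = d + w"
    using least_power_funpow[OF up, of "d + i" p] u_pow_p' least_power_u_p by simp
qed

text \<open>The orbits of \<open>u\<close> and \<open>s\<close> have the same lengths. Comparing the sums of squares of the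
  lengths over the orbits meeting the 3-cycle leaves only one possibility.\<close>

lemma v_eq: "v = d + w"
proof -
  have "(\<Sum>x\<in>{1..n}. least_power s x) = (\<Sum>x\<in>{1..n}. least_power u (t x))"
    using least_power_conj[OF permutes_inj[OF tp], of u s] u_t by simp
  also have "\<dots> = (\<Sum>x\<in>{1..n}. least_power u x)"
    using sum.permute[OF tp, of "least_power u"] by (simp add: o_def)
  finally have eq: "(\<Sum>x\<in>{1..n}. least_power s x) = (\<Sum>x\<in>{1..n}. least_power u x)" .
  \<comment> \<open>Summed over points, orbit lengths give the sum of their squares over orbits. Off
    \<open>K\<close> the permutations \<open>u\<close> and \<open>s\<close> agree, so these points
    drop out.\<close>
  have "(\<Sum>x\<in>{1..n} - K. least_power s x) = (\<Sum>x\<in>{1..n} - K. least_power u x)"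
    by (rule sum.cong) (use u_pow_outside in \<open>auto simp: least_power_def\<close>)
  moreover have "(\<Sum>x\<in>{1..n}. g x) = (\<Sum>x\<in>{1..n} - K. g x) + sum g K" for g :: "nat \<Rightarrow> nat"
    using sum.subset_diff[OF K_sub, of g] by simp
  ultimately have "sum (least_power s) K = sum (least_power u) K" using eq by simp
  moreover have "sum (least_power s) K = v * v + w * w"
    unfolding sum_K least_power_funpow[OF sp] by (simp add: v_def w_def)
  moreover have "sum (least_power u) K = d * (d + w) + (v - d) * (v - d) + w * (d + w)"
  proof -
    have "(\<Sum>i<v. least_power u ((s ^^ i) p)) = (\<Sum>i<v. if i < d then d + w else v - d)"
      by (rule sum.cong) (auto simp: least_power_u_cases)
    also have "\<dots> = d * (d + w) + (v - d) * (v - d)" using wv_pos by (intro sum_if_less) simp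
    finally show ?thesis by (simp add: sum_K least_power_u_cases)
  qed
  ultimately have *: "v * v + w * w = d * (d + w) + (v - d) * (v - d) + w * (d + w)" by simp
  define e where "e = v - d"
  have e: "v = d + e" using wv_pos by (simp add: e_def)
  \<comment> \<open>Both sides of the comparison contain the squares of \<open>d\<close>,
    \<open>e\<close> and \<open>w\<close>; only the mixed products remain.\<close>
  have "d * e + d * e = d * w + d * w" using * unfolding e diff_add_inverse by (simp add: algebra_simps)
  hence "d * e = d * w" by linarith
  thus ?thesis using e d by simp
qed

text \<open>The height of a cylinder is the return time of \<open>t\<close> to the two orbits through the corners.\<close>

definition ret where "ret b = (LEAST y. 0 < y \<and> (t ^^ y) b \<in> K)"

lemma ret:
  assumes "b \<in> K"
  shows "0 < ret b" "(t ^^ ret b) b \<in> K" "0 < y \<Longrightarrow> y < ret b \<Longrightarrow> (t ^^ y) b \<notin> K"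
proof -
  have "0 < least_power t b \<and> (t ^^ least_power t b) b \<in> K"
    using least_power_pos[OF tp, of b] assms by simp
  from LeastI[of "\<lambda>y. 0 < y \<and> (t ^^ y) b \<in> K", OF this] show "0 < ret b" "(t ^^ ret b) b \<in> K"
    by (simp_all add: ret_def)
  show "0 < y \<Longrightarrow> y < ret b \<Longrightarrow> (t ^^ y) b \<notin> K" using not_less_Least[of y "\<lambda>y. 0 < y \<and> (t ^^ y) b \<in> K"] by (auto simp: ret_def)
qed

text \<open>\<open>t\<close> intertwines \<open>s\<close> with \<open>u\<close>, and
  \<open>u\<close> equals \<open>s\<close> off \<open>K\<close>. So \<open>t\<close> carries a whole
  row to a row until the row returns to \<open>K\<close>.\<close>

lemma t_pow_s_pow:
  assumes b: "b \<in> K" and y: "y < ret b"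
  shows "(t ^^ y) ((s ^^ x) b) = (s ^^ x) ((t ^^ y) b)"
  using y
proof (induction y)
  case (Suc y)
  have "(t ^^ Suc y) ((s ^^ x) b) = t ((s ^^ x) ((t ^^ y) b))" using Suc by simp
  also have "\<dots> = (u ^^ x) ((t ^^ Suc y) b)" using funpow_intertwine[of u t s, OF u_t] by simp
  also have "\<dots> = (s ^^ x) ((t ^^ Suc y) b)"
  proof (rule u_pow_outside)
    show "(t ^^ Suc y) b \<in> {1..n}" using b K_sub funpow_in_carrier[OF tp] by blast
    show "(t ^^ Suc y) b \<notin> K" using ret(3)[OF b] Suc.prems by blast
  qed
  finally show ?case .
qed simp

text \<open>At the return the target row lies in \<open>K\<close> and must be walked with
  \<open>u\<close> instead of \<open>s\<close>; this is the gluing of the top.\<close>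

lemma t_pow_ret: "b \<in> K \<Longrightarrow> (t ^^ ret b) ((s ^^ x) b) = (u ^^ x) ((t ^^ ret b) b)"
proof -
  assume b: "b \<in> K"
  obtain y where y: "ret b = Suc y" using ret(1)[OF b] by (cases "ret b") auto
  have "(t ^^ ret b) ((s ^^ x) b) = t ((s ^^ x) ((t ^^ y) b))" using t_pow_s_pow[OF b, of y] y by simp
  thus ?thesis using funpow_intertwine[of u t s, OF u_t] y by simp
qed

lemma least_power_u_ret: "b \<in> K \<Longrightarrow> least_power u ((t ^^ ret b) b) = least_power s b"
proof -
  assume b: "b \<in> K"
  have "(u ^^ x) ((t ^^ ret b) b) = (t ^^ ret b) b \<longleftrightarrow> (s ^^ x) b = b" for x
    unfolding t_pow_ret[OF b, symmetric] by (rule inj_eq[OF permutes_inj[OF permutes_funpow[OF tp]]])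
  thus ?thesis by (simp add: least_power_def)
qed

lemma t_pow_outside:
  assumes b: "b \<in> K" and "0 < y" "y < ret b"
  shows "(t ^^ y) ((s ^^ x) b) \<notin> K"
proof -
  have "(t ^^ y) b \<in> {1..n}" using b K_sub funpow_in_carrier[OF tp] by blast
  thus ?thesis using ret(3)[OF assms] by (simp add: t_pow_s_pow[OF b assms(3)] s_pow_in_K)
qed

lemma pq_in_K: "p \<in> K" "q \<in> K"
  using pow_base_in_K(1)[of 0] pow_base_in_K(2)[of 0] by simp_all

text \<open>The returning row is a \<open>u\<close>-orbit of length \<open>w\<close>. The two
  \<open>u\<close>-orbits in \<open>K\<close> have lengths \<open>d + w\<close> and
  \<open>v - d = w\<close>, so it must be the one through \<open>r\<close>.\<close>

lemma return_narrow: obtains \<alpha> where "\<alpha> < w" "(t ^^ ret q) q = (u ^^ \<alpha>) r"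
proof -
  have L: "least_power u ((t ^^ ret q) q) = w" using least_power_u_ret[OF pq_in_K(2)] by (simp add: w_def)
  from ret(2)[OF pq_in_K(2)] show ?thesis
  proof (cases rule: K_cases)
    case (1 i)
    hence "d \<le> i" using L least_power_u_cases(1)[of i] d by (cases "i < d") auto
    moreover from this have "(t ^^ ret q) q = (u ^^ (i - d)) r" using 1 u_pow_r[of "i - d"] by simp
    ultimately show ?thesis using that[of "i - d"] 1 v_eq by simp
  next
    case (2 i)
    thus ?thesis using L least_power_u_cases(3)[of i] d by simp
  qed
qed

lemma return_wide: obtains \<beta> where "\<beta> < v" "(t ^^ ret p) p = (u ^^ \<beta>) p"
proof -
  have L: "least_power u ((t ^^ ret p) p) = v" using least_power_u_ret[OF pq_in_K(1)] by (simp add: v_def)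
  from ret(2)[OF pq_in_K(1)] show ?thesis
  proof (cases rule: K_cases)
    case (1 i)
    hence "i < d" using L least_power_u_cases(2)[of i] d wv_pos by (cases "i < d") auto
    thus ?thesis using that[of i] 1 u_pow_p by simp
  next
    case (2 i)
    thus ?thesis using that[of "d + i"] u_pow_p' v_eq by simp
  qed
qed

text \<open>A cell gets the label reached from the corner of its cylinder by \<open>x\<close> steps
  of \<open>s\<close> and then \<open>y\<close> steps of \<open>t\<close>. The cells so labelled are
  closed under both moves, hence exhaust the surface.\<close>

lemma exists_coord:
  assumes st: "(s, t) \<in> pairsA n"
  shows "\<exists>\<alpha> \<beta> f. two_cylinder n w v (ret q) (ret p) \<alpha> \<beta> \<and> two_cylinder.coord n w v (ret q) (ret p) \<alpha> \<beta> f s t"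
proof -
  obtain \<alpha> where \<alpha>: "\<alpha> < w" "(t ^^ ret q) q = (u ^^ \<alpha>) r" by (rule return_narrow)
  obtain \<beta> where \<beta>: "\<beta> < v" "(t ^^ ret p) p = (u ^^ \<beta>) p" by (rule return_wide)
  let ?h = "ret q" and ?k = "ret p"
  define base where "base = (\<lambda>b. if b then p else q)"
  have base_K: "base b \<in> K" for b using pq_in_K by (simp add: base_def)
  have width: "cyl_width w v b = least_power s (base b)" for b by (simp add: cyl_width_def base_def w_def v_def)
  have height: "cyl_width ?h ?k b = ret (base b)" for b by (simp add: cyl_width_def base_def)
  \<comment> \<open>The area is kept symbolic: that it equals \<open>n\<close> is known only once
    \<open>f\<close> is onto.\<close>
  interpret T: two_cylinder "w * ?h + v * ?k" w v ?h ?k \<alpha> \<beta>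
    by standard (use wv_pos v_eq d \<alpha> \<beta> ret(1)[OF pq_in_K(1)] ret(1)[OF pq_in_K(2)] in auto)
  define f where "f = restrict (\<lambda>(b, x, y). (t ^^ y) ((s ^^ x) (base b))) T.M"
  have f: "f (b, x, y) = (t ^^ y) ((s ^^ x) (base b))" if "(b, x, y) \<in> T.M" for b x y
    using that by (simp add: f_def)
  have f0: "f (b, x, 0) = (s ^^ x) (base b)" if "x < cyl_width w v b" for b x
    using f[of b x 0] that T.width_pos by (simp add: cells_def)
  have sf: "s (f m) = f (T.R m)" if m: "m \<in> T.M" for m
  proof -
    obtain b x y where m': "m = (b, x, y)" by (cases m) auto
    have y: "y < ret (base b)" using m m' by (simp add: cells_def height)
    have "s (f m) = s ((s ^^ x) ((t ^^ y) (base b)))"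
      using f[of b x y] m t_pow_s_pow[OF base_K y] m' by simp
    also have "\<dots> = (s ^^ Suc x) ((t ^^ y) (base b))" by simp
    also have "\<dots> = (t ^^ y) ((s ^^ Suc x) (base b))" using t_pow_s_pow[OF base_K y] by metis
    also have "(s ^^ Suc x) (base b) = (s ^^ ((x + 1) mod cyl_width w v b)) (base b)"
      unfolding width using funpow_mod_period[OF least_power_pos(2)[OF sp], of "x + 1" "base b"] by simp
    also have "(t ^^ y) \<dots> = f (T.R m)" using T.R_in[OF m] m' by (simp add: f)
    finally show ?thesis .
  qed
  have tf: "t (f m) = f (T.U m)" if m: "m \<in> T.M" for m
  proof -
    obtain b x y where m': "m = (b, x, y)" by (cases m) auto
    have y: "y < ret (base b)" using m m' by (simp add: cells_def height)
    have tm: "t (f m) = (t ^^ Suc y) ((s ^^ x) (base b))" using f m m' by simp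
    have Um: "T.U m \<in> T.M" using T.U_in[OF m] .
    show ?thesis
    proof (cases "y + 1 < cyl_width ?h ?k b")
      case True
      hence "T.U m = (b, x, y + 1)" by (simp add: m')
      thus ?thesis using tm Um by (simp add: f)
    next
      case False
      hence "Suc y = ret (base b)" using y by (simp add: height)
      hence top: "t (f m) = (u ^^ x) ((t ^^ ret (base b)) (base b))"
        using tm t_pow_ret[OF base_K] by simp
      show ?thesis
      proof (cases b)
        case True
        define z where "z = (x + \<beta>) mod v"
        have z: "z < v" using wv_pos by (simp add: z_def)
        have U: "T.U m = glue_wide w v z" using False True by (simp add: m' z_def)
        have "t (f m) = (u ^^ (x + \<beta>)) p" using top True \<beta>(2) by (simp add: base_def funpow_add)
        also have "\<dots> = (u ^^ z) p"
          unfolding z_def using funpow_mod_period[OF least_power_pos(2)[OF up], of "x + \<beta>" p]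
          by (simp add: least_power_u_p v_eq)
        also have "\<dots> = f (glue_wide w v z)"
        proof (cases "z < d")
          case True
          thus ?thesis using f0[of z True] z u_pow_p by (simp add: glue_wide_def v_eq base_def cyl_width_def)
        next
          case False
          thus ?thesis using f0[of "z - d" False] z u_pow_p'[of "z - d"] by (simp add: glue_wide_def v_eq base_def cyl_width_def)
        qed
        finally show ?thesis using U by simp
      next
        case b: False
        define z where "z = (x + \<alpha>) mod w"
        have z: "z < w" using wv_pos by (simp add: z_def)
        have U: "T.U m = (True, d + z, 0)" using False b by (simp add: m' z_def v_eq)
        have "t (f m) = (u ^^ (x + \<alpha>)) r" using top b \<alpha>(2) by (simp add: base_def funpow_add)
        also have "\<dots> = (u ^^ z) r"
          unfolding z_def using funpow_mod_period[OF least_power_pos(2)[OF up], of "x + \<alpha>" r]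
          by (simp add: least_power_u_r v_eq)
        also have "\<dots> = (s ^^ (d + z)) p" using z v_eq by (intro u_pow_r) simp
        also have "\<dots> = f (True, d + z, 0)" using f0[of "d + z" True] z by (simp add: base_def cyl_width_def v_eq)
        finally show ?thesis using U by simp
      qed
    qed
  qed
  \<comment> \<open>Cancelling the lower power of \<open>t\<close> puts a point of \<open>K\<close>
    equal to one reached after \<open>y' - y\<close> steps, less than the return time; so the rows
    agree, and then the columns.\<close>
  have f_le: "m = m'" if mm: "m \<in> T.M" "m' \<in> T.M" "f m = f m'" "snd (snd m) \<le> snd (snd m')" for m m'
  proof -
    obtain b x y where m: "m = (b, x, y)" by (cases m) auto
    obtain b' x' y' where m': "m' = (b', x', y')" by (cases m') auto
    have lt: "x < least_power s (base b)" "x' < least_power s (base b')" "y < ret (base b)" "y' < ret (base b')"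
      using mm by (simp_all add: m m' cells_def height width)
    have yy: "y \<le> y'" using mm by (simp add: m m')
    have "(t ^^ y) ((s ^^ x) (base b)) = (t ^^ (y + (y' - y))) ((s ^^ x') (base b'))"
      using mm f yy by (simp add: m m')
    also have "\<dots> = (t ^^ y) ((t ^^ (y' - y)) ((s ^^ x') (base b')))" by (simp only: funpow_add o_apply)
    finally have eq: "(s ^^ x) (base b) = (t ^^ (y' - y)) ((s ^^ x') (base b'))"
      using injD[OF permutes_inj[OF permutes_funpow[OF tp, of y]]] by blast
    have "(s ^^ x) (base b) \<in> K" using pow_base_in_K by (simp add: base_def)
    hence "\<not> 0 < y' - y" using t_pow_outside[OF base_K[of b'], of "y' - y" x'] lt eq by (metis less_imp_diff_less)
    hence y: "y = y'" using yy by simp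
    hence eq': "(s ^^ x) (base b) = (s ^^ x') (base b')" using eq by simp
    have b: "b = b'"
      using eq' p_pow_neq_q_pow[of x x'] p_pow_neq_q_pow[of x' x] by (cases b; cases b') (auto simp: base_def)
    have "x = x'" using eq' b lt funpow_inj_on_period[OF sp, of "base b"] by (auto simp: inj_on_def)
    thus ?thesis using b y by (simp add: m m')
  qed
  have inj: "inj_on f T.M"
    by (rule inj_onI) (metis f_le nat_le_linear)
  have "f ` T.M = {1..n}"
  proof (rule stable_subset_eq_carrier[OF st])
    show "f ` T.M \<subseteq> {1..n}"
    proof (rule image_subsetI)
      fix m assume m: "m \<in> T.M"
      obtain b x y where m': "m = (b, x, y)" by (cases m) auto
      have "base b \<in> {1..n}" using p_in q_in by (simp add: base_def)
      thus "f m \<in> {1..n}" unfolding m' f[OF m[unfolded m']] by (simp only: funpow_in_carrier[OF sp] funpow_in_carrier[OF tp])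
    qed
    show "s ` f ` T.M \<subseteq> f ` T.M" using sf T.R_in by auto
    show "t ` f ` T.M \<subseteq> f ` T.M" using tf T.U_in by auto
    show "f (True, 0, 0) \<in> f ` T.M" "f (False, 0, 0) \<in> f ` T.M" using T.corners_in by blast+
    show "f (True, 0, 0) \<noteq> f (False, 0, 0)" using inj T.corners_in by (auto simp: inj_on_def)
  qed
  hence bij: "bij_betw f T.M {1..n}" using inj by (simp add: bij_betw_def)
  hence area: "w * ?h + v * ?k = n" using bij_betw_same_card[OF bij] T.card_cells by simp
  have ext: "f \<in> extensional T.M" by (simp add: f_def)
  have tc: "two_cylinder n w v ?h ?k \<alpha> \<beta>" using T.two_cylinder_axioms area by simp
  moreover have "two_cylinder.coord n w v ?h ?k \<alpha> \<beta> f s t"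
    unfolding two_cylinder.coord_def[OF tc] modelled_def bijections_def using bij ext sp tp sf tf by blast
  ultimately show ?thesis by blast
qed

end

section \<open>One cylinder\<close>

text \<open>One cylinder of height 1: the corners are the positions 0, \<open>i\<close>, \<open>j\<close> on the orbit of \<open>s\<close>, and \<open>exch\<close> lists the
  positions in the order \<open>[0, i), [j, n), [i, j)\<close> in which the conjugate of \<open>s\<close> visits them.\<close>

locale one_cylinder =
  fixes n i j \<tau> :: nat
  assumes gaps: "0 < i" "i < j" "j < n" and twist: "\<tau> < n"
begin

definition exch :: "nat \<Rightarrow> nat" where
  "exch z = (if z < i then z else if z < i + (n - j) then z + (j - i) else z - (n - j))"

abbreviation U where "U x \<equiv> exch ((x + \<tau>) mod n)"

lemma exch_less: "z < n \<Longrightarrow> exch z < n"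
  using gaps by (auto simp: exch_def)

lemma exch_inj: "z < n \<Longrightarrow> z' < n \<Longrightarrow> exch z = exch z' \<Longrightarrow> z = z'"
  using gaps by (auto simp: exch_def split: if_splits)

lemma U_less: "U x < n"
  using gaps by (intro exch_less) simp

lemma bij_R: "bij_betw (\<lambda>x. (x + 1) mod n) {..<n} {..<n}"
proof -
  have "inj_on (\<lambda>x. (x + 1) mod n) {..<n}"
    by (rule inj_onI) (use mod_shift_inj in blast)
  moreover have "(\<lambda>x. (x + 1) mod n) ` {..<n} \<subseteq> {..<n}" using gaps by auto
  ultimately show ?thesis unfolding bij_betw_def by (intro conjI endo_inj_surj finite_lessThan)
qed

lemma bij_U: "bij_betw U {..<n} {..<n}"
proof -
  have "inj_on U {..<n}"
  proof (rule inj_onI)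
    fix x x' assume *: "x \<in> {..<n}" "x' \<in> {..<n}" "U x = U x'"
    have "(x + \<tau>) mod n = (x' + \<tau>) mod n" by (rule exch_inj[OF _ _ *(3)]) (use gaps in simp_all)
    thus "x = x'" using * mod_shift_inj by simp
  qed
  moreover have "U ` {..<n} \<subseteq> {..<n}" using U_less by auto
  ultimately show ?thesis unfolding bij_betw_def by (intro conjI endo_inj_surj finite_lessThan)
qed

text \<open>The commutator visits the corners as 0, \<open>j\<close>, \<open>i\<close>, against
  their order on the orbit. With the opposite order the conjugate of \<open>s\<close> would not have
  a single orbit.\<close>

definition C where
  "C x = (if x = 0 then j else if x = j then i else if x = i then 0 else x)"

lemma R_U: "(U x + 1) mod n = C (U ((x + 1) mod n))"
proof -
  define z where "z = (x + \<tau>) mod n"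
  have z: "z < n" using gaps by (simp add: z_def)
  have n0: "0 < n" using gaps by simp
  have "U ((x + 1) mod n) = exch (if Suc z = n then 0 else Suc z)"
    unfolding z_def using mod_shift_Suc[OF n0, of x \<tau>] by simp
  moreover have "(exch z + 1) mod n = C (exch (if Suc z = n then 0 else Suc z))"
  proof -
    \<comment> \<open>The thresholds \<open>i\<close>, \<open>i + (n - j)\<close> and
      \<open>n\<close> are the ends of the three intervals in the order of \<open>exch\<close>;
      corners are met only there.\<close>
    consider "z + 1 < i" | "z + 1 = i" | "i \<le> z" "z + 1 < i + (n - j)" | "z + 1 = i + (n - j)"
      | "i + (n - j) \<le> z" "z + 1 < n" | "z + 1 = n"
      using z by linarith
    thus ?thesis
    proof cases
      case 1 thus ?thesis using gaps by (simp add: exch_def C_def)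
    next
      case 2 thus ?thesis using gaps by (auto simp: exch_def C_def)
    next
      case 3
      hence "exch z = z + (j - i)" "exch (Suc z) = Suc z + (j - i)" "Suc z + (j - i) < n" "j < Suc z + (j - i)"
        using gaps by (auto simp: exch_def)
      moreover have "Suc z \<noteq> n" using 3 gaps by linarith
      ultimately show ?thesis using gaps by (simp add: C_def)
    next
      case 4
      hence "exch z = n - 1" "exch (Suc z) = i" "Suc z < n" using gaps by (auto simp: exch_def)
      thus ?thesis using gaps by (simp add: C_def)
    next
      case 5
      hence "exch z = z - (n - j)" "exch (Suc z) = Suc z - (n - j)" "Suc z - (n - j) < j" "i < Suc z - (n - j)"
        "Suc z - (n - j) = Suc (z - (n - j))"
        using gaps by (auto simp: exch_def)
      thus ?thesis using 5 gaps by (simp add: C_def)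
    next
      case 6
      hence "exch z = j - 1" "exch 0 = 0" using gaps by (auto simp: exch_def)
      thus ?thesis using 6 gaps by (simp add: C_def)
    qed
  qed
  ultimately show ?thesis by (simp add: z_def)
qed

definition coord where
  "coord f s t \<longleftrightarrow> modelled n {..<n} (\<lambda>x. (x + 1) mod n) (\<lambda>x. U x) f s t"

lemma coord_transport:
  "f \<in> bijections {..<n} {1..n} \<Longrightarrow> coord f (transport f {..<n} (\<lambda>x. (x + 1) mod n)) (transport f {..<n} (\<lambda>x. U x))"
  unfolding coord_def using bij_R bij_U by (intro modelled_transport)

lemma coord_transport_unique:
  assumes "coord f s t"
  shows "s = transport f {..<n} (\<lambda>x. (x + 1) mod n)" "t = transport f {..<n} (\<lambda>x. U x)"
  using modelled_transport_unique[OF assms[unfolded coord_def]] .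

context
  fixes f s t
  assumes co: "coord f s t"
begin

lemma f_eq_iff: "x < n \<Longrightarrow> y < n \<Longrightarrow> f x = f y \<longleftrightarrow> x = y"
  and f_in: "x < n \<Longrightarrow> f x \<in> {1..n}"
  and s_f: "x < n \<Longrightarrow> s (f x) = f ((x + 1) mod n)"
  and t_f: "x < n \<Longrightarrow> t (f x) = f (U x)"
  and s_perm: "s permutes {1..n}" and t_perm: "t permutes {1..n}"
  using modelledD[OF co[unfolded coord_def]] by (simp_all del: atLeastAtMost_iff)

lemma f_surj:
  assumes "z \<in> {1..n}"
  obtains x where "x < n" "z = f x"
  using modelled_surj[OF co[unfolded coord_def] assms] by auto

lemma commutator_is_coord: "commutator_is n s t (f 0) (f j) (f i)"
  by (rule modelled_commutator[OF co[unfolded coord_def]])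
     (use gaps U_less R_U in \<open>simp_all add: C_def Let_def\<close>)

lemma s_pow: "x < n \<Longrightarrow> (s ^^ m) (f x) = f ((x + m) mod n)"
proof (induction m)
  case (Suc m)
  have "(x + m) mod n < n" using gaps by simp
  thus ?case using Suc by (simp add: s_f mod_simps)
qed simp

lemma s_pow_0: "(s ^^ m) (f 0) = f (m mod n)"
  using s_pow[of 0 m] gaps by simp

lemma orel_total: "orel n s = {1..n} \<times> {1..n}"
proof (intro equalityI subsetI)
  fix z assume "z \<in> {1..n} \<times> {1..n}"
  then obtain a b where ab: "z = (a, b)" "a \<in> {1..n}" "b \<in> {1..n}" by blast
  obtain x where x: "x < n" "a = f x" using f_surj[OF ab(2)] by metis
  obtain y where y: "y < n" "b = f y" using f_surj[OF ab(3)] by metis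
  have "(s ^^ (n - x + y)) a = f ((x + (n - x + y)) mod n)" using s_pow[OF x(1)] x(2) by simp
  also have "x + (n - x + y) = n + y" using x by simp
  finally have "b = (s ^^ (n - x + y)) a" using y by simp
  thus "z \<in> orel n s" using ab unfolding orel_def by blast
qed (use orelD(1)[OF s_perm] in blast)

text \<open>Modulo the gcd of \<open>i\<close>, \<open>j\<close>, \<open>n\<close>, exchanging the
  intervals does not change a position, so \<open>s\<close> adds 1 and \<open>t\<close> adds \<tau>.
  The corners 0 and \<open>j\<close> get the same value, hence so do 0 and 1.\<close>

lemma pairsA_coord_gcd:
  assumes st: "(s, t) \<in> pairsA n"
  shows "gcd (gcd i j) n = 1"
proof -
  define m where "m = gcd (gcd i j) n"
  have m: "m dvd i" "m dvd j" "m dvd n" by (auto simp: m_def intro: dvd_trans)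
  have md: "m dvd j - i" "m dvd n - j" using m by (auto intro: dvd_diff_nat)
  have mod_n: "[x mod n = x] (mod m)" for x using m(3) by (simp add: cong_def mod_mod_cancel)
  have exch: "[exch z = z] (mod m)" if "z < n" for z
  proof -
    have "exch z = z \<or> exch z = z + (j - i) \<or> z = exch z + (n - j)"
      unfolding exch_def using gaps by auto
    moreover have "[y + e = y] (mod m)" if "m dvd e" for y e
      using cong_add[OF cong_refl[of y m], of e 0] that by (simp add: cong_0_iff)
    ultimately show ?thesis using md cong_sym cong_refl by metis
  qed
  have valU: "[U x = x + \<tau>] (mod m)" for x
  proof -
    have "[U x = (x + \<tau>) mod n] (mod m)" by (rule exch) (use gaps in simp)
    thus ?thesis using mod_n[of "x + \<tau>"] by (rule cong_trans)
  qed
  have "[int 1 = int 0] (mod int m)"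
  proof (rule pairsA_modelled_cong[OF st co[unfolded coord_def], where val = int and A = 1 and B = "int \<tau>" and a = 0 and b = j])
    fix x
    have "[(x + 1) mod n = x + 1] (mod m)" by (rule mod_n)
    thus "[int ((x + 1) mod n) = int x + 1] (mod int m)" unfolding cong_int_iff[symmetric] of_nat_add of_nat_1 .
    show "[int (U x) = int x + int \<tau>] (mod int m)" using valU[of x] unfolding cong_int_iff[symmetric] by simp
    show "[int 0 = int j] (mod int m)" using m(2) by (simp add: cong_sym_eq[of 0] cong_0_iff)
  qed (use gaps U_less in simp_all)
  hence "m dvd 1" by (simp add: cong_int_iff cong_0_iff)
  thus ?thesis by (simp add: m_def)
qed

text \<open>On the single orbit of \<open>s\<close>, an invariant relation is described by a
  subgroup of differences of positions. It contains \<open>n\<close> and, as the corners are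
  identified, \<open>i\<close> and \<open>j\<close>.\<close>

lemma coord_pairsA:
  assumes "gcd (gcd i j) n = 1"
  shows "(s, t) \<in> pairsA n"
proof (rule pairsA_I[OF commutator_is_coord])
  fix E assume E: "stable_equiv n s t E" and E0j: "(f 0, f j) \<in> E" and Eji: "(f j, f i) \<in> E"
  note eD = stable_equivD[OF E]
  define \<kappa> where "\<kappa> = (\<lambda>x. E `` {(s ^^ x) (f 0)})"
  have pt_in: "(s ^^ x) (f 0) \<in> {1..n}" for x unfolding s_pow_0 using f_in gaps by simp
  have \<kappa>: "\<kappa> x = \<kappa> y \<longleftrightarrow> ((s ^^ x) (f 0), (s ^^ y) (f 0)) \<in> E" for x y
    using E pt_in unfolding \<kappa>_def stable_equiv_def by (intro eq_equiv_class_iff) auto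
  have shift1: "\<kappa> (Suc x) = \<kappa> (Suc y) \<longleftrightarrow> \<kappa> x = \<kappa> y" for x y
  proof -
    have "(s a, s b) \<in> E \<longleftrightarrow> (a, b) \<in> E" for a b
    proof
      assume "(s a, s b) \<in> E"
      thus "(a, b) \<in> E"
        using inv_in_finite_invariant_rel[OF s_perm eD(1,5)] permutes_inverses(2)[OF s_perm] by metis
    qed (rule eD(5))
    thus ?thesis unfolding \<kappa> funpow.simps o_apply .
  qed
  have shift: "\<kappa> (x + a) = \<kappa> (y + a) \<longleftrightarrow> \<kappa> x = \<kappa> y" for x y a
    by (induction a) (simp_all add: shift1)
  define L where "L = (\<lambda>a::int. \<exists>x y. a = int x - int y \<and> \<kappa> x = \<kappa> y)"
  have LI: "L (int x - int y)" if "\<kappa> x = \<kappa> y" for x y using that unfolding L_def by blast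
  have add: "L (a + b)" if ab: "L a" "L b" for a b
  proof -
    obtain x y where 1: "a = int x - int y" "\<kappa> x = \<kappa> y" using ab(1) unfolding L_def by blast
    obtain x' y' where 2: "b = int x' - int y'" "\<kappa> x' = \<kappa> y'" using ab(2) unfolding L_def by blast
    have "\<kappa> (x + x') = \<kappa> (y + x')" using 1(2) by (simp only: shift)
    moreover have "\<kappa> (x' + y) = \<kappa> (y' + y)" using 2(2) by (simp only: shift)
    ultimately have "\<kappa> (x + x') = \<kappa> (y' + y)" by (simp only: add.commute)
    from LI[OF this] have "L (int (x + x') - int (y' + y))" .
    moreover have "a + b = int (x + x') - int (y' + y)" using 1(1) 2(1) by simp
    ultimately show ?thesis by (simp only:)
  qed
  have neg: "L (- a)" if "L a" for a using that unfolding L_def by (metis minus_diff_eq)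
  have pt: "(s ^^ x) (f 0) = f x" if "x < n" for x using s_pow_0[of x] that by simp
  have "\<kappa> n = \<kappa> 0" by (simp add: \<kappa>_def s_pow_0)
  from LI[OF this] have Ln: "L (int n)" by simp
  have "\<kappa> j = \<kappa> 0" unfolding \<kappa> using eD(3)[OF E0j] gaps pt by simp
  from LI[OF this] have Lj: "L (int j)" by simp
  have "\<kappa> i = \<kappa> 0" unfolding \<kappa> using eD(3)[OF eD(4)[OF E0j Eji]] gaps pt by simp
  from LI[OF this] have Li: "L (int i)" by simp
  have "L (gcd (int i) (int j))" by (rule gcd_in_subgroup[of L, OF _ _ Li Lj]) (fact add, fact neg)
  hence "L (gcd (gcd (int i) (int j)) (int n))" by (rule gcd_in_subgroup[of L, OF _ _ _ Ln, rotated 2]) (fact add, fact neg)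
  hence "L 1" using assms by (simp only: gcd_int_int_eq of_nat_1)
  then obtain x y where xy: "1 = int x - int y" "\<kappa> x = \<kappa> y" unfolding L_def by blast
  hence "x = 1 + y" by linarith
  hence "\<kappa> (1 + y) = \<kappa> (0 + y)" using xy(2) by simp
  hence one: "\<kappa> 1 = \<kappa> 0" by (simp only: shift)
  have all: "\<kappa> x = \<kappa> 0" for x
  proof (induction x)
    case (Suc x)
    thus ?case using shift1[of x 0] one by simp
  qed simp
  have "(f x, f y) \<in> E" if "x < n" "y < n" for x y
    using \<kappa>[of x y] all[of x] all[of y] pt that by simp
  hence "{1..n} \<times> {1..n} \<subseteq> E" using f_surj by (metis SigmaE subsetI)
  thus "E = {1..n} \<times> {1..n}" using eD(1) by blast
qed

end

end

text \<open>The label of position 0 has to be prescribed, since each of the three corners gives a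
  presentation of the same pair.\<close>

lemma one_cylinder_coord_unique:
  assumes oc: "one_cylinder n i j \<tau>" "one_cylinder n i' j' \<tau>'"
    and co: "one_cylinder.coord n i j \<tau> f s t" "one_cylinder.coord n i' j' \<tau>' f' s t"
    and base: "f 0 = f' 0"
  shows "(i, j, \<tau>) = (i', j', \<tau>')" "f = f'"
proof -
  interpret A: one_cylinder n i j \<tau> by fact
  interpret B: one_cylinder n i' j' \<tau>' by fact
  have ff: "f x = f' x" if "x < n" for x
    using A.s_pow_0[OF co(1), of x] B.s_pow_0[OF co(2), of x] that base by simp
  have "f \<in> extensional {..<n}" "f' \<in> extensional {..<n}"
    using modelledD(2)[OF co(1)[unfolded A.coord_def]] modelledD(2)[OF co(2)[unfolded B.coord_def]]
    unfolding bijections_def by blast+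
  thus "f = f'" by (rule extensionalityI) (use ff in simp)
  note cA = A.commutator_is_coord[OF co(1)] and cB = B.commutator_is_coord[OF co(2)]
  have cyc: "cycle_of_list [f 0, f j, f i] = cycle_of_list [f' 0, f' j', f' i']"
    using cA cB by (rule commutator_is_cycle_eq)
  note cycA = cycle_of_list_3[OF commutator_isD(3)[OF cA]]
  note cycB = cycle_of_list_3[OF commutator_isD(3)[OF cB], folded cyc]
  have "f j = f' j'" using cycA(1) cycB(1) base by simp
  moreover from this have "f i = f' i'" using cycA(2) cycB(2) by simp
  ultimately have "f j = f j'" "f i = f i'" using ff[of j'] ff[of i'] B.gaps by simp_all
  hence "j = j'" "i = i'"
    using A.f_eq_iff[OF co(1), of j j'] A.f_eq_iff[OF co(1), of i i'] A.gaps B.gaps by simp_all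
  have "f (A.U 0) = f (B.U 0)"
    using A.t_f[OF co(1), of 0] B.t_f[OF co(2), of 0] A.gaps base ff[OF B.U_less[of 0]] by simp
  hence "A.U 0 = B.U 0" using A.f_eq_iff[OF co(1) A.U_less[of 0] B.U_less[of 0]] by blast
  hence "A.exch \<tau> = A.exch \<tau>'"
    using A.twist B.twist \<open>i = i'\<close> \<open>j = j'\<close> by (simp add: A.exch_def B.exch_def)
  hence "\<tau> = \<tau>'" using A.exch_inj A.twist B.twist by blast
  thus "(i, j, \<tau>) = (i', j', \<tau>')" using \<open>i = i'\<close> \<open>j = j'\<close> by simp
qed

text \<open>The coordinate is the position on the orbit of \<open>s\<close>, counted from
  \<open>p\<close>. The conjugate \<open>u\<close> has a single orbit as well, and
  \<open>exch\<close> is the order in which it meets these positions.\<close>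

lemma one_cylinder_exists_coord:
  assumes c: "commutator_is n s t p q r" and total: "orel n s = {1..n} \<times> {1..n}"
  shows "\<exists>i j \<tau> f. one_cylinder n i j \<tau> \<and> one_cylinder.coord n i j \<tau> f s t \<and> f 0 = p"
proof -
  note cD = commutator_isD[OF c]
  note sp = cD(1) and tp = cD(2) and dist = cD(3) and p_in = cD(4)
  define u where "u = twisted s p q r"
  have up: "u permutes {1..n}" unfolding u_def using c by (rule twisted_permutes)
  have u_t: "u (t x) = t (s x)" for x unfolding u_def using c by (rule twisted_conj)
  have "(p, q) \<in> orel n s" "(q, r) \<in> orel n s" using total cD by auto
  hence total_u: "orel n u = {1..n} \<times> {1..n}"
    unfolding u_def using stable_equiv_orel_same_orbit(1)[OF c] total by simp
  have orbit: "\<exists>x<least_power s p. z = (s ^^ x) p" if "z \<in> {1..n}" for z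
    using orel_period[OF sp, of p z] total that p_in by auto
  have inj_p: "inj_on (\<lambda>x. (s ^^ x) p) {..<least_power s p}" using sp by (rule funpow_inj_on_period)
  have image: "(\<lambda>x. (s ^^ x) p) ` {..<least_power s p} = {1..n}"
  proof (intro equalityI subsetI)
    fix z assume "z \<in> (\<lambda>x. (s ^^ x) p) ` {..<least_power s p}"
    thus "z \<in> {1..n}" using funpow_in_carrier[OF sp] p_in by auto
  qed (use orbit in auto)
  have n: "least_power s p = n" using card_image[OF inj_p] image by simp
  have pow_eq: "(s ^^ x) p = (s ^^ y) p \<longleftrightarrow> x = y" if "x < n" "y < n" for x y
    using inj_p that n by (auto simp: inj_on_def)
  have s_n: "(s ^^ n) p = p" using least_power_pos(2)[OF sp, of p] n by simp
  obtain j where j: "j < n" "q = (s ^^ j) p" using orbit[OF cD(5)] n by auto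
  obtain i where i: "i < n" "r = (s ^^ i) p" using orbit[OF cD(6)] n by auto
  have neq: "i \<noteq> 0" "j \<noteq> 0" "i \<noteq> j" using dist i j by (auto intro: Nat.gr0I)
  have corner: "(s ^^ x) p \<in> {p, q, r} \<longleftrightarrow> x = 0 \<or> x = j \<or> x = i" if "x < n" for x
    using pow_eq[OF that, of 0] pow_eq[OF that j(1)] pow_eq[OF that i(1)] that i j by auto
  have walk: "(u ^^ m) ((s ^^ a) p) = (s ^^ (a + m)) p"
    if "a + m < n" "\<And>x. a < x \<Longrightarrow> x \<le> a + m \<Longrightarrow> x \<noteq> i \<and> x \<noteq> j" for a m
  proof -
    have eq: "(s ^^ l) ((s ^^ a) p) = (s ^^ (a + l)) p" for l by (metis add.commute funpow_add o_apply)
    have "(u ^^ m) ((s ^^ a) p) = (s ^^ m) ((s ^^ a) p)"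
      unfolding u_def
    proof (rule funpow_twisted[OF dist])
      fix l assume l: "0 < l" "l \<le> m"
      have "\<not> (a + l = 0 \<or> a + l = j \<or> a + l = i)" "a + l < n"
        using l that(1) that(2)[of "a + l"] by auto
      hence "(s ^^ (a + l)) p \<notin> {p, q, r}" using corner by blast
      thus "(s ^^ l) ((s ^^ a) p) \<notin> {p, q, r}" unfolding eq .
    qed
    thus ?thesis by (simp only: eq)
  qed
  have last: "u ((s ^^ (x - 1)) p) = twisted s p q r ((s ^^ (x - 1)) p)" "s ((s ^^ (x - 1)) p) = (s ^^ x) p"
    if "0 < x" for x
    using that by (cases x; simp add: u_def)+
  have ij: "i < j"
  proof (rule ccontr)
    assume "\<not> i < j"
    hence ji: "j < i" using neq by simp
    have w: "(u ^^ m) p = (s ^^ m) p" if "m < j" for m using walk[of 0 m] that ji i by simp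
    have "(u ^^ j) p = u ((u ^^ (j - 1)) p)" using neq by (cases j) auto
    also have "\<dots> = u ((s ^^ (j - 1)) p)" using w[of "j - 1"] neq by simp
    also have "\<dots> = p" using last(2)[of j] neq j(2) unfolding u_def by (intro twisted_simps(2)[OF dist]) simp
    finally have "least_power u p \<le> j" using neq by (intro least_power_le) simp_all
    moreover have "(p, r) \<in> orel n u" using total_u cD by simp
    then obtain m where "m < least_power u p" "r = (u ^^ m) p" using orel_period[OF up] by blast
    ultimately have "m < j" "(s ^^ i) p = (s ^^ m) p" using w[of m] i(2) by simp_all
    thus False using pow_eq[of i m] i ji by simp
  qed
  have plus: "(u ^^ (a + b)) p = (u ^^ b) ((u ^^ a) p)" for a b by (metis add.commute funpow_add o_apply)
  have u1: "(u ^^ m) p = (s ^^ m) p" if "m < i" for m using walk[of 0 m] that ij j by simp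
  have u2: "(u ^^ i) p = q"
  proof -
    have "(u ^^ i) p = u ((u ^^ (i - 1)) p)" using neq by (cases i) auto
    also have "\<dots> = u ((s ^^ (i - 1)) p)" using u1[of "i - 1"] neq by simp
    also have "\<dots> = q" using last(2)[of i] neq i(2) unfolding u_def by (intro twisted_simps(3)[OF dist]) simp
    finally show ?thesis .
  qed
  have u3: "(u ^^ (i + m)) p = (s ^^ (j + m)) p" if "m < n - j" for m
    using walk[of j m] that ij j by (simp add: plus u2)
  have u4: "(u ^^ (i + (n - j))) p = r"
  proof -
    obtain m where m: "n - j = Suc m" using j by (cases "n - j") auto
    hence nm: "n - 1 = j + m" by simp
    have "(u ^^ (i + (n - j))) p = u ((u ^^ (i + m)) p)" by (simp add: m)
    also have "\<dots> = u ((s ^^ (n - 1)) p)" using u3[of m] m nm by simp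
    also have "\<dots> = r" using last(2)[of n] j s_n unfolding u_def by (intro twisted_simps(1)[OF dist]) simp
    finally show ?thesis .
  qed
  have u5: "(u ^^ (i + (n - j) + m)) p = (s ^^ (i + m)) p" if "m < j - i" for m
  proof -
    have "(u ^^ (i + (n - j) + m)) p = (u ^^ m) r" unfolding plus[of "i + (n - j)" m] u4 ..
    also have "\<dots> = (s ^^ (i + m)) p" unfolding i(2) by (rule walk) (use that j in auto)
    finally show ?thesis .
  qed
  have u6: "(u ^^ n) p = p"
  proof -
    obtain m where m: "j - i = Suc m" using ij by (cases "j - i") auto
    hence jm: "j - 1 = i + m" and nm: "n = Suc (i + (n - j) + m)" using ij j by simp_all
    have "(u ^^ n) p = u ((u ^^ (i + (n - j) + m)) p)" by (subst nm) simp
    also have "\<dots> = u ((s ^^ (j - 1)) p)" using u5[of m] m jm by simp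
    also have "\<dots> = p" using last(2)[of j] neq j(2) unfolding u_def by (intro twisted_simps(2)[OF dist]) simp
    finally show ?thesis .
  qed
  \<comment> \<open>The twist is the place of \<open>t p\<close> on the \<open>u\<close>-orbit of
    \<open>p\<close>. As \<open>u\<close> after \<open>t\<close> is \<open>t\<close> after
    \<open>s\<close>, the point \<open>x\<close> steps of \<open>s\<close> from \<open>p\<close>
    goes to the point x + \<tau> steps of \<open>u\<close> from \<open>p\<close>.\<close>
  have "(p, t p) \<in> orel n u" using total_u p_in permutes_in_image[OF tp] by auto
  then obtain \<tau> where \<tau>: "\<tau> < least_power u p" "t p = (u ^^ \<tau>) p" using orel_period[OF up] by blast
  have "\<tau> < n" using \<tau>(1) least_power_le[OF u6] i by simp
  interpret T: one_cylinder n i j \<tau>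
    by standard (use neq ij j \<open>\<tau> < n\<close> in auto)
  have u_pow: "(u ^^ z) p = (s ^^ T.exch z) p" if z: "z < n" for z
  proof -
    consider "z < i" | "i \<le> z" "z < i + (n - j)" | "i + (n - j) \<le> z" by linarith
    thus ?thesis
    proof cases
      case 1 thus ?thesis using u1 by (simp add: T.exch_def)
    next
      case 2
      hence "T.exch z = j + (z - i)" using ij unfolding T.exch_def by auto
      moreover have "z - i < n - j" "z = i + (z - i)" using 2 by auto
      ultimately show ?thesis using u3[of "z - i"] by simp
    next
      case 3
      hence "T.exch z = i + (z - (i + (n - j)))" using ij unfolding T.exch_def by auto
      moreover have "z - (i + (n - j)) < j - i" "z = i + (n - j) + (z - (i + (n - j)))" using 3 z j ij by auto
      ultimately show ?thesis using u5[of "z - (i + (n - j))"] by simp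
    qed
  qed
  define f where "f = restrict (\<lambda>x. (s ^^ x) p) {..<n}"
  have f: "f x = (s ^^ x) p" if "x < n" for x using that by (simp add: f_def)
  have "bij_betw (\<lambda>x. (s ^^ x) p) {..<n} {1..n}" using inj_p image n by (simp add: bij_betw_def)
  hence "bij_betw f {..<n} {1..n}"
    using bij_betw_cong[of "{..<n}" f "\<lambda>x. (s ^^ x) p" "{1..n}"] f by simp
  hence bij: "f \<in> bijections {..<n} {1..n}" by (simp add: bijections_def f_def)
  have n0: "0 < n" using i by simp
  have "s (f x) = f ((x + 1) mod n)" if "x < n" for x
  proof -
    have "s (f x) = (s ^^ (x + 1)) p" using f[OF that] by simp
    also have "\<dots> = (s ^^ ((x + 1) mod n)) p" using funpow_mod_period[OF s_n, of "x + 1"] by simp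
    finally show ?thesis using f[of "(x + 1) mod n"] n0 by simp
  qed
  moreover have "t (f x) = f (T.U x)" if "x < n" for x
  proof -
    have "t (f x) = (u ^^ x) (t p)" using f[OF that] funpow_intertwine[of u t s, OF u_t] by simp
    also have "\<dots> = (u ^^ (x + \<tau>)) p" by (simp add: \<tau>(2) funpow_add)
    also have "\<dots> = (u ^^ ((x + \<tau>) mod n)) p" using funpow_mod_period[OF u6, of "x + \<tau>"] by simp
    also have "\<dots> = (s ^^ T.U x) p" using n0 by (intro u_pow) simp
    finally show ?thesis using f[OF T.U_less] by simp
  qed
  ultimately have "T.coord f s t" unfolding T.coord_def modelled_def using bij sp tp by blast
  moreover have "f 0 = p" using f[of 0] n0 by simp
  ultimately show ?thesis using T.one_cylinder_axioms by blast
qed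

section \<open>Counting pairs\<close>

text \<open>If all corners lie on one \<open>s\<close>-orbit, the orbit relation is stable, and
  generation makes it total. Hence a single cylinder always has height 1.\<close>

definition one_cylinder_pairs :: "nat \<Rightarrow> ((nat \<Rightarrow> nat) \<times> (nat \<Rightarrow> nat)) set" where
  "one_cylinder_pairs n = {(s, t). (s, t) \<in> pairsA n \<and> orel n s = {1..n} \<times> {1..n}}"

lemma finite_pairsA: "finite (pairsA n)"
proof (rule finite_subset)
  show "pairsA n \<subseteq> {s. s permutes {1..n}} \<times> {t. t permutes {1..n}}"
    by (auto simp: pairsA_def sym_group_carrier)
  show "finite ({s. s permutes {1..n}} \<times> {t. t permutes {1..n}})"
    by (intro finite_cartesian_product finite_permutations finite_atLeastAtMost)
qed

lemma card_commutator_points: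
  assumes c: "commutator_is n s t p q r"
  shows "{p. \<exists>q r. commutator_is n s t p q r} = {p, q, r}" "card {p. \<exists>q r. commutator_is n s t p q r} = 3"
proof -
  note cD = commutator_isD[OF c]
  show *: "{p. \<exists>q r. commutator_is n s t p q r} = {p, q, r}"
  proof (intro equalityI subsetI)
    fix a assume "a \<in> {p. \<exists>q r. commutator_is n s t p q r}"
    then obtain b e where c': "commutator_is n s t a b e" by blast
    have cyc: "cycle_of_list [p, q, r] a = b"
      unfolding commutator_is_cycle_eq[OF c c'] using cycle_of_list_3(1)[OF commutator_isD(3)[OF c']] .
    show "a \<in> {p, q, r}"
    proof (rule ccontr)
      assume "a \<notin> {p, q, r}"
      hence "cycle_of_list [p, q, r] a = a" using cycle_of_list_3(4)[OF cD(3)] by simp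
      thus False using cyc commutator_isD(3)[OF c'] by simp
    qed
  next
    fix a assume "a \<in> {p, q, r}"
    thus "a \<in> {p. \<exists>q r. commutator_is n s t p q r}"
      using c commutator_is_rotate[OF c] commutator_is_rotate[OF commutator_is_rotate[OF c]] by blast
  qed
  show "card {p. \<exists>q r. commutator_is n s t p q r} = 3" unfolding * using cD(3) by simp
qed

text \<open>Both sides count pairs with a marked corner: three marks for each pair, against gaps, a
  twist and a labelling whose position 0 is the mark.\<close>

lemma card_one_cylinder_pairs:
  assumes "n > 0"
  shows "3 * card (one_cylinder_pairs n) = card (gap_pairs n) * n * fact n"
proof -
  define pts where "pts = (\<lambda>(s, t). {p. \<exists>q r. commutator_is n s t p q r})"
  define S where "S = ((gap_pairs n \<times> {..<n}) \<times> bijections {..<n} {1..n})"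
  define F where "F = (\<lambda>(((i, j), \<tau>), f :: nat \<Rightarrow> nat).
    ((transport f {..<n} (\<lambda>x. (x + 1) mod n), transport f {..<n} (\<lambda>x. one_cylinder.exch n i j ((x + \<tau>) mod n))), f 0))"
  have oc: "one_cylinder n i j \<tau> \<and> gcd (gcd i j) n = 1 \<longleftrightarrow> ((i, j), \<tau>) \<in> gap_pairs n \<times> {..<n}" for i j \<tau>
    by (auto simp: one_cylinder_def gap_pairs_def)
  have co: "one_cylinder.coord n i j \<tau> f (fst (fst (F (((i, j), \<tau>), f)))) (snd (fst (F (((i, j), \<tau>), f))))"
    if "(((i, j), \<tau>), f) \<in> S" for i j \<tau> f
  proof -
    interpret one_cylinder n i j \<tau> using that oc by (auto simp: S_def)
    have "f \<in> bijections {..<n} {1..n}" using that by (auto simp: S_def)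
    from coord_transport[OF this] show ?thesis by (simp add: F_def)
  qed
  have "bij_betw F S (SIGMA st:one_cylinder_pairs n. pts st)"
    unfolding bij_betw_def
  proof (intro conjI inj_onI equalityI image_subsetI subsetI)
    fix a b assume ab: "a \<in> S" "b \<in> S" "F a = F b"
    obtain i j \<tau> f where a: "a = (((i, j), \<tau>), f)" by (metis prod.exhaust)
    obtain i' j' \<tau>' f' where b: "b = (((i', j'), \<tau>'), f')" by (metis prod.exhaust)
    have oc': "one_cylinder n i j \<tau>" "one_cylinder n i' j' \<tau>'" using ab oc by (auto simp: a b S_def)
    have "f 0 = f' 0" using ab(3) by (simp add: a b F_def)
    moreover note co[OF ab(1)[unfolded a]]
    moreover have "one_cylinder.coord n i' j' \<tau>' f' (fst (fst (F a))) (snd (fst (F a)))"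
      using co[OF ab(2)[unfolded b]] ab(3) b by simp
    ultimately show "a = b" using one_cylinder_coord_unique[OF oc', of f] by (simp add: a b)
  next
    fix a assume aS: "a \<in> S"
    obtain i j \<tau> f where a: "a = (((i, j), \<tau>), f)" by (metis prod.exhaust)
    obtain s t where F: "F a = ((s, t), f 0)" by (simp add: a F_def)
    have "one_cylinder n i j \<tau> \<and> gcd (gcd i j) n = 1" using aS unfolding oc by (simp add: a S_def)
    hence "one_cylinder n i j \<tau>" and g: "gcd (gcd i j) n = 1" by blast+
    then interpret one_cylinder n i j \<tau> by blast
    have c: "coord f s t" using co[OF aS[unfolded a]] F a by simp
    have "(s, t) \<in> one_cylinder_pairs n"
      using coord_pairsA[OF c g] orel_total[OF c] by (simp add: one_cylinder_pairs_def)
    moreover have "f 0 \<in> pts (s, t)" using commutator_is_coord[OF c] by (auto simp: pts_def)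
    ultimately show "F a \<in> (SIGMA st:one_cylinder_pairs n. pts st)" by (simp add: F)
  next
    fix z assume "z \<in> (SIGMA st:one_cylinder_pairs n. pts st)"
    then obtain s t p q r where z: "z = ((s, t), p)" and st: "(s, t) \<in> pairsA n" "orel n s = {1..n} \<times> {1..n}"
      and c: "commutator_is n s t p q r" by (auto simp: one_cylinder_pairs_def pts_def)
    obtain i j \<tau> f where oc': "one_cylinder n i j \<tau>" and co': "one_cylinder.coord n i j \<tau> f s t" and f0: "f 0 = p"
      using one_cylinder_exists_coord[OF c st(2)] by blast
    interpret one_cylinder n i j \<tau> by fact
    have "gcd (gcd i j) n = 1" using pairsA_coord_gcd[OF co' st(1)] .
    from iffD1[OF oc conjI[OF oc' this]] have "((i, j), \<tau>) \<in> gap_pairs n \<times> {..<n}" .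
    moreover have "f \<in> bijections {..<n} {1..n}" using modelledD(2)[OF co'[unfolded coord_def]] .
    ultimately have "(((i, j), \<tau>), f) \<in> S" by (simp add: S_def)
    moreover have "F (((i, j), \<tau>), f) = z"
      using coord_transport_unique[OF co'] f0 by (simp add: F_def z)
    ultimately show "z \<in> F ` S" by (metis imageI)
  qed
  hence "card S = card (SIGMA st:one_cylinder_pairs n. pts st)" by (rule bij_betw_same_card)
  also have "\<dots> = (\<Sum>st\<in>one_cylinder_pairs n. card (pts st))"
  proof (rule card_SigmaI)
    show "finite (one_cylinder_pairs n)"
      by (rule finite_subset[OF _ finite_pairsA[of n]]) (auto simp: one_cylinder_pairs_def)
    show "\<forall>st\<in>one_cylinder_pairs n. finite (pts st)"
      using card_commutator_points(1) by (auto simp: one_cylinder_pairs_def pairsA_iff pts_def)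
  qed
  also have "\<dots> = (\<Sum>st\<in>one_cylinder_pairs n. 3)"
    by (rule sum.cong) (use card_commutator_points(2) in \<open>auto simp: one_cylinder_pairs_def pairsA_iff pts_def\<close>)
  finally have "card S = 3 * card (one_cylinder_pairs n)" by simp
  thus ?thesis by (simp add: S_def card_cartesian_product card_bijections)
qed

definition two_cylinder_params :: "nat \<Rightarrow> (nat \<times> nat \<times> nat \<times> nat \<times> nat \<times> nat) set" where
  "two_cylinder_params n = {(w, v, h, k, \<alpha>, \<beta>). (w, v, h, k) \<in> quads n \<and> w < v \<and> coprime h k \<and> (\<alpha>, \<beta>) \<in> twist_pairs w v h k}"

lemma two_cylinder_params_iff:
  "(w, v, h, k, \<alpha>, \<beta>) \<in> two_cylinder_params n \<longleftrightarrow>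
     two_cylinder n w v h k \<alpha> \<beta> \<and> coprime h k \<and> (\<alpha>, \<beta>) \<in> twist_pairs w v h k"
  by (auto simp: two_cylinder_params_def two_cylinder_def quads_def twist_pairs_def)

lemma card_two_cylinder_params:
  "finite (two_cylinder_params n)" "real (card (two_cylinder_params n)) = two_cylinder_count n"
proof -
  define Q where "Q = {(w, v, h, k). (w, v, h, k) \<in> quads n \<and> (w < v \<and> coprime h k)}"
  define P where "P = (SIGMA x:Q. case x of (w, v, h, k) \<Rightarrow> twist_pairs w v h k)"
  have fin: "finite Q" by (rule finite_subset[OF _ finite_quads[of n]]) (auto simp: Q_def)
  have bij: "bij_betw (\<lambda>((w, v, h, k), \<alpha>, \<beta>). (w, v, h, k, \<alpha>, \<beta>)) P (two_cylinder_params n)"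
    by (rule bij_betw_byWitness[of _ "\<lambda>(w, v, h, k, \<alpha>, \<beta>). ((w, v, h, k), \<alpha>, \<beta>)"])
       (auto simp: P_def Q_def two_cylinder_params_def)
  have finP: "finite P" unfolding P_def using fin finite_twist_pairs by (auto intro!: finite_SigmaI)
  show "finite (two_cylinder_params n)" using bij_betw_finite[OF bij] finP by simp
  have "card (two_cylinder_params n) = card P" using bij_betw_same_card[OF bij] by simp
  also have "\<dots> = (\<Sum>(w, v, h, k)\<in>Q. card (twist_pairs w v h k))"
    unfolding P_def using fin finite_twist_pairs by (subst card_SigmaI) (auto simp: case_prod_beta)
  finally show "real (card (two_cylinder_params n)) = two_cylinder_count n"
    by (simp add: two_cylinder_count_def Q_def case_prod_beta)
qed

text \<open>There is no factor 3: by \<open>coord_unique\<close> the corner alone on its orbit fixes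
  the roles of all three.\<close>

lemma card_two_cylinder_pairs:
  "card (pairsA n - one_cylinder_pairs n) = card (two_cylinder_params n) * fact n"
proof -
  define S where "S = (SIGMA x:two_cylinder_params n. case x of (w, v, h, k, \<alpha>, \<beta>) \<Rightarrow> bijections (cells w v h k) {1..n})"
  define F where "F = (\<lambda>((w, v, h, k, \<alpha>, \<beta>), f :: bool \<times> nat \<times> nat \<Rightarrow> nat).
    (transport f (cells w v h k) (right_cell w v), transport f (cells w v h k) (up_cell w v h k \<alpha> \<beta>)))"
  have co: "two_cylinder.coord n w v h k \<alpha> \<beta> f (fst (F ((w, v, h, k, \<alpha>, \<beta>), f))) (snd (F ((w, v, h, k, \<alpha>, \<beta>), f)))"
    "two_cylinder n w v h k \<alpha> \<beta>"
    if "((w, v, h, k, \<alpha>, \<beta>), f) \<in> S" for w v h k \<alpha> \<beta> f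
  proof -
    show tc: "two_cylinder n w v h k \<alpha> \<beta>" using that by (simp add: S_def two_cylinder_params_iff)
    interpret two_cylinder n w v h k \<alpha> \<beta> by fact
    have "f \<in> bijections M {1..n}" using that by (simp add: S_def)
    from coord_transport[OF this]
    show "two_cylinder.coord n w v h k \<alpha> \<beta> f (fst (F ((w, v, h, k, \<alpha>, \<beta>), f))) (snd (F ((w, v, h, k, \<alpha>, \<beta>), f)))"
      by (simp add: F_def)
  qed
  have "bij_betw F S (pairsA n - one_cylinder_pairs n)"
    unfolding bij_betw_def
  proof (intro conjI inj_onI equalityI image_subsetI subsetI)
    fix a b assume ab: "a \<in> S" "b \<in> S" "F a = F b"
    obtain w v h k \<alpha> \<beta> f where a: "a = ((w, v, h, k, \<alpha>, \<beta>), f)" by (metis prod.exhaust)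
    obtain w' v' h' k' \<alpha>' \<beta>' f' where b: "b = ((w', v', h', k', \<alpha>', \<beta>'), f')" by (metis prod.exhaust)
    have "two_cylinder.coord n w' v' h' k' \<alpha>' \<beta>' f' (fst (F a)) (snd (F a))"
      using co(1)[OF ab(2)[unfolded b]] ab(3) b by simp
    from coord_unique[OF co(2)[OF ab(1)[unfolded a]] co(2)[OF ab(2)[unfolded b]] co(1)[OF ab(1)[unfolded a]] this[unfolded a]]
    show "a = b" by (simp add: a b)
  next
    fix a assume aS: "a \<in> S"
    obtain w v h k \<alpha> \<beta> f where a: "a = ((w, v, h, k, \<alpha>, \<beta>), f)" by (metis prod.exhaust)
    obtain s t where F: "F a = (s, t)" by (cases "F a") auto
    have tc: "two_cylinder n w v h k \<alpha> \<beta>" and hk: "coprime h k" "(\<alpha>, \<beta>) \<in> twist_pairs w v h k"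
      using aS by (simp_all add: a S_def two_cylinder_params_iff)
    interpret two_cylinder n w v h k \<alpha> \<beta> by fact
    have c: "coord f s t" using co(1)[OF aS[unfolded a]] F a by simp
    have "(f (True, 0, 0), f (False, 0, 0)) \<notin> orel n s" "f (True, 0, 0) \<in> {1..n}" "f (False, 0, 0) \<in> {1..n}"
      using orel_corners(2)[OF c] f_in[OF c] corners_in by blast+
    hence "(s, t) \<notin> one_cylinder_pairs n" unfolding one_cylinder_pairs_def by blast
    thus "F a \<in> pairsA n - one_cylinder_pairs n" using coord_pairsA[OF c hk] F by simp
  next
    fix z assume "z \<in> pairsA n - one_cylinder_pairs n"
    then obtain s t where z: "z = (s, t)" and st: "(s, t) \<in> pairsA n" and nt: "orel n s \<noteq> {1..n} \<times> {1..n}"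
      by (cases z) (auto simp: one_cylinder_pairs_def)
    obtain p0 q0 r0 where c0: "commutator_is n s t p0 q0 r0" using st unfolding pairsA_iff by blast
    \<comment> \<open>Were all three corners on one orbit, the orbit relation would be stable and so
      total, contrary to the choice of the pair.\<close>
    have "\<exists>p q r. commutator_is n s t p q r \<and> (p, r) \<in> orel n s \<and> (p, q) \<notin> orel n s"
    proof (rule orbit_trichotomy[OF c0])
      assume rel: "(p0, q0) \<in> orel n s" "(q0, r0) \<in> orel n s"
      have "p0 \<noteq> q0" using commutator_isD(3)[OF c0] by simp
      from pairsA_D[OF st stable_equiv_orel_same_orbit(2)[OF c0 rel] rel(1) this] nt
      show ?thesis by blast
    qed blast
    then obtain p q r where c: "commutator_is n s t p q r" and pr: "(p, r) \<in> orel n s" and pq: "(p, q) \<notin> orel n s"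
      by blast
    obtain d where d: "d < least_power s p" "r = (s ^^ d) p" using orel_period[OF commutator_isD(1)[OF c] pr] by blast
    have "d \<noteq> 0" using commutator_isD(3)[OF c] d(2) by (intro notI) simp
    hence "0 < d" by simp
    interpret O: two_orbits n s t p q r d
      using two_orbits.intro[OF c d(2) \<open>0 < d\<close> d(1) pq] .
    from O.exists_coord[OF st] obtain \<alpha> \<beta> f where
      tc: "two_cylinder n O.w O.v (O.ret q) (O.ret p) \<alpha> \<beta>" and
      co': "two_cylinder.coord n O.w O.v (O.ret q) (O.ret p) \<alpha> \<beta> f s t" by blast
    interpret T: two_cylinder n O.w O.v "O.ret q" "O.ret p" \<alpha> \<beta> by fact
    let ?x = "(O.w, O.v, O.ret q, O.ret p, \<alpha>, \<beta>)"
    have "?x \<in> two_cylinder_params n"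
      unfolding two_cylinder_params_iff using tc T.pairsA_coord_coprime[OF co' st] by blast
    moreover have "f \<in> bijections T.M {1..n}" using modelledD(2)[OF co'[unfolded T.coord_def]] .
    ultimately have "(?x, f) \<in> S" by (simp add: S_def)
    moreover have "F (?x, f) = z" using T.coord_transport_unique[OF co'] by (simp add: F_def z)
    ultimately show "z \<in> F ` S" by (metis imageI)
  qed
  hence "card (pairsA n - one_cylinder_pairs n) = card S" using bij_betw_same_card by metis
  also have "\<dots> = (\<Sum>x\<in>two_cylinder_params n. fact n)"
  proof -
    have bij: "finite (bijections (cells w v h k) {1..n})" "card (bijections (cells w v h k) {1..n}) = fact n"
      if "(w, v, h, k, \<alpha>, \<beta>) \<in> two_cylinder_params n" for w v h k \<alpha> \<beta>
    proof -
      interpret two_cylinder n w v h k \<alpha> \<beta> using that by (simp add: two_cylinder_params_iff)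
      show "finite (bijections M {1..n})" "card (bijections M {1..n}) = fact n"
        using card_bijections[OF finite_cells, of "{1..n}"] card_cells by simp_all
    qed
    have "card S = (\<Sum>x\<in>two_cylinder_params n.
        card (case x of (w, v, h, k, \<alpha>, \<beta>) \<Rightarrow> bijections (cells w v h k) {1..n}))"
      unfolding S_def by (rule card_SigmaI) (use card_two_cylinder_params(1) bij(1) in auto)
    also have "\<dots> = (\<Sum>x\<in>two_cylinder_params n. fact n)"
      by (rule sum.cong[OF refl]) (use bij(2) in \<open>auto simp del: One_nat_def\<close>)
    finally show ?thesis .
  qed
  finally show ?thesis by simp
qed

theorem mainTheorem18:
  fixes n :: nat
  assumes "n > 2"
  shows "real (card (pairsA n)) = 3 / 8 * (real n - 2) * jordan_totient2 n * fact n"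
proof -
  have sub: "one_cylinder_pairs n \<subseteq> pairsA n" by (auto simp: one_cylinder_pairs_def)
  have "card (pairsA n) = card (one_cylinder_pairs n) + card (pairsA n - one_cylinder_pairs n)"
    using card_Diff_subset[OF finite_subset[OF sub finite_pairsA] sub] card_mono[OF finite_pairsA sub] by simp
  moreover have "3 * real (card (one_cylinder_pairs n)) = real (card (gap_pairs n)) * real n * fact n"
  proof -
    have "real (3 * card (one_cylinder_pairs n)) = real (card (gap_pairs n) * n * fact n)"
      using assms by (simp only: card_one_cylinder_pairs)
    thus ?thesis by simp
  qed
  moreover have "real (card (pairsA n - one_cylinder_pairs n)) = two_cylinder_count n * fact n"
    unfolding card_two_cylinder_pairs by (simp add: card_two_cylinder_params(2))
  ultimately have "real (card (pairsA n)) = (real n / 3 * real (card (gap_pairs n)) + two_cylinder_count n) * fact n"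
    by (simp add: algebra_simps)
  also have "\<dots> = 3 / 8 * (real n - 2) * jordan_totient2 n * fact n"
    using cylinder_counts_eq_jordan_totient2[of n] assms by simp
  finally show ?thesis .
qed

end
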